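(* Let $\mathcal{V}:[0,T]\times\mathcal{P}^1(\mathbb{T}^d)\rightrightarrows C(\mathbb{T}^d)$ be an upper semicontinuous multifunction that is viable with respect to the mean field game dynamics, and assume that $\mathcal{V}(T,m)=\{\sigma(\cdot,m)\}$ for every $m\in\mathcal{P}^1(\mathbb{T}^d)$. Then $\mathcal{V}$ is a value multifunction of the mean field game with data $(f,g,\sigma)$.
   Context: **Setting.** Fix $T>0$, $d\ge 1$. $\mathbb{T}^d=\mathbb{R}^d/\mathbb{Z}^d$ carries its quotient metric, written $\|x'-x''\|$; $\mathbb{T}^d\times\mathbb{R}$ carries the metric $\|x'-x''\|+|z'-z''|$, and $\mathrm{p}:\mathbb{T}^d\times\mathbb{R}\to\mathbb{T}^d$ is the projection. For a separable metric space $X$, $\mathcal{P}^1(X)$ is the set of Borel probabilities on $X$ with finite first moment, with the 1-Wasserstein metric $W_1$; $h_\#m$ is the push-forward of $m$ by $h$. $C(\mathbb{T}^d)$ carries the sup-norm $\|\cdot\|$. **Standing assumptions.** $U$ is a compact metric space; $f:[0,T]\times\mathbb{T}^d\times\mathcal{P}^1(\mathbb{T}^d)\times U\to\mathbb{R}^d$, $g:[0,T]\times\mathbb{T}^d\times\mathcal{P}^1(\mathbb{T}^d)\times U\to\mathbb{R}$, $\sigma:\mathbb{T}^d\times\mathcal{P}^1(\mathbb{T}^d)\to\mathbb{R}$ are continuous; there is $\alpha:\mathbb{R}\to[0,\infty)$ with $\alpha(\delta)\to0$ as $\delta\to0$ such that $\|f(t',x,m,u)-f(t'',x,m,u)\|\le\alpha(t'-t'')$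 and $|g(t',x,m,u)-g(t'',x,m,u)|\le\alpha(t'-t'')$ for all arguments; there is $L$ with $\|f(t,x',m',u)-f(t,x'',m'',u)\|\le L(\|x'-x''\|+W_1(m',m''))$ and the same bound for $g$; there is $\varkappa$ with $|\sigma(x',m)-\sigma(x'',m)|\le\varkappa\|x'-x''\|$. **Dynamics.** $F(t,x,m)=\mathrm{co}\{(f(t,x,m,u),g(t,x,m,u)):u\in U\}\subset\mathbb{R}^{d+1}$. $\mathcal{C}_{s,r}=C([s,r];\mathbb{T}^d\times\mathbb{R})$ (sup metric); for $w(\cdot)=(x(\cdot),z(\cdot))\in\mathcal{C}_{s,r}$, $e_t(w(\cdot))=x(t)$, $\hat e_t(w(\cdot))=w(t)$. $\mathcal{M}_{s,r}$ (resp. $\mathcal{N}_{s,r}$) is the set of measurable functions from $[s,r]$ to $\mathcal{P}^1(\mathbb{T}^d)$ (resp. $\mathcal{P}^1(\mathbb{T}^d\times\mathbb{R})$). For $m(\cdot)\in\mathcal{M}_{s,r}$, $y\in\mathbb{T}^d$, $\mathrm{Sol}(r,s,y,m(\cdot))$ is the set of absolutely continuous $(x(\cdot),z(\cdot))\in\mathcal{C}_{s,r}$ with $(\dot x(t),\dot z(t))\in F(t,x(t),m(t))$ for a.e. $t\in[s,r]$ and $x(s)=y$ ($z(s)$ is arbitrary); $\mathrm{SOL}(r,s,m(\cdot))=\bigcup_{y}\mathrm{Sol}(r,s,y,m(\cdot))$. **MFDI.** $\nu(\cdot)\in\mathcal{N}_{s,r}$ *solves the MFDI* on $[s,r]$ if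 there is $\chi\in\mathcal{P}^1(\mathcal{C}_{s,r})$ with $\nu(t)=\hat e_t{}_\#\chi$ for all $t\in[s,r]$ and $\mathrm{supp}(\chi)\subset\mathrm{SOL}(r,s,m(\cdot))$ where $m(t)=\mathrm{p}_\#\nu(t)$. **Notation.** $(B^{s,r}_{m(\cdot)}\psi)(y)=\sup\{\psi(x(r))+z(r)-z(s):(x(\cdot),z(\cdot))\in\mathrm{Sol}(r,s,y,m(\cdot))\}$ for $\psi\in C(\mathbb{T}^d)$. $[\phi,\nu]=\int_{\mathbb{T}^d\times\mathbb{R}}(\phi(x)+z)\,\nu(d(x,z))$. **Solution of the mean field game.** Each player has dynamics $\dot x=f(t,x,m(t),u)$ and maximizes $\sigma(x(T),m(T))+\int_{t_0}^T g(t,x,m(t),u)\,dt$. A pair $(V,m(\cdot))$ with $V:[t_0,T]\times\mathbb{T}^d\to\mathbb{R}$ continuous and $m(\cdot)\in\mathcal{M}_{t_0,T}$ is a solution if there is $\chi\in\mathcal{P}^1(\mathcal{C}_{t_0,T})$ such that: (1) $m(t)=e_t{}_\#\chi$; (2) $V(s,y)$ is the maximum of $\sigma(x(T),m(T))+z(T)-z(s)$ over $(x(\cdot),z(\cdot))\in\mathrm{Sol}(T,s,y,m(\cdot))$; (3) $\mathrm{supp}(\chi)\subset\mathrm{SOL}(T,t_0,m(\cdot))$; (4) for all $s<r$ in $[t_0,T]$ and all $(x(\cdot),z(\cdot))\in\mathrm{supp}(\chi)$, $V(s,x(s))+z(s)=V(r,x(r))+z(r)$. **Value multifunction.** A multifunction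 $\mathcal{V}$ is upper semicontinuous if its graph is closed: $(t_i,m_i)\to(t,m)$, $\phi_i\in\mathcal{V}(t_i,m_i)$, $\|\phi_i-\phi\|\to0$ imply $\phi\in\mathcal{V}(t,m)$. An upper semicontinuous $\mathcal{V}:[0,T]\times\mathcal{P}^1(\mathbb{T}^d)\rightrightarrows C(\mathbb{T}^d)$ is a value multifunction if for all $t_0\in[0,T]$, $m_0\in\mathcal{P}^1(\mathbb{T}^d)$, $\phi\in\mathcal{V}(t_0,m_0)$ there is a solution $(V,m(\cdot))$ of the mean field game on $[t_0,T]$ with $V(t_0,\cdot)=\phi$ and $m(t_0)=m_0$. **Mean field game dynamics.** For $s\le r$ in $[0,T]$, $\Psi^{r,s}:\mathcal{P}^1(\mathbb{T}^d)\times C(\mathbb{T}^d)\rightrightarrows\mathcal{P}^1(\mathbb{T}^d)\times C(\mathbb{T}^d)$ is defined by: $(\mu,\psi)\in\Psi^{r,s}(m,\phi)$ iff there is a solution $\nu(\cdot)$ of the MFDI on $[s,r]$ such that, with $m(t)=\mathrm{p}_\#\nu(t)$: $m(s)=m$, $m(r)=\mu$; $\phi=B^{s,r}_{m(\cdot)}\psi$; $[\psi,\nu(r)]\ge[\phi,\nu(s)]$. In particular $\Psi^{s,s}(m,\phi)=\{(m,\phi)\}$. **Viability.** An upper semicontinuous $\mathcal{V}:[0,T]\times\mathcal{P}^1(\mathbb{T}^d)\rightrightarrows C(\mathbb{T}^d)$ is viable with respect to the mean field game dynamics if for all $s\le r$ in $[0,T]$, $m\in\mathcal{P}^1(\mathbb{T}^d)$,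 $\phi\in\mathcal{V}(s,m)$ there are $\mu\in\mathcal{P}^1(\mathbb{T}^d)$ and $\psi\in C(\mathbb{T}^d)$ with $(\mu,\psi)\in\Psi^{r,s}(m,\phi)$ and $\psi\in\mathcal{V}(r,\mu)$. *)

theory Defs
  imports "HOL-Probability.Probability"
begin

section \<open>The flat torus\<close>

definition int_lattice :: "(real ^ 'n::finite) set"
  where "int_lattice = {k. \<forall>i. k $ i \<in> \<int>}"

lemma int_lattice_0 [simp]: "0 \<in> int_lattice"
  and int_lattice_add: "k \<in> int_lattice \<Longrightarrow> l \<in> int_lattice \<Longrightarrow> k + l \<in> int_lattice"
  and int_lattice_diff: "k \<in> int_lattice \<Longrightarrow> l \<in> int_lattice \<Longrightarrow> k - l \<in> int_lattice"
  and int_lattice_minus: "k \<in> int_lattice \<Longrightarrow> - k \<in> int_lattice"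
  by (auto simp: int_lattice_def)

definition torus_rel :: "real ^ 'n::finite \<Rightarrow> real ^ 'n \<Rightarrow> bool"
  where "torus_rel x y \<longleftrightarrow> x - y \<in> int_lattice"

lemma equivp_torus_rel: "equivp torus_rel"
proof (rule equivpI)
  show "reflp torus_rel"
    by (simp add: reflp_def torus_rel_def)
  show "symp torus_rel"
    unfolding symp_def torus_rel_def using int_lattice_minus by fastforce
  show "transp torus_rel"
    unfolding transp_def torus_rel_def using int_lattice_add by fastforce
qed

quotient_type (overloaded) 'n torus = "real ^ ('n::finite)" / torus_rel
  morphisms rep_torus torus_of
  by (rule equivp_torus_rel)

instantiation torus :: (finite) metric_space
begin

lift_definition dist_torus :: "'a torus \<Rightarrow> 'a torus \<Rightarrow> real"
  is "\<lambda>x y. INF k\<in>int_lattice. norm (x - y - k)"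
proof -
  fix x x' y y' :: "real ^ 'a"
  assume "torus_rel x x'" "torus_rel y y'"
  then have l: "(x - x') - (y - y') \<in> int_lattice" (is "?l \<in> _")
    by (auto simp: torus_rel_def intro: int_lattice_diff)
  have "(\<lambda>k. norm (x - y - k)) ` int_lattice = (\<lambda>k. norm (x' - y' - k)) ` int_lattice"
  proof (intro antisym image_subsetI)
    fix k :: "real ^ 'a"
    assume "k \<in> int_lattice"
    then have k: "k - ?l \<in> int_lattice" "k + ?l \<in> int_lattice"
      using l by (auto intro: int_lattice_diff int_lattice_add)
    have e: "x - y - k = x' - y' - (k - ?l)" "x' - y' - k = x - y - (k + ?l)"
      by simp_all
    show "norm (x - y - k) \<in> (\<lambda>k. norm (x' - y' - k)) ` int_lattice"
      by (rule image_eqI[OF _ k(1)]) (simp only: e(1))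
    show "norm (x' - y' - k) \<in> (\<lambda>k. norm (x - y - k)) ` int_lattice"
      by (rule image_eqI[OF _ k(2)]) (simp only: e(2))
  qed
  then show "(INF k\<in>int_lattice. norm (x - y - k)) = (INF k\<in>int_lattice. norm (x' - y' - k))"
    by simp
qed

definition uniformity_torus :: "('a torus \<times> 'a torus) filter"
  where "uniformity_torus = (INF e\<in>{0<..}. principal {(x, y). dist x y < e})"

definition open_torus :: "'a torus set \<Rightarrow> bool"
  where "open_torus S \<longleftrightarrow> (\<forall>x\<in>S. \<forall>\<^sub>F (x', y) in uniformity. x' = x \<longrightarrow> y \<in> S)"

instance
proof
  have bdd: "bdd_below ((\<lambda>k. norm (z - k)) ` int_lattice)" for z :: "real ^ 'a"
    by (rule bdd_belowI[of _ 0]) auto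
  have ne: "(int_lattice :: (real ^ 'a) set) \<noteq> {}"
    using int_lattice_0 by blast
  have approx: "\<exists>k\<in>int_lattice. norm (z - k) < (INF k\<in>int_lattice. norm (z - k)) + e"
    if "e > 0" for z :: "real ^ 'a" and e
    using cInf_lessD[of "(\<lambda>k. norm (z - k)) ` int_lattice"
        "(INF k\<in>int_lattice. norm (z - k)) + e"] ne that by auto
  show "dist x y = 0 \<longleftrightarrow> x = y" for x y :: "'a torus"
  proof (transfer, rule iffI)
    fix x y :: "real ^ 'a"
    assume 0: "(INF k\<in>int_lattice. norm (x - y - k)) = 0"
    have "(x - y) $ i \<in> closure \<int>" for i
    proof (unfold closure_approachable, intro allI impI)
      fix e :: real
      assume "e > 0"
      with approx[of e "x - y"] 0 obtain k where k: "k \<in> int_lattice" "norm (x - y - k) < e"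
        by auto
      then have "\<bar>(x - y - k) $ i\<bar> < e"
        using component_le_norm_cart[of "x - y - k" i] by linarith
      with k show "\<exists>j\<in>\<int>. dist j ((x - y) $ i) < e"
        by (intro bexI[of _ "k $ i"]) (auto simp: int_lattice_def dist_real_def)
    qed
    then show "torus_rel x y"
      by (auto simp: torus_rel_def int_lattice_def closure_closed)
  next
    fix x y :: "real ^ 'a"
    assume "torus_rel x y"
    then have "(INF k\<in>int_lattice. norm (x - y - k)) \<le> norm (x - y - (x - y))"
      by (intro cINF_lower bdd) (simp add: torus_rel_def)
    moreover have "0 \<le> (INF k\<in>int_lattice. norm (x - y - k))"
      by (rule cINF_greatest[OF ne]) simp
    ultimately show "(INF k\<in>int_lattice. norm (x - y - k)) = 0"
      by simp
  qed
  show "dist x y \<le> dist x z + dist y z" for x y z :: "'a torus"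
  proof (transfer, rule field_le_epsilon)
    fix x y z :: "real ^ 'a" and e :: real
    assume "e > 0"
    then obtain k l where k: "k \<in> int_lattice"
        "norm (x - z - k) < (INF k\<in>int_lattice. norm (x - z - k)) + e / 2"
      and l: "l \<in> int_lattice"
        "norm (y - z - l) < (INF k\<in>int_lattice. norm (y - z - k)) + e / 2"
      using approx[of "e / 2" "x - z"] approx[of "e / 2" "y - z"] by auto
    have "(INF k\<in>int_lattice. norm (x - y - k)) \<le> norm (x - y - (k - l))"
      using k l by (intro cINF_lower bdd) (auto intro: int_lattice_diff)
    also have "\<dots> = norm ((x - z - k) - (y - z - l))"
      by (simp add: algebra_simps)
    also have "\<dots> \<le> norm (x - z - k) + norm (y - z - l)"
      by (rule norm_triangle_ineq4)
    finally show "(INF k\<in>int_lattice. norm (x - y - k)) \<le>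
        (INF k\<in>int_lattice. norm (x - z - k)) + (INF k\<in>int_lattice. norm (y - z - k)) + e"
      using k l by linarith
  qed
qed (simp_all only: uniformity_torus_def open_torus_def)

end

lemma dist_torus_of_le: "dist (torus_of x) (torus_of y) \<le> dist x y"
  unfolding dist_torus.abs_eq dist_norm
  by (rule cINF_lower2[of _ _ 0]) (auto intro!: bdd_belowI[of _ 0])

lemma compact_torus: "compact (UNIV :: 'n::finite torus set)"
proof -
  have "continuous_on S torus_of" for S :: "(real ^ 'n) set"
    unfolding continuous_on_iff by (meson dist_torus_of_le le_less_trans)
  then have "compact (torus_of ` cbox 0 (1 :: real ^ 'n))"
    by (intro compact_continuous_image compact_cbox)
  moreover have "q \<in> torus_of ` cbox 0 (1 :: real ^ 'n)" for q
  proof -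
    obtain x where x: "q = torus_of x"
      by (metis Quotient_torus Quotient_abs_rep)
    have "torus_rel x (\<chi> i. frac (x $ i))"
      by (simp add: torus_rel_def int_lattice_def frac_def)
    then have "q = torus_of (\<chi> i. frac (x $ i))"
      using x by (simp add: torus.abs_eq_iff)
    then show ?thesis
      by (auto simp: mem_box_cart frac_lt_1 less_imp_le)
  qed
  ultimately show ?thesis
    by (metis UNIV_eq_I)
qed

text \<open>\<open>'n torus \<Rightarrow>\<^sub>C real\<close>, with its supremum norm, is therefore the whole of
  \<open>C(\<T>\<^sup>d)\<close>.\<close>

lemma apply_bcontfun_torus:
  fixes h :: "'n::finite torus \<Rightarrow> 'b::metric_space"
  assumes "continuous_on UNIV h"
  shows "apply_bcontfun (Bcontfun h) = h"
  using compact_continuous_image[OF assms compact_torus] assms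
  by (intro Bcontfun_inverse) (simp add: bcontfun_def compact_imp_bounded)

definition sum_metric :: "('a::metric_space \<times> 'b::metric_space) metric"
  where "sum_metric = metric (UNIV, \<lambda>p q. dist (fst p) (fst q) + dist (snd p) (snd q))"

lemma Metric_space_sum:
  "Metric_space UNIV
     (\<lambda>p q :: 'a::metric_space \<times> 'b::metric_space. dist (fst p) (fst q) + dist (snd p) (snd q))"
proof
  fix p q :: "'a \<times> 'b"
  show "dist (fst p) (fst q) + dist (snd p) (snd q) = 0 \<longleftrightarrow> p = q"
    by (simp add: add_nonneg_eq_0_iff prod_eq_iff)
next
  fix p q r :: "'a \<times> 'b"
  show "dist (fst p) (fst r) + dist (snd p) (snd r) \<le>
      (dist (fst p) (fst q) + dist (snd p) (snd q)) + (dist (fst q) (fst r) + dist (snd q) (snd r))"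
    using dist_triangle[of "fst p" "fst r" "fst q"] dist_triangle[of "snd p" "snd r" "snd q"]
    by linarith
qed (simp_all add: dist_commute)

lemma mspace_sum_metric [simp]: "mspace sum_metric = UNIV"
  and mdist_sum_metric [simp]:
    "mdist sum_metric p q = dist (fst p) (fst q) + dist (snd p) (snd q)"
  by (simp_all add: sum_metric_def Metric_space.mspace_metric[OF Metric_space_sum]
      Metric_space.mdist_metric[OF Metric_space_sum])

lemma mtopology_of_sum_metric [simp]:
  "mtopology_of (sum_metric :: ('a::metric_space \<times> 'b::metric_space) metric) = euclidean"
proof -
  let ?X = "sum_metric :: ('a \<times> 'b) metric"
  have le1: "dist p q \<le> mdist ?X p q" for p q :: "'a \<times> 'b"
    using sqrt_sum_squares_le_sum[of "dist (fst p) (fst q)" "dist (snd p) (snd q)"]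
    by (simp add: dist_prod_def)
  have le2: "mdist ?X p q \<le> 2 * dist p q" for p q :: "'a \<times> 'b"
    using dist_fst_le[of p q] dist_snd_le[of p q] by simp
  have "openin (mtopology_of ?X) S \<longleftrightarrow> open S" for S
  proof -
    have "openin (mtopology_of ?X) S \<longleftrightarrow> (\<forall>x\<in>S. \<exists>e>0. \<forall>y. mdist ?X y x < e \<longrightarrow> y \<in> S)"
      unfolding mtopology_of_def Metric_space.openin_mtopology[OF Metric_space_mspace_mdist]
        subset_iff Metric_space.in_mball[OF Metric_space_mspace_mdist]
      by (simp only: mspace_sum_metric UNIV_I simp_thms mdist_commute Ball_def)
    also have "\<dots> \<longleftrightarrow> (\<forall>x\<in>S. \<exists>e>0. \<forall>y. dist y x < e \<longrightarrow> y \<in> S)"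
    proof (intro ball_cong refl iffI; elim exE conjE)
      fix x e
      assume "e > 0" "\<forall>y. mdist ?X y x < e \<longrightarrow> y \<in> S"
      moreover have "mdist ?X y x < e" if "dist y x < e / 2" for y
        using le2[of y x] that by linarith
      ultimately show "\<exists>e>0. \<forall>y. dist y x < e \<longrightarrow> y \<in> S"
        by (meson half_gt_zero)
    next
      fix x e
      assume "e > 0" "\<forall>y. dist y x < e \<longrightarrow> y \<in> S"
      then show "\<exists>e>0. \<forall>y. mdist ?X y x < e \<longrightarrow> y \<in> S"
        by (meson le1 le_less_trans)
    qed
    finally show ?thesis
      by (simp add: open_dist)
  qed
  then show ?thesis
    by (auto simp: topology_eq)
qed


section \<open>Wasserstein spaces\<close>

definition borel_of :: "'a topology \<Rightarrow> 'a measure"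
  where "borel_of X = sigma (topspace X) {S. openin X S}"

lemma borel_of_euclidean [simp]: "borel_of euclidean = borel"
  by (simp add: borel_of_def borel_def)

definition P1 :: "'a metric \<Rightarrow> 'a measure set"
  where "P1 X = {M. sets M = sets (borel_of (mtopology_of X)) \<and> prob_space M \<and>
    (\<exists>x0\<in>mspace X. integrable M (\<lambda>x. mdist X x0 x))}"

definition couplings :: "'a metric \<Rightarrow> 'a measure \<Rightarrow> 'a measure \<Rightarrow> ('a \<times> 'a) measure set"
  where "couplings X M N = {\<pi>.
    sets \<pi> = sets (borel_of (mtopology_of X) \<Otimes>\<^sub>M borel_of (mtopology_of X)) \<and>
    distr \<pi> (borel_of (mtopology_of X)) fst = M \<and>
    distr \<pi> (borel_of (mtopology_of X)) snd = N}"

definition W1 :: "'a metric \<Rightarrow> 'a measure \<Rightarrow> 'a measure \<Rightarrow> real"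
  where "W1 X M N = (INF \<pi>\<in>couplings X M N. \<integral>p. mdist X (fst p) (snd p) \<partial>\<pi>)"

text \<open>The metric topology of \<open>W1 X\<close> on \<open>P1 X\<close>, written out so that no proof of the
  triangle inequality is needed in order to state it.\<close>

definition P1_topology :: "'a metric \<Rightarrow> 'a measure topology"
  where "P1_topology X = topology (\<lambda>S. S \<subseteq> P1 X \<and>
    (\<forall>M\<in>S. \<exists>e>0. \<forall>N\<in>P1 X. W1 X M N < e \<longrightarrow> N \<in> S))"

lemma openin_P1_topology:
  "openin (P1_topology X) S \<longleftrightarrow>
     S \<subseteq> P1 X \<and> (\<forall>M\<in>S. \<exists>e>0. \<forall>N\<in>P1 X. W1 X M N < e \<longrightarrow> N \<in> S)"
proof -
  have "istopology (\<lambda>S. S \<subseteq> P1 X \<and> (\<forall>M\<in>S. \<exists>e>0. \<forall>N\<in>P1 X. W1 X M N < e \<longrightarrow> N \<in> S))"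
    unfolding istopology_def
  proof (intro conjI allI impI; (elim conjE)?)
    fix S S' :: "'a measure set"
    assume *: "\<forall>M\<in>S. \<exists>e>0. \<forall>N\<in>P1 X. W1 X M N < e \<longrightarrow> N \<in> S"
      "\<forall>M\<in>S'. \<exists>e>0. \<forall>N\<in>P1 X. W1 X M N < e \<longrightarrow> N \<in> S'"
    show "\<forall>M\<in>S \<inter> S'. \<exists>e>0. \<forall>N\<in>P1 X. W1 X M N < e \<longrightarrow> N \<in> S \<inter> S'"
    proof
      fix M
      assume "M \<in> S \<inter> S'"
      with * obtain e e' where "e > 0" "\<forall>N\<in>P1 X. W1 X M N < e \<longrightarrow> N \<in> S"
        "e' > 0" "\<forall>N\<in>P1 X. W1 X M N < e' \<longrightarrow> N \<in> S'"
        by blast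
      then show "\<exists>e>0. \<forall>N\<in>P1 X. W1 X M N < e \<longrightarrow> N \<in> S \<inter> S'"
        by (intro exI[of _ "min e e'"]) auto
    qed
  next
    fix \<K> :: "'a measure set set"
    assume *: "\<forall>S\<in>\<K>. S \<subseteq> P1 X \<and> (\<forall>M\<in>S. \<exists>e>0. \<forall>N\<in>P1 X. W1 X M N < e \<longrightarrow> N \<in> S)"
    then show "\<Union>\<K> \<subseteq> P1 X"
      by blast
    show "\<forall>M\<in>\<Union>\<K>. \<exists>e>0. \<forall>N\<in>P1 X. W1 X M N < e \<longrightarrow> N \<in> \<Union>\<K>"
      using * by (meson Union_iff)
  qed blast
  then show ?thesis
    by (simp add: P1_topology_def topology_inverse')
qed

lemma topspace_P1_topology [simp]: "topspace (P1_topology X) = P1 X"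
proof (rule antisym)
  show "topspace (P1_topology X) \<subseteq> P1 X"
    using openin_P1_topology openin_topspace by blast
  show "P1 X \<subseteq> topspace (P1_topology X)"
    by (rule openin_subset) (auto simp: openin_P1_topology intro: exI[of _ 1])
qed

definition measure_supp :: "'a metric \<Rightarrow> 'a measure \<Rightarrow> 'a set"
  where "measure_supp X M =
    {x \<in> mspace X. \<forall>S. openin (mtopology_of X) S \<and> x \<in> S \<longrightarrow> emeasure M S > 0}"


section \<open>Dynamics\<close>

definition curves :: "real \<Rightarrow> real \<Rightarrow> (real \<Rightarrow> 'n::finite torus \<times> real) metric"
  where "curves s r = cfunspace (top_of_set {s..r}) sum_metric"

definition measure_flows :: "'a metric \<Rightarrow> real \<Rightarrow> real \<Rightarrow> (real \<Rightarrow> 'a measure) set"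
  where "measure_flows X s r = restrict_space borel {s..r} \<rightarrow>\<^sub>M borel_of (P1_topology X)"

definition absolutely_continuous_on :: "real \<Rightarrow> real \<Rightarrow> (real \<Rightarrow> 'a::metric_space) \<Rightarrow> bool"
  where "absolutely_continuous_on s r W \<longleftrightarrow>
    (\<forall>\<epsilon>>0. \<exists>\<delta>>0. \<forall>n (a :: nat \<Rightarrow> real) b.
      (\<forall>i<n. s \<le> a i \<and> a i \<le> b i \<and> b i \<le> r) \<and>
      disjoint_family_on (\<lambda>i. {a i<..<b i}) {..<n} \<and>
      (\<Sum>i<n. b i - a i) < \<delta> \<longrightarrow>
      (\<Sum>i<n. dist (W (a i)) (W (b i))) < \<epsilon>)"

definition velocities ::
    "(real \<Rightarrow> 'n::finite torus \<Rightarrow> 'n torus measure \<Rightarrow> 'u \<Rightarrow> real ^ 'n) \<Rightarrow>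
     (real \<Rightarrow> 'n torus \<Rightarrow> 'n torus measure \<Rightarrow> 'u \<Rightarrow> real) \<Rightarrow> 'u set \<Rightarrow>
     real \<Rightarrow> 'n torus \<Rightarrow> 'n torus measure \<Rightarrow> ((real ^ 'n) \<times> real) set"
  where "velocities f g U t x m = convex hull ((\<lambda>u. (f t x m u, g t x m u)) ` U)"

text \<open>Absolute continuity and the velocity of a curve in \<open>\<T>\<^sup>d \<times> \<real>\<close> are those of a lift \<open>W\<close>
  of the curve to \<open>\<real>\<^sup>d \<times> \<real>\<close>; the choice of the lift does not matter, since two continuous lifts
  differ by a constant vector of \<open>int_lattice\<close>.\<close>

definition Sol ::
    "(real \<Rightarrow> 'n::finite torus \<Rightarrow> 'n torus measure \<Rightarrow> 'u \<Rightarrow> real ^ 'n) \<Rightarrow>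
     (real \<Rightarrow> 'n torus \<Rightarrow> 'n torus measure \<Rightarrow> 'u \<Rightarrow> real) \<Rightarrow> 'u set \<Rightarrow>
     real \<Rightarrow> real \<Rightarrow> 'n torus \<Rightarrow> (real \<Rightarrow> 'n torus measure) \<Rightarrow> (real \<Rightarrow> 'n torus \<times> real) set"
  where "Sol f g U r s y m = {w \<in> mspace (curves s r). fst (w s) = y \<and>
    (\<exists>W :: real \<Rightarrow> (real ^ 'n) \<times> real.
      (\<forall>t\<in>{s..r}. w t = (torus_of (fst (W t)), snd (W t))) \<and>
      absolutely_continuous_on s r W \<and>
      (AE t in lebesgue. t \<in> {s..r} \<longrightarrow>
        (\<exists>v \<in> velocities f g U t (fst (w t)) (m t).
          (W has_vector_derivative v) (at t within {s..r}))))}"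

definition SOL ::
    "(real \<Rightarrow> 'n::finite torus \<Rightarrow> 'n torus measure \<Rightarrow> 'u \<Rightarrow> real ^ 'n) \<Rightarrow>
     (real \<Rightarrow> 'n torus \<Rightarrow> 'n torus measure \<Rightarrow> 'u \<Rightarrow> real) \<Rightarrow> 'u set \<Rightarrow>
     real \<Rightarrow> real \<Rightarrow> (real \<Rightarrow> 'n torus measure) \<Rightarrow> (real \<Rightarrow> 'n torus \<times> real) set"
  where "SOL f g U r s m = (\<Union>y. Sol f g U r s y m)"

definition solves_MFDI ::
    "(real \<Rightarrow> 'n::finite torus \<Rightarrow> 'n torus measure \<Rightarrow> 'u \<Rightarrow> real ^ 'n) \<Rightarrow>
     (real \<Rightarrow> 'n torus \<Rightarrow> 'n torus measure \<Rightarrow> 'u \<Rightarrow> real) \<Rightarrow> 'u set \<Rightarrow>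
     real \<Rightarrow> real \<Rightarrow> (real \<Rightarrow> ('n torus \<times> real) measure) \<Rightarrow> bool"
  where "solves_MFDI f g U s r \<nu> \<longleftrightarrow> \<nu> \<in> measure_flows sum_metric s r \<and>
    (\<exists>\<gamma>\<in>P1 (curves s r).
      (\<forall>t\<in>{s..r}. \<nu> t = distr \<gamma> borel (\<lambda>w. w t)) \<and>
      measure_supp (curves s r) \<gamma> \<subseteq> SOL f g U r s (\<lambda>t. distr (\<nu> t) borel fst))"


section \<open>Mean field games\<close>

definition MFG_solution ::
    "real \<Rightarrow> (real \<Rightarrow> 'n::finite torus \<Rightarrow> 'n torus measure \<Rightarrow> 'u \<Rightarrow> real ^ 'n) \<Rightarrow>
     (real \<Rightarrow> 'n torus \<Rightarrow> 'n torus measure \<Rightarrow> 'u \<Rightarrow> real) \<Rightarrow> 'u set \<Rightarrow>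
     ('n torus \<Rightarrow> 'n torus measure \<Rightarrow> real) \<Rightarrow> real \<Rightarrow>
     (real \<Rightarrow> 'n torus \<Rightarrow> real) \<Rightarrow> (real \<Rightarrow> 'n torus measure) \<Rightarrow> bool"
  where "MFG_solution T f g U \<sigma> t0 V m \<longleftrightarrow>
    continuous_on ({t0..T} \<times> UNIV) (\<lambda>(t, x). V t x) \<and>
    m \<in> measure_flows euclidean_metric t0 T \<and>
    (\<exists>\<gamma>\<in>P1 (curves t0 T).
      (\<forall>t\<in>{t0..T}. m t = distr \<gamma> borel (\<lambda>w. fst (w t))) \<and>
      (\<forall>s\<in>{t0..T}. \<forall>y.
        (\<exists>w\<in>Sol f g U T s y m. V s y = \<sigma> (fst (w T)) (m T) + snd (w T) - snd (w s)) \<and>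
        (\<forall>w\<in>Sol f g U T s y m. \<sigma> (fst (w T)) (m T) + snd (w T) - snd (w s) \<le> V s y)) \<and>
      measure_supp (curves t0 T) \<gamma> \<subseteq> SOL f g U T t0 m \<and>
      (\<forall>s\<in>{t0..T}. \<forall>r\<in>{t0..T}. s < r \<longrightarrow> (\<forall>w\<in>measure_supp (curves t0 T) \<gamma>.
        V s (fst (w s)) + snd (w s) = V r (fst (w r)) + snd (w r))))"

definition upper_semicontinuous ::
    "real \<Rightarrow> (real \<Rightarrow> 'n::finite torus measure \<Rightarrow> ('n torus \<Rightarrow>\<^sub>C real) set) \<Rightarrow> bool"
  where "upper_semicontinuous T \<V> \<longleftrightarrow>
    (\<forall>ts ms \<phi>s t m \<phi>.
      (\<forall>i :: nat. ts i \<in> {0..T} \<and> ms i \<in> P1 euclidean_metric \<and> \<phi>s i \<in> \<V> (ts i) (ms i)) \<and>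
      t \<in> {0..T} \<and> m \<in> P1 euclidean_metric \<and>
      ts \<longlonglongrightarrow> t \<and> (\<lambda>i. W1 euclidean_metric (ms i) m) \<longlonglongrightarrow> 0 \<and> \<phi>s \<longlonglongrightarrow> \<phi> \<longrightarrow>
      \<phi> \<in> \<V> t m)"

definition value_multifunction ::
    "real \<Rightarrow> (real \<Rightarrow> 'n::finite torus \<Rightarrow> 'n torus measure \<Rightarrow> 'u \<Rightarrow> real ^ 'n) \<Rightarrow>
     (real \<Rightarrow> 'n torus \<Rightarrow> 'n torus measure \<Rightarrow> 'u \<Rightarrow> real) \<Rightarrow> 'u set \<Rightarrow>
     ('n torus \<Rightarrow> 'n torus measure \<Rightarrow> real) \<Rightarrow>
     (real \<Rightarrow> 'n torus measure \<Rightarrow> ('n torus \<Rightarrow>\<^sub>C real) set) \<Rightarrow> bool"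
  where "value_multifunction T f g U \<sigma> \<V> \<longleftrightarrow> upper_semicontinuous T \<V> \<and>
    (\<forall>t0\<in>{0..T}. \<forall>m0\<in>P1 euclidean_metric. \<forall>\<phi>\<in>\<V> t0 m0.
      \<exists>V m. MFG_solution T f g U \<sigma> t0 V m \<and> V t0 = apply_bcontfun \<phi> \<and> m t0 = m0)"

text \<open>The supremum below is the one of \<open>\<real>\<close>; its set is nonempty and bounded whenever \<open>f\<close> and
  \<open>g\<close> satisfy the usual continuity assumptions, \<open>U\<close> is compact and nonempty, and \<open>m\<close> is a
  measurable flow.\<close>

definition bellman ::
    "(real \<Rightarrow> 'n::finite torus \<Rightarrow> 'n torus measure \<Rightarrow> 'u \<Rightarrow> real ^ 'n) \<Rightarrow>
     (real \<Rightarrow> 'n torus \<Rightarrow> 'n torus measure \<Rightarrow> 'u \<Rightarrow> real) \<Rightarrow> 'u set \<Rightarrow>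
     real \<Rightarrow> real \<Rightarrow> (real \<Rightarrow> 'n torus measure) \<Rightarrow> ('n torus \<Rightarrow>\<^sub>C real) \<Rightarrow> 'n torus \<Rightarrow> real"
  where "bellman f g U s r m \<psi> y =
    (SUP w\<in>Sol f g U r s y m. apply_bcontfun \<psi> (fst (w r)) + snd (w r) - snd (w s))"

definition payoff_pairing :: "('n::finite torus \<Rightarrow>\<^sub>C real) \<Rightarrow> ('n torus \<times> real) measure \<Rightarrow> real"
  where "payoff_pairing \<phi> \<nu> = (\<integral>p. apply_bcontfun \<phi> (fst p) + snd p \<partial>\<nu>)"

definition MFG_dynamics ::
    "(real \<Rightarrow> 'n::finite torus \<Rightarrow> 'n torus measure \<Rightarrow> 'u \<Rightarrow> real ^ 'n) \<Rightarrow>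
     (real \<Rightarrow> 'n torus \<Rightarrow> 'n torus measure \<Rightarrow> 'u \<Rightarrow> real) \<Rightarrow> 'u set \<Rightarrow>
     real \<Rightarrow> real \<Rightarrow> 'n torus measure \<Rightarrow> ('n torus \<Rightarrow>\<^sub>C real) \<Rightarrow>
     ('n torus measure \<times> ('n torus \<Rightarrow>\<^sub>C real)) set"
  where "MFG_dynamics f g U r s m \<phi> = {(\<mu>, \<psi>). \<exists>\<nu>. solves_MFDI f g U s r \<nu> \<and>
    distr (\<nu> s) borel fst = m \<and> distr (\<nu> r) borel fst = \<mu> \<and>
    apply_bcontfun \<phi> = bellman f g U s r (\<lambda>t. distr (\<nu> t) borel fst) \<psi> \<and>
    payoff_pairing \<psi> (\<nu> r) \<ge> payoff_pairing \<phi> (\<nu> s)}"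

definition viable ::
    "real \<Rightarrow> (real \<Rightarrow> 'n::finite torus \<Rightarrow> 'n torus measure \<Rightarrow> 'u \<Rightarrow> real ^ 'n) \<Rightarrow>
     (real \<Rightarrow> 'n torus \<Rightarrow> 'n torus measure \<Rightarrow> 'u \<Rightarrow> real) \<Rightarrow> 'u set \<Rightarrow>
     (real \<Rightarrow> 'n torus measure \<Rightarrow> ('n torus \<Rightarrow>\<^sub>C real) set) \<Rightarrow> bool"
  where "viable T f g U \<V> \<longleftrightarrow>
    (\<forall>s\<in>{0..T}. \<forall>r\<in>{0..T}. s \<le> r \<longrightarrow>
      (\<forall>m\<in>P1 euclidean_metric. \<forall>\<phi>\<in>\<V> s m.
        \<exists>\<mu>\<in>P1 euclidean_metric. \<exists>\<psi>. (\<mu>, \<psi>) \<in> MFG_dynamics f g U r s m \<phi> \<and> \<psi> \<in> \<V> r \<mu>))"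

end

(* Viability is applied once, on the whole interval [t0, T]: it yields a law gamma on curves, its
   flow m of marginals and a terminal payoff psi, and psi = sigma(., m T) by the terminal condition.
   The candidate value is V s = B^{s,T} psi. Along every solution of the inclusion the function
   V t (x t) + z t is nonincreasing (dynamic programming), while viability says that its gamma-mean
   does not decrease from t0 to T; hence it is constant on the support of gamma.

   The remaining points are that V is continuous and that the maximum is attained. The marginals
   are W1-continuous in time, so the inclusion has a right-hand side that is continuous in time,
   Lipschitz in the state and convex compact valued. Its solutions are the limits of Euler polygons,
   which can be made to follow a given solution from a nearby starting point (Filippov's estimate);
   such a limit is Lipschitz, and at a point of differentiability its derivative lies in the
   right-hand side. *)

theory Submission
  imports Defs "HOL-Complex_Analysis.Complex_Analysis"
begin

section \<open>Absolutely continuous and Lipschitz curves\<close>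

text \<open>A merely measurable flow would give a right-hand side that is only measurable in time.
  Here the flow consists of marginals of a law on continuous curves, and the torus is bounded, so
  dominated convergence makes it W1-continuous; compactness of \<open>U\<close> and of the torus
  then gives a modulus in time uniform in state and control. Hence Euler polygons with constant step
  suffice.

  Everything is done with lifts to R^d x R; lattice invariance brings the results back to the torus.
  Trajectories are handled through increments instead of integrated velocities: a mean value
  property puts difference quotients into convex tubes, a condition that survives pointwise limits.
  The return to velocities needs differentiability almost everywhere of Lipschitz curves, which
  explains the real analysis at the start.

  Equality of means gives constancy only almost surely. It extends to the whole support because the
  loss from t0 to T is a continuous functional of the curve; conversely, separability gives the
  support full measure, so a sign on the support is a sign almost surely.\<close>

text \<open>Henstock's argument: the null set without a good derivative lies in an open set of
  measure below the \<delta> of absolute continuity, so intervals tagged there contribute at most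
  \<epsilon>; an interval tagged elsewhere contributes at most \<epsilon> times its length. A fine
  tagged division consists of these two kinds.\<close>

lemma absolutely_continuous_on_nonpos_deriv:
  fixes h :: "real \<Rightarrow> real"
  assumes ab: "a \<le> b" and ac: "absolutely_continuous_on a b h"
    and ae: "AE t in lebesgue. t \<in> {a..b} \<longrightarrow>
      (\<exists>d\<le>0. (h has_vector_derivative d) (at t within {a..b}))"
  shows "h b \<le> h a"
proof -
  have main: "h b - h a \<le> (1 + (b - a)) * \<epsilon>" if e: "\<epsilon> > 0" for \<epsilon>
  proof -
    obtain \<delta> where \<delta>0: "\<delta> > 0" and \<delta>': "\<forall>n (l :: nat \<Rightarrow> real) r.
        (\<forall>i<n. a \<le> l i \<and> l i \<le> r i \<and> r i \<le> b) \<and>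
        disjoint_family_on (\<lambda>i. {l i<..<r i}) {..<n} \<and> (\<Sum>i<n. r i - l i) < \<delta> \<longrightarrow>
        (\<Sum>i<n. dist (h (l i)) (h (r i))) < \<epsilon>"
      using ac[unfolded absolutely_continuous_on_def, THEN spec, THEN mp, OF e] by (elim exE conjE)
    note \<delta> = \<delta>0 \<delta>'[THEN spec, THEN spec, THEN spec, THEN mp, OF conjI, OF _ conjI]
    obtain N where N: "\<And>t. t \<in> space lebesgue - N \<Longrightarrow> t \<in> {a..b} \<longrightarrow>
        (\<exists>d\<le>0. (h has_vector_derivative d) (at t within {a..b}))" "N \<in> null_sets lebesgue"
      using AE_E3[OF ae] by metis
    note N = N(2) N(1)[unfolded Diff_iff, OF conjI, THEN mp]
    obtain G where G: "open G" "N \<subseteq> G" "G \<in> lmeasurable" "measure lebesgue G < \<delta>"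
    proof -
      have "N \<in> lmeasurable" using N(1) by (intro negligible_imp_measurable) (simp add: negligible_iff_null_sets)
      then obtain G where G: "open G" "N \<subseteq> G" "G - N \<in> lmeasurable" "emeasure lebesgue (G - N) < ennreal \<delta>"
        by (rule sets_lebesgue_outer_open[OF fmeasurableD \<delta>0])
      have "emeasure lebesgue G \<le> emeasure lebesgue (G - N) + emeasure lebesgue N"
        by (metis G(3) N(1) Un_Diff_cancel2 emeasure_Un_null_set emeasure_subadditive fmeasurableD null_setsD2 G(2) sup.orderE)
      then have *: "emeasure lebesgue G < ennreal \<delta>"
        using G(4) N(1) by auto
      then have "G \<in> lmeasurable"
        using G(1) by (intro fmeasurableI) (auto intro: order_less_trans)
      then show ?thesis
        using that[OF G(1,2)] * \<delta>(1) by (simp add: emeasure_eq_measure2 ennreal_less_iff)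
    qed
    \<comment> \<open>Straddle estimate: \<open>y\<close> and \<open>z\<close> lie on opposite sides
      of \<open>t\<close>, so the errors \<open>\<epsilon> * (t - y)\<close> and
      \<open>\<epsilon> * (z - t)\<close> add up to exactly
      \<open>\<epsilon> * (z - y)\<close>.\<close>
    have "\<exists>\<eta>>0. \<forall>y\<in>{a..b}. \<forall>z\<in>{a..b}. y \<le> t \<and> t \<le> z \<and> \<bar>y - t\<bar> < \<eta> \<and> \<bar>z - t\<bar> < \<eta> \<longrightarrow> h z - h y \<le> \<epsilon> * (z - y)"
      if t: "t \<in> {a..b}" "t \<notin> N" for t
    proof -
      obtain d where d: "d \<le> 0" "(h has_vector_derivative d) (at t within {a..b})"
        using N(2)[OF _ t(2,1)] by auto
      then obtain \<eta> where \<eta>: "\<eta> > 0" "\<And>y. y \<in> {a..b} \<Longrightarrow> norm (y - t) < \<eta> \<Longrightarrow>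
          norm (h y - h t - (y - t) *\<^sub>R d) \<le> \<epsilon> * norm (y - t)"
        using e unfolding has_vector_derivative_def has_derivative_within_alt by meson
      have "h z - h y \<le> \<epsilon> * (z - y)"
        if "y \<in> {a..b}" "z \<in> {a..b}" "y \<le> t" "t \<le> z" "\<bar>y - t\<bar> < \<eta>" "\<bar>z - t\<bar> < \<eta>" for y z
      proof -
        have "h z - h t \<le> (z - t) * d + \<epsilon> * (z - t)" "h t - h y \<le> (t - y) * d + \<epsilon> * (t - y)"
          using \<eta>(2)[of y] \<eta>(2)[of z] that by (auto simp: algebra_simps)
        moreover have "(z - t) * d \<le> 0" "(t - y) * d \<le> 0"
          using that d by (auto intro: mult_nonneg_nonpos)
        ultimately show ?thesis by (simp add: algebra_simps)
      qed
      then show ?thesis using \<eta>(1) by blast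
    qed
    then obtain \<eta> where \<eta>: "\<And>t. t \<in> {a..b} \<Longrightarrow> t \<notin> N \<Longrightarrow> \<eta> t > 0"
      "\<And>t y z. t \<in> {a..b} \<Longrightarrow> t \<notin> N \<Longrightarrow> y \<in> {a..b} \<Longrightarrow> z \<in> {a..b} \<Longrightarrow> y \<le> t \<Longrightarrow> t \<le> z \<Longrightarrow>
        \<bar>y - t\<bar> < \<eta> t \<Longrightarrow> \<bar>z - t\<bar> < \<eta> t \<Longrightarrow> h z - h y \<le> \<epsilon> * (z - y)"
      by metis
    \<comment> \<open>A gauge lives on the whole line; the radius 1 off \<open>{a..b}\<close> is a
      mere default.\<close>
    define \<gamma> where "\<gamma> t = (if t \<in> N then G else if t \<in> {a..b} then ball t (\<eta> t) else ball t 1)" for t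
    have "gauge \<gamma>"
      unfolding gauge_def \<gamma>_def using G \<eta>(1) by auto
    then obtain p where p: "p tagged_division_of {a..b}" "\<gamma> fine p"
      using fine_division_exists_real by blast
    note pD = tagged_division_ofD[OF p(1)]
    define q where "q = {xk \<in> p. fst xk \<in> N}"
    have qp: "q \<subseteq> p" "finite q" "finite p"
      using pD(1) by (auto simp: q_def intro: finite_subset)
    have shape: "\<exists>u v. snd xk = {u..v} \<and> u \<le> fst xk \<and> fst xk \<le> v \<and> a \<le> u \<and> v \<le> b" if xkp: "xk \<in> p" for xk
    proof -
      obtain x k where xk: "xk = (x, k)" by fastforce
      obtain u v where k: "k = cbox u v" using pD(4) xkp xk by blast
      show ?thesis
        using pD(2)[of x k] pD(3)[of x k] xkp xk k by (auto simp: intro!: exI[of _ u] exI[of _ v])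
    qed
    \<comment> \<open>Endpoints are recovered as \<open>Inf\<close> and \<open>Sup\<close> because
      the telescoping sum \<open>additive_tagged_division_1\<close> is stated with them.\<close>
    define l r where "l xk = Inf (snd xk)" and "r xk = Sup (snd xk)" for xk :: "real \<times> real set"
    have lr: "snd xk = {l xk..r xk}" "l xk \<le> fst xk" "fst xk \<le> r xk" "a \<le> l xk" "r xk \<le> b" "l xk \<le> r xk"
      if xkp: "xk \<in> p" for xk
    proof -
      obtain u v where uv: "snd xk = {u..v}" "u \<le> fst xk" "fst xk \<le> v" "a \<le> u" "v \<le> b"
        using shape[OF xkp] by blast
      then have "l xk = u" "r xk = v"
        by (simp_all add: l_def r_def)
      with uv show "snd xk = {l xk..r xk}" "l xk \<le> fst xk" "fst xk \<le> r xk" "a \<le> l xk" "r xk \<le> b" "l xk \<le> r xk"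
        by simp_all
    qed
    have sums: "(\<Sum>xk\<in>p. F (r xk) - F (l xk)) = F b - F a" for F :: "real \<Rightarrow> real"
      using additive_tagged_division_1[OF ab p(1), of F] by (simp add: l_def r_def split_beta)
    have disj: "{l xk<..<r xk} \<inter> {l yk<..<r yk} = {}" if "xk \<in> p" "yk \<in> p" "xk \<noteq> yk" for xk yk
    proof -
      have "interior (snd xk) \<inter> interior (snd yk) = {}"
        using pD(5)[of "fst xk" "snd xk" "fst yk" "snd yk"] that by auto
      then show ?thesis
        using lr(1)[OF that(1)] lr(1)[OF that(2)] by simp
    qed
    obtain e n where e: "bij_betw e {..<n::nat} q"
      using ex_bij_betw_nat_finite[OF qp(2)] by (auto simp: atLeast0LessThan)
    have ein: "e i \<in> q" "e i \<in> p" if "i < n" for i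
      using e that qp by (auto simp: bij_betw_def)
    have bad: "(\<Sum>i<n. dist (h (l (e i))) (h (r (e i)))) < \<epsilon>"
    proof (rule \<delta>(2))
      show "\<forall>i<n. a \<le> l (e i) \<and> l (e i) \<le> r (e i) \<and> r (e i) \<le> b"
        using ein lr by blast
      show dj: "disjoint_family_on (\<lambda>i. {l (e i)<..<r (e i)}) {..<n}"
        unfolding disjoint_family_on_def
        using ein disj e by (metis bij_betw_inv_into_left lessThan_iff)
      have "(\<Sum>i<n. r (e i) - l (e i)) = (\<Sum>i<n. measure lebesgue {l (e i)<..<r (e i)})"
        using ein lr by (intro sum.cong) auto
      also have "\<dots> = measure lebesgue (\<Union>i<n. {l (e i)<..<r (e i)})"
        by (rule measure_finite_Union[symmetric]) (use dj ein lr in \<open>auto simp: emeasure_lborel_Ioo\<close>)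
      also have "\<dots> \<le> measure lebesgue G"
      proof (rule measure_mono_fmeasurable)
        show "(\<Union>i<n. {l (e i)<..<r (e i)}) \<subseteq> G"
        proof (intro UN_least)
          fix i assume i: "i \<in> {..<n}"
          then have "e i \<in> q" "e i \<in> p" using ein by auto
          then have "snd (e i) \<subseteq> \<gamma> (fst (e i))" "fst (e i) \<in> N"
            using p(2) by (auto simp: fine_def q_def split_beta)
          then show "{l (e i)<..<r (e i)} \<subseteq> G"
            using lr(1)[OF \<open>e i \<in> p\<close>] by (auto simp: \<gamma>_def)
        qed
      qed (use G in auto)
      finally show "(\<Sum>i<n. r (e i) - l (e i)) < \<delta>" using G by simp
    qed
    have "(\<Sum>xk\<in>q. h (r xk) - h (l xk)) \<le> (\<Sum>xk\<in>q. dist (h (l xk)) (h (r xk)))"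
      by (intro sum_mono) (auto simp: dist_real_def)
    also have "\<dots> = (\<Sum>i<n. dist (h (l (e i))) (h (r (e i))))"
      by (rule sum.reindex_bij_betw[OF e, symmetric])
    finally have q1: "(\<Sum>xk\<in>q. h (r xk) - h (l xk)) \<le> \<epsilon>" using bad by simp
    have "(\<Sum>xk\<in>p - q. h (r xk) - h (l xk)) \<le> (\<Sum>xk\<in>p - q. \<epsilon> * (r xk - l xk))"
    proof (rule sum_mono)
      fix xk assume xk: "xk \<in> p - q"
      then have "snd xk \<subseteq> \<gamma> (fst xk)" "fst xk \<notin> N" "fst xk \<in> {a..b}"
        using p(2) lr[of xk] by (auto simp: fine_def q_def split_beta)
      then have "{l xk..r xk} \<subseteq> ball (fst xk) (\<eta> (fst xk))"
        using lr(1)[of xk] xk by (auto simp: \<gamma>_def)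
      moreover have "l xk \<in> {l xk..r xk}" "r xk \<in> {l xk..r xk}" using lr xk by auto
      ultimately have "l xk \<in> ball (fst xk) (\<eta> (fst xk))" "r xk \<in> ball (fst xk) (\<eta> (fst xk))" by blast+
      then show "h (r xk) - h (l xk) \<le> \<epsilon> * (r xk - l xk)"
        using \<eta>(2)[of "fst xk" "l xk" "r xk"] lr[of xk] xk \<open>fst xk \<notin> N\<close>
        by (auto simp: dist_real_def abs_minus_commute)
    qed
    also have "\<dots> \<le> (\<Sum>xk\<in>p. \<epsilon> * (r xk - l xk))"
      using qp \<open>\<epsilon> > 0\<close> lr by (intro sum_mono2) auto
    also have "\<dots> = \<epsilon> * (b - a)"
      using sums[of "\<lambda>x. x"] by (simp flip: sum_distrib_left)
    finally have "(\<Sum>xk\<in>p - q. h (r xk) - h (l xk)) \<le> \<epsilon> * (b - a)" .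
    then show ?thesis
      using q1 sums[of h] sum.subset_diff[OF qp(1,3), of "\<lambda>xk. h (r xk) - h (l xk)"]
      by (simp add: algebra_simps)
  qed
  show ?thesis
  proof (rule ccontr)
    assume "\<not> h b \<le> h a"
    then have "(h b - h a) / (2 * (1 + (b - a))) > 0" using ab by simp
    moreover have "c * ((h b - h a) / (2 * c)) = (h b - h a) / 2" if "c > 0" for c
      using that by simp
    from this[of "1 + (b - a)"] have "(1 + (b - a)) * ((h b - h a) / (2 * (1 + (b - a)))) = (h b - h a) / 2"
      using ab by simp
    ultimately show False using main \<open>\<not> h b \<le> h a\<close> by force
  qed
qed

section \<open>Differentiability almost everywhere of Lipschitz curves\<close>

lemma lipschitz_indefinite_integral:
  fixes F :: "real \<Rightarrow> real"
  assumes lip: "M-lipschitz_on {a..b} F" and ab: "a \<le> b"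
  obtains f :: "real \<Rightarrow> real" where
    "\<And>x y. a \<le> x \<Longrightarrow> x \<le> y \<Longrightarrow> y \<le> b \<Longrightarrow> (f has_integral (F y - F x)) {x..y}"
proof -
  \<comment> \<open>\<open>G\<close> is a bi-Lipschitz bijection of the line that differs from \<open>F\<close> by a linear function on \<open>{a..b}\<close>.
    The image of Lebesgue measure under its inverse is absolutely continuous, and its density
    is the derivative of \<open>G\<close>.\<close>
  define p where "p t = min b (max a t)" for t
  \<comment> \<open>The slope \<open>M + 1\<close> exceeds the steepest descent of \<open>F\<close>
    by 1, which makes the inverse of \<open>G\<close> 1-Lipschitz.\<close>
  define G where "G t = F (p t) + (M + 1) * t" for t
  have M: "M \<ge> 0" using lip by (rule lipschitz_on_nonneg)
  have p: "p t \<in> {a..b}" "\<bar>p x - p y\<bar> \<le> \<bar>x - y\<bar>" for t x y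
    using ab by (auto simp: p_def)
  have Fp: "\<bar>F (p x) - F (p y)\<bar> \<le> M * \<bar>x - y\<bar>" for x y
    using lipschitz_onD[OF lip p(1)[of x] p(1)[of y]] p(2)[of x y] M
    by (metis (no_types, opaque_lifting) dist_real_def mult_left_mono order_trans)
  have G_ge: "y - x \<le> G y - G x" if "x \<le> y" for x y
    using Fp[of y x] that by (simp add: G_def algebra_simps)
  have G_le: "\<bar>G y - G x\<bar> \<le> (2 * M + 1) * \<bar>y - x\<bar>" for x y
  proof -
    have "\<bar>(M + 1) * y - (M + 1) * x\<bar> = (M + 1) * \<bar>y - x\<bar>"
      using M by (simp flip: right_diff_distrib add: abs_mult)
    then show ?thesis
      using Fp[of y x] by (simp add: G_def algebra_simps)
  qed
  have G_less: "x < y \<longleftrightarrow> G x < G y" and G_le_iff: "x \<le> y \<longleftrightarrow> G x \<le> G y" for x y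
    using G_ge[of x y] G_ge[of y x] by linarith+
  have "inj G"
    by (rule injI) (use G_le_iff in \<open>metis order_antisym order_refl\<close>)
  have "(2 * M + 1)-lipschitz_on UNIV G"
    using G_le M by (intro lipschitz_onI) (auto simp: dist_real_def)
  then have G_cont: "continuous_on A G" for A
    using lipschitz_on_continuous_on lipschitz_on_subset by (metis subset_UNIV)
  have "\<exists>x. G x = z" for z
  proof -
    define c where "c = \<bar>z - G 0\<bar>"
    have "G (- c) \<le> z" "z \<le> G c"
      using G_ge[of "-c" 0] G_ge[of 0 c] by (auto simp: c_def)
    then show ?thesis
      using IVT'[of G "-c" z c] G_cont by (auto simp: c_def)
  qed
  then have surj: "surj G" by (metis surjI)
  define H where "H = inv G"
  have GH: "G (H z) = z" and HG: "H (G x) = x" for z x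
    using surj \<open>inj G\<close> by (auto simp: H_def surj_f_inv_f)
  have H_vimage: "H -` S = G ` S" for S
    using GH HG by (auto simp: image_iff) (metis)
  have "1-lipschitz_on UNIV H"
  proof (rule lipschitz_onI)
    fix x y :: real
    show "dist (H x) (H y) \<le> 1 * dist x y"
      using G_ge[of "H x" "H y"] G_ge[of "H y" "H x"] by (cases "H x \<le> H y") (auto simp: dist_real_def GH)
  qed simp
  then have "continuous_on UNIV H"
    by (rule lipschitz_on_continuous_on)
  then have [measurable]: "H \<in> borel_measurable borel"
    by (rule borel_measurable_continuous_onI)
  define N where "N = distr lborel borel H"
  have sets_N: "sets N = sets lborel" by (simp add: N_def)
  have N_em: "emeasure N S = emeasure lborel (G ` S)" if "S \<in> sets borel" for S
    using that by (simp add: N_def emeasure_distr H_vimage)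
  have N_Icc: "emeasure N {x..y} = ennreal (G y - G x)" if "x \<le> y" for x y
  proof -
    have "G ` {x..y} = {G x..G y}"
      using G_le_iff GH by (auto simp: image_iff Bex_def) (metis)
    then show ?thesis
      using N_em[of "{x..y}"] G_le_iff that by simp
  qed
  \<comment> \<open>\<open>N\<close> gives a set the Lebesgue measure of its image under
    \<open>G\<close>, and the Lipschitz map \<open>G\<close> sends null sets to null sets.\<close>
  have "absolutely_continuous lborel N"
    unfolding absolutely_continuous_def
  proof
    fix S :: "real set" assume S: "S \<in> null_sets lborel"
    then have Sb: "S \<in> sets borel" by auto
    have "negligible S"
      using S by (metis negligible_iff_null_sets null_sets_completionI)
    then have "negligible (G ` S)"
      by (rule negligible_locally_Lipschitz_image[rotated])
         (auto simp: intro!: exI[of _ UNIV] exI[of _ "2 * M + 1"] G_le)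
    moreover have "G ` S \<in> sets borel"
      using Sb by (simp flip: H_vimage) (metis \<open>H \<in> borel_measurable borel\<close> inf_top.right_neutral measurable_sets space_borel)
    ultimately have "emeasure lborel (G ` S) = 0"
      by (metis negligible_iff_null_sets null_setsD1 null_sets_completion_iff sets_lborel)
    then show "S \<in> null_sets N"
      using N_em[OF Sb] Sb by (intro null_setsI) (auto simp: sets_N)
  qed
  then obtain f0 where f0[measurable]: "f0 \<in> borel_measurable lborel" and f0N: "density lborel f0 = N"
    using sigma_finite_measure.Radon_Nikodym[OF sigma_finite_lborel _ sets_N] by blast
  have f0_int: "(\<integral>\<^sup>+t. f0 t * indicator {x..y} t \<partial>lborel) = ennreal (G y - G x)" if "x \<le> y" for x y
    using N_Icc[OF that] emeasure_density[of f0 lborel "{x..y}"] by (simp add: f0N)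
  define f1 where "f1 t = enn2real (f0 t)" for t
  have f1_meas[measurable]: "f1 \<in> borel_measurable borel"
    using f0 unfolding f1_def by simp
  have f1_int: "(f1 has_integral (G y - G x)) {x..y}" if "x \<le> y" for x y
  proof -
    have "AE t in lborel. f0 t * indicator {x..y} t \<noteq> \<infinity>"
      by (rule nn_integral_PInf_AE) (use f0_int[OF that] in auto)
    then have "AE t in lborel. ennreal (f1 t * indicator {x..y} t) = f0 t * indicator {x..y} t"
      by eventually_elim (auto simp: f1_def indicator_def less_top)
    then have "(\<integral>\<^sup>+t. ennreal (f1 t * indicator {x..y} t) \<partial>lborel) = ennreal (G y - G x)"
      using f0_int[OF that] nn_integral_cong_AE by metis
    moreover have "0 \<le> G y - G x" using G_ge[OF that] that by simp
    ultimately have "((\<lambda>t. f1 t * indicator {x..y} t) has_integral (G y - G x)) UNIV"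
      by (intro nn_integral_has_integral) (auto simp: f1_def)
    then show ?thesis
      by (subst has_integral_restrict_UNIV[symmetric])
        (auto simp: indicator_def if_distrib cong: if_cong elim!: has_integral_eq[rotated])
  qed
  show ?thesis
  proof (rule that[of "\<lambda>t. f1 t - (M + 1)"])
    fix x y assume *: "a \<le> x" "x \<le> y" "y \<le> b"
    have "((\<lambda>t. f1 t - (M + 1)) has_integral (G y - G x - (y - x) *\<^sub>R (M + 1))) {x..y}"
      by (intro has_integral_diff f1_int *) (use has_integral_const_real[of "M + 1" x y] * in simp)
    moreover have "G y - G x - (y - x) *\<^sub>R (M + 1) = F y - F x"
      using * by (simp add: G_def p_def algebra_simps max_def min_def)
    ultimately show "((\<lambda>t. f1 t - (M + 1)) has_integral (F y - F x)) {x..y}" by simp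
  qed
qed

lemma negligible_not_derivative_indefinite_integral:
  fixes F :: "real \<Rightarrow> real"
  assumes int: "\<And>x y. a \<le> x \<Longrightarrow> x \<le> y \<Longrightarrow> y \<le> b \<Longrightarrow> (f has_integral (F y - F x)) {x..y}"
    and ab: "a < b" and eta: "\<eta> > 0"
  shows "negligible {t. \<forall>d>0. \<exists>u v. a \<le> u \<and> u \<le> t \<and> t \<le> v \<and> v \<le> b \<and> u < v \<and> t - d < u \<and> v < t + d \<and>
     \<eta> * (v - u) < \<bar>F v - F u - f t * (v - u)\<bar>}" (is "negligible ?E")
  unfolding negligible_outer_le
proof (intro allI impI)
  \<comment> \<open>By Henstock's lemma, disjoint fine intervals on which the difference quotient is off by more
    than \<open>\<eta>\<close> have total length at most \<open>e\<close>; by Vitali's theorem such intervals cover the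
    exceptional set up to a null set.\<close>
  fix e :: real assume e: "e > 0"
  define P where "P t u v \<longleftrightarrow> a \<le> u \<and> u \<le> t \<and> t \<le> v \<and> v \<le> b \<and> u < v \<and>
     \<eta> * (v - u) < \<bar>F v - F u - f t * (v - u)\<bar>" for t u v
  have "f integrable_on cbox a b" using int[of a b] ab by auto
  \<comment> \<open>Every selected interval contributes more than \<eta> times its length to
    Henstock's sum, so the bound \<open>e * \<eta>\<close> caps the total length by
    \<open>e\<close>.\<close>
  then obtain \<gamma> where \<gamma>: "gauge \<gamma>" "\<And>p. p tagged_partial_division_of (cbox a b) \<Longrightarrow> \<gamma> fine p \<Longrightarrow>
      sum (\<lambda>(x,k). norm (measure lborel k *\<^sub>R f x - integral k f)) p < e * \<eta>"
    using Henstock_lemma[of f a b "e * \<eta>"] e eta by auto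
  \<comment> \<open>Intervals enter as triples (tag, left end, right end) because the Vitali theorem
    speaks of indexed balls; \<open>c\<close> and \<open>r\<close> are midpoint and half
    length.\<close>
  define K where "K = {(t, u, v). P t u v \<and> {u..v} \<subseteq> \<gamma> t}"
  define c where "c = (\<lambda>(t :: real, u, v). (u + v) / 2 :: real)"
  define r where "r = (\<lambda>(t :: real, u, v). (v - u) / 2 :: real)"
  have cb: "cball (c (t, u, v)) (r (t, u, v)) = {u..v}" for t u v :: real
    by (simp add: c_def r_def cball_eq_atLeastAtMost add_divide_distrib diff_divide_distrib)
  have rpos: "0 < r i" if "i \<in> K" for i
    using that by (auto simp: K_def P_def r_def)
  have cover: "\<exists>i. i \<in> K \<and> t \<in> cball (c i) (r i) \<and> r i < d" if t: "t \<in> ?E" and d: "0 < d" for t d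
  proof -
    have "open (\<gamma> t)" "t \<in> \<gamma> t" using \<gamma>(1) by (auto simp: gauge_def)
    then obtain \<delta> where \<delta>: "\<delta> > 0" "ball t \<delta> \<subseteq> \<gamma> t" using openE by blast
    from t d \<delta>(1) obtain u v where uv: "P t u v" "t - min d \<delta> < u" "v < t + min d \<delta>"
      unfolding P_def mem_Collect_eq by (metis min_less_iff_conj)
    have "{u..v} \<subseteq> ball t \<delta>" using uv by (auto simp: dist_real_def)
    then have "(t, u, v) \<in> K" using uv \<delta> by (auto simp: K_def)
    moreover have "t \<in> {u..v}" "r (t, u, v) < d"
      using uv by (auto simp: P_def r_def)
    ultimately show ?thesis using cb by metis
  qed
  obtain C where C: "countable C" "C \<subseteq> K"
     "pairwise (\<lambda>i j. disjnt (cball (c i) (r i)) (cball (c j) (r j))) C"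
     "negligible (?E - (\<Union>i\<in>C. cball (c i) (r i)))"
    using Vitali_covering_theorem_cballs[of K r ?E c, OF rpos cover] by blast
  \<comment> \<open>Henstock's lemma bounds finite families; the countable union inherits the bound
    because it is uniform over finite subfamilies.\<close>
  have fin: "measure lebesgue (\<Union>i\<in>D. cball (c i) (r i)) \<le> e" if D: "D \<subseteq> C" "finite D" for D
  proof -
    define p where "p = (\<lambda>(t, u, v). (t, {u..v})) ` D"
    have K_D: "P t u v" "{u..v} \<subseteq> \<gamma> t" if "(t, u, v) \<in> D" for t u v
      using that D C(2) by (auto simp: K_def)
    have dj: "{u..v} \<inter> {u'..v'} = {}" if "(t, u, v) \<in> D" "(t', u', v') \<in> D" "(t, u, v) \<noteq> (t', u', v')" for t u v t' u' v'
      using pairwiseD[OF C(3), of "(t, u, v)" "(t', u', v')"] that D(1) by (auto simp: disjnt_def cb)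
    have "p tagged_partial_division_of (cbox a b)"
      unfolding tagged_partial_division_of_def
    proof (intro conjI allI impI)
      show "finite p" using D by (simp add: p_def)
    next
      fix x k assume "(x, k) \<in> p"
      then obtain u v where uv: "(x, u, v) \<in> D" "k = {u..v}" by (auto simp: p_def)
      from K_D(1)[OF uv(1)] uv(2) show "x \<in> k" "k \<subseteq> cbox a b" "\<exists>a b. k = cbox a b"
        by (auto simp: P_def)
    next
      fix x1 k1 x2 k2 assume "(x1, k1) \<in> p \<and> (x2, k2) \<in> p \<and> (x1, k1) \<noteq> (x2, k2)"
      then obtain u1 v1 u2 v2 where "(x1, u1, v1) \<in> D" "k1 = {u1..v1}" "(x2, u2, v2) \<in> D" "k2 = {u2..v2}"
        "(x1, u1, v1) \<noteq> (x2, u2, v2)" by (auto simp: p_def)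
      then have "k1 \<inter> k2 = {}" using dj by blast
      then show "interior k1 \<inter> interior k2 = {}" using interior_subset by blast
    qed
    moreover have "\<gamma> fine p"
      using K_D(2) by (auto simp: fine_def p_def)
    ultimately have small: "sum (\<lambda>(x,k). norm (measure lborel k *\<^sub>R f x - integral k f)) p < e * \<eta>"
      by (rule \<gamma>(2))
    have inj: "inj_on (\<lambda>(t, u, v). (t, {u..v})) D"
    proof (rule inj_onI)
      fix i j assume *: "i \<in> D" "j \<in> D" "(\<lambda>(t, u, v). (t, {u..v})) i = (\<lambda>(t, u, v). (t, {u..v})) j"
      obtain t u v where i: "i = (t, u, v)" by (cases i)
      from * i K_D(1)[of t u v] show "i = j"
        by (cases j) (auto simp: P_def Icc_eq_Icc)
    qed
    have "measure lebesgue (\<Union>i\<in>D. cball (c i) (r i)) \<le> (\<Sum>i\<in>D. measure lebesgue (cball (c i) (r i)))"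
      by (rule measure_UNION_le) (use D in auto)
    also have "\<dots> \<le> (\<Sum>i\<in>D. (\<lambda>(x,k). norm (measure lborel k *\<^sub>R f x - integral k f)) ((\<lambda>(t, u, v). (t, {u..v})) i) / \<eta>)"
    proof (rule sum_mono)
      fix i assume i: "i \<in> D"
      obtain t u v where tuv: "i = (t, u, v)" by (cases i)
      then have P: "P t u v" using K_D i by auto
      then have "integral {u..v} f = F v - F u"
        using int[of u v] by (intro integral_unique) (auto simp: P_def)
      then have "norm (measure lborel {u..v} *\<^sub>R f t - integral {u..v} f) = \<bar>F v - F u - f t * (v - u)\<bar>"
        using P by (simp add: P_def abs_minus_commute mult.commute)
      then show "measure lebesgue (cball (c i) (r i)) \<le>
         (\<lambda>(x,k). norm (measure lborel k *\<^sub>R f x - integral k f)) ((\<lambda>(t, u, v). (t, {u..v})) i) / \<eta>"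
        using P eta by (simp add: tuv cb P_def pos_le_divide_eq mult.commute)
    qed
    also have "\<dots> = sum (\<lambda>(x,k). norm (measure lborel k *\<^sub>R f x - integral k f)) p / \<eta>"
      unfolding p_def by (simp add: sum.reindex[OF inj] sum_divide_distrib)
    also have "\<dots> \<le> e"
      using small eta by (simp add: pos_divide_le_eq)
    finally show ?thesis .
  qed
  define \<D> where "\<D> = (\<lambda>i. cball (c i) (r i)) ` C"
  have cnt: "countable \<D>" using C(1) by (simp add: \<D>_def)
  have lm: "d \<in> lmeasurable" if "d \<in> \<D>" for d using that by (auto simp: \<D>_def)
  have bd: "measure lebesgue (\<Union>D') \<le> e" if D': "D' \<subseteq> \<D>" "finite D'" for D'
  proof -
    obtain D where "D \<subseteq> C" "finite D" "D' = (\<lambda>i. cball (c i) (r i)) ` D"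
      using finite_subset_image[OF D'(2)] D'(1) unfolding \<D>_def by blast
    then show ?thesis using fin[of D] by simp
  qed
  have "\<Union>\<D> \<in> lmeasurable \<and> measure lebesgue (\<Union>\<D>) \<le> e"
    using fmeasurable_Union_bound[OF cnt lm bd] measure_Union_bound[OF cnt lm bd] by blast
  moreover have Z: "negligible (?E - \<Union>\<D>)" using C(4) by (simp add: \<D>_def)
  ultimately have "\<Union>\<D> \<union> (?E - \<Union>\<D>) \<in> lmeasurable" "measure lebesgue (\<Union>\<D> \<union> (?E - \<Union>\<D>)) \<le> e"
    using negligible_imp_measurable[OF Z] Z[unfolded negligible_iff_null_sets]
    by (simp_all only: fmeasurable.Un measure_Un_null_set[OF fmeasurableD])
  then show "\<exists>T. ?E \<subseteq> T \<and> T \<in> lmeasurable \<and> measure lebesgue T \<le> e"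
    by (intro exI[of _ "\<Union>\<D> \<union> (?E - \<Union>\<D>)"]) auto
qed

text \<open>The density \<open>f\<close> serves as the derivative: for each tolerance
  \<open>1 / real (Suc n)\<close> the exceptional set is null, and off their union the quotients
  converge. These sets admit intervals with \<open>t\<close> as an endpoint, which are the
  increments that a derivative tests.\<close>

lemma lipschitz_real_differentiable_AE:
  fixes F :: "real \<Rightarrow> real"
  assumes lip: "M-lipschitz_on {a..b} F"
  shows "AE t in lebesgue. t \<in> {a..b} \<longrightarrow> (\<exists>d. (F has_vector_derivative d) (at t within {a..b}))"
proof (cases "a < b")
  case False
  have "negligible {a..b}" using False by (intro negligible_subset[OF negligible_sing[of a]]) auto
  then have "{a..b} \<in> null_sets lebesgue" by (simp add: negligible_iff_null_sets)
  then show ?thesis by (rule AE_I') auto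
next
  case ab: True
  obtain f where f: "\<And>x y. a \<le> x \<Longrightarrow> x \<le> y \<Longrightarrow> y \<le> b \<Longrightarrow> (f has_integral (F y - F x)) {x..y}"
    using lipschitz_indefinite_integral[OF lip] ab by (metis less_imp_le)
  define E where "E \<eta> = {t. \<forall>d>0. \<exists>u v. a \<le> u \<and> u \<le> t \<and> t \<le> v \<and> v \<le> b \<and> u < v \<and> t - d < u \<and> v < t + d \<and>
     \<eta> * (v - u) < \<bar>F v - F u - f t * (v - u)\<bar>}" for \<eta>
  have "negligible (E \<eta>)" if "\<eta> > 0" for \<eta>
    unfolding E_def by (rule negligible_not_derivative_indefinite_integral[OF f ab that])
  then have "negligible (\<Union>n. E (1 / real (Suc n)))"
    by (intro negligible_countable_Union) auto
  then have "(\<Union>n. E (1 / real (Suc n))) \<in> null_sets lebesgue"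
    by (simp add: negligible_iff_null_sets)
  then show ?thesis
  proof (rule AE_I', intro subsetI)
    fix t assume "t \<in> {t \<in> space lebesgue. \<not> (t \<in> {a..b} \<longrightarrow> (\<exists>d. (F has_vector_derivative d) (at t within {a..b})))}"
    then have t: "t \<in> {a..b}" "\<not> (F has_vector_derivative f t) (at t within {a..b})" by auto
    show "t \<in> (\<Union>n. E (1 / real (Suc n)))"
    proof (rule ccontr)
      assume nE: "t \<notin> (\<Union>n. E (1 / real (Suc n)))"
      have "(F has_vector_derivative f t) (at t within {a..b})"
        unfolding has_vector_derivative_def has_derivative_within_alt
      proof (intro conjI allI impI)
        show "bounded_linear (\<lambda>h. h *\<^sub>R f t)" by (rule bounded_linear_scaleR_left)
        fix e :: real assume "0 < e"
        then obtain n where n: "1 / real (Suc n) < e"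
          using reals_Archimedean[of e] by (auto simp: inverse_eq_divide)
        from nE have "t \<notin> E (1 / real (Suc n))" by blast
        then obtain d where d: "d > 0" "\<And>u v. a \<le> u \<Longrightarrow> u \<le> t \<Longrightarrow> t \<le> v \<Longrightarrow> v \<le> b \<Longrightarrow> u < v \<Longrightarrow> t - d < u \<Longrightarrow> v < t + d \<Longrightarrow>
            \<bar>F v - F u - f t * (v - u)\<bar> \<le> 1 / real (Suc n) * (v - u)"
          unfolding E_def mem_Collect_eq not_all not_imp not_ex by (metis not_less)
        have "norm (F y - F t - (y - t) *\<^sub>R f t) \<le> e * norm (y - t)" if y: "y \<in> {a..b}" "norm (y - t) < d" for y
        proof -
          have le: "1 / real (Suc n) * \<bar>y - t\<bar> \<le> e * \<bar>y - t\<bar>"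
            using n by (intro mult_right_mono) auto
          consider "y = t" | "t < y" | "y < t" by linarith
          then have "\<bar>F y - F t - (y - t) * f t\<bar> \<le> 1 / real (Suc n) * \<bar>y - t\<bar>"
          proof cases
            case 2
            then show ?thesis using d(2)[of t y] y t by (simp add: mult.commute)
          next
            case 3
            have "F y - F t - (y - t) * f t = - (F t - F y - f t * (t - y))" by (simp add: algebra_simps)
            then show ?thesis using 3 d(2)[of y t] y t by simp
          qed simp
          with le show ?thesis by simp
        qed
        then show "\<exists>d>0. \<forall>y\<in>{a..b}. norm (y - t) < d \<longrightarrow> norm (F y - F t - (y - t) *\<^sub>R f t) \<le> e * norm (y - t)"
          using d(1) by blast
      qed
      with t show False by blast
    qed
  qed
qed

lemma lipschitz_differentiable_AE:
  fixes F :: "real \<Rightarrow> 'a::euclidean_space"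
  assumes lip: "M-lipschitz_on {a..b} F"
  shows "AE t in lebesgue. t \<in> {a..b} \<longrightarrow> (\<exists>d. (F has_vector_derivative d) (at t within {a..b}))"
proof -
  have "AE t in lebesgue. \<forall>i\<in>Basis. t \<in> {a..b} \<longrightarrow> (\<exists>d. ((\<lambda>t. F t \<bullet> i) has_vector_derivative d) (at t within {a..b}))"
  proof (subst AE_finite_all[OF finite_Basis], intro ballI lipschitz_real_differentiable_AE)
    fix i :: 'a assume i: "i \<in> Basis"
    show "M-lipschitz_on {a..b} (\<lambda>t. F t \<bullet> i)"
    proof (rule lipschitz_onI)
      fix x y assume "x \<in> {a..b}" "y \<in> {a..b}"
      then show "dist (F x \<bullet> i) (F y \<bullet> i) \<le> M * dist x y"
        using lipschitz_onD[OF lip, of x y] Basis_le_norm[OF i, of "F x - F y"]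
        by (simp add: dist_norm inner_diff_left)
    qed (rule lipschitz_on_nonneg[OF lip])
  qed
  then show ?thesis
  proof eventually_elim
    case (elim t)
    show ?case
    proof
      assume "t \<in> {a..b}"
      with elim obtain d where d: "\<And>i. i \<in> Basis \<Longrightarrow> ((\<lambda>t. F t \<bullet> i) has_vector_derivative d i) (at t within {a..b})"
        by metis
      have "((\<lambda>t. \<Sum>i\<in>Basis. (F t \<bullet> i) *\<^sub>R i) has_vector_derivative (\<Sum>i\<in>Basis. d i *\<^sub>R i)) (at t within {a..b})"
        by (intro has_vector_derivative_sum) (use d in \<open>auto intro!: derivative_eq_intros simp: has_real_derivative_iff_has_vector_derivative\<close>)
      then show "\<exists>d. (F has_vector_derivative d) (at t within {a..b})"
        by (auto simp: euclidean_representation)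
    qed
  qed
qed

section \<open>Absolute continuity and the mean value property\<close>

lemma absolutely_continuous_on_subset:
  assumes "absolutely_continuous_on s r W" "s \<le> x" "y \<le> r"
  shows "absolutely_continuous_on x y W"
  unfolding absolutely_continuous_on_def
proof (intro allI impI)
  fix \<epsilon> :: real assume "\<epsilon> > 0"
  then obtain \<delta> where \<delta>: "\<delta> > 0" "\<forall>n (a :: nat \<Rightarrow> real) b.
      (\<forall>i<n. s \<le> a i \<and> a i \<le> b i \<and> b i \<le> r) \<and> disjoint_family_on (\<lambda>i. {a i<..<b i}) {..<n} \<and>
      (\<Sum>i<n. b i - a i) < \<delta> \<longrightarrow> (\<Sum>i<n. dist (W (a i)) (W (b i))) < \<epsilon>"
    using assms(1)[unfolded absolutely_continuous_on_def] by meson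
  have "\<forall>n (a :: nat \<Rightarrow> real) b.
      (\<forall>i<n. x \<le> a i \<and> a i \<le> b i \<and> b i \<le> y) \<and> disjoint_family_on (\<lambda>i. {a i<..<b i}) {..<n} \<and>
      (\<Sum>i<n. b i - a i) < \<delta> \<longrightarrow> (\<Sum>i<n. dist (W (a i)) (W (b i))) < \<epsilon>"
  proof (intro allI impI, elim conjE)
    fix n and a b :: "nat \<Rightarrow> real"
    assume *: "\<forall>i<n. x \<le> a i \<and> a i \<le> b i \<and> b i \<le> y" "disjoint_family_on (\<lambda>i. {a i<..<b i}) {..<n}"
      "(\<Sum>i<n. b i - a i) < \<delta>"
    then have "\<forall>i<n. s \<le> a i \<and> a i \<le> b i \<and> b i \<le> r" using assms(2,3) by force
    then show "(\<Sum>i<n. dist (W (a i)) (W (b i))) < \<epsilon>"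
      by (intro \<delta>(2)[THEN spec, THEN spec, THEN spec, THEN mp] conjI *)
  qed
  with \<delta>(1) show "\<exists>\<delta>>0. \<forall>n (a :: nat \<Rightarrow> real) b.
      (\<forall>i<n. x \<le> a i \<and> a i \<le> b i \<and> b i \<le> y) \<and> disjoint_family_on (\<lambda>i. {a i<..<b i}) {..<n} \<and>
      (\<Sum>i<n. b i - a i) < \<delta> \<longrightarrow> (\<Sum>i<n. dist (W (a i)) (W (b i))) < \<epsilon>" by blast
qed

lemma lipschitz_imp_absolutely_continuous_on:
  assumes "M-lipschitz_on {s..r} W"
  shows "absolutely_continuous_on s r W"
  unfolding absolutely_continuous_on_def
proof (intro allI impI)
  fix \<epsilon> :: real assume e: "\<epsilon> > 0"
  have M: "M \<ge> 0" using assms by (rule lipschitz_on_nonneg)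
  show "\<exists>\<delta>>0. \<forall>n (a :: nat \<Rightarrow> real) b.
      (\<forall>i<n. s \<le> a i \<and> a i \<le> b i \<and> b i \<le> r) \<and> disjoint_family_on (\<lambda>i. {a i<..<b i}) {..<n} \<and>
      (\<Sum>i<n. b i - a i) < \<delta> \<longrightarrow> (\<Sum>i<n. dist (W (a i)) (W (b i))) < \<epsilon>"
  proof (rule exI[of _ "\<epsilon> / (M + 1)"], intro conjI allI impI, goal_cases)
    case (2 n a b)
    have "(\<Sum>i<n. dist (W (a i)) (W (b i))) \<le> (\<Sum>i<n. M * (b i - a i))"
    proof (rule sum_mono)
      fix i assume "i \<in> {..<n}"
      then have "s \<le> a i \<and> a i \<le> b i \<and> b i \<le> r" using 2 by blast
      then show "dist (W (a i)) (W (b i)) \<le> M * (b i - a i)"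
        using lipschitz_onD[OF assms, of "a i" "b i"] by (auto simp: dist_real_def abs_minus_commute)
    qed
    also have "\<dots> = M * (\<Sum>i<n. b i - a i)" by (simp flip: sum_distrib_left)
    also have "\<dots> \<le> (M + 1) * (\<Sum>i<n. b i - a i)"
      using 2 by (intro mult_right_mono sum_nonneg) auto
    also have "\<dots> < \<epsilon>"
      using 2 M by (simp add: pos_less_divide_eq mult.commute)
    finally show ?case .
  qed (use e M in auto)
qed

text \<open>Otherwise a hyperplane separates the quotient from \<open>D\<close>; the function
  \<open>b * t - a \<bullet> W t\<close> then has nonpositive derivative almost everywhere, hence
  decreases, against the separation.\<close>

lemma mean_value_closed_convex:
  fixes W :: "real \<Rightarrow> 'a::euclidean_space"
  assumes xy: "x < y" and ac: "absolutely_continuous_on x y W"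
    and D: "closed D" "convex D"
    and ae: "AE t in lebesgue. t \<in> {x..y} \<longrightarrow> (\<exists>v\<in>D. (W has_vector_derivative v) (at t within {x..y}))"
  shows "(W y - W x) /\<^sub>R (y - x) \<in> D"
proof (rule ccontr)
  assume "(W y - W x) /\<^sub>R (y - x) \<notin> D"
  from separating_hyperplane_closed_point[OF D(2,1) this]
  obtain a b where ab: "a \<bullet> ((W y - W x) /\<^sub>R (y - x)) < b" "\<And>v. v \<in> D \<Longrightarrow> b < a \<bullet> v" by blast
  define h where "h t = b * t - a \<bullet> W t" for t
  have "absolutely_continuous_on x y h"
    unfolding absolutely_continuous_on_def
  proof (intro allI impI)
    fix \<epsilon> :: real assume e: "\<epsilon> > 0"
    define \<epsilon>1 where "\<epsilon>1 = \<epsilon> / (2 * (norm a + 1))"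
    have e1: "\<epsilon>1 > 0" using e by (simp add: \<epsilon>1_def add_nonneg_pos)
    obtain \<delta> where \<delta>: "\<delta> > 0" "\<forall>n (l :: nat \<Rightarrow> real) r.
      (\<forall>i<n. x \<le> l i \<and> l i \<le> r i \<and> r i \<le> y) \<and> disjoint_family_on (\<lambda>i. {l i<..<r i}) {..<n} \<and>
      (\<Sum>i<n. r i - l i) < \<delta> \<longrightarrow> (\<Sum>i<n. dist (W (l i)) (W (r i))) < \<epsilon>1"
      using ac[unfolded absolutely_continuous_on_def] e1 by meson
    show "\<exists>\<delta>>0. \<forall>n (l :: nat \<Rightarrow> real) r.
      (\<forall>i<n. x \<le> l i \<and> l i \<le> r i \<and> r i \<le> y) \<and> disjoint_family_on (\<lambda>i. {l i<..<r i}) {..<n} \<and>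
      (\<Sum>i<n. r i - l i) < \<delta> \<longrightarrow> (\<Sum>i<n. dist (h (l i)) (h (r i))) < \<epsilon>"
    \<comment> \<open>Both summands of \<open>h\<close> get half of \<epsilon>: the linear one
      through the bound on the total length, the other through \<open>\<epsilon>1\<close>. The added
      1 in each denominator guards against \<open>b = 0\<close> and \<open>a = 0\<close>.\<close>
    proof (rule exI[of _ "min \<delta> (\<epsilon> / (2 * (\<bar>b\<bar> + 1)))"], intro conjI allI impI, goal_cases)
      case 1
      show ?case using \<delta>(1) e by (simp add: add_nonneg_pos)
    next
      case (2 n l r)
      have W: "(\<Sum>i<n. dist (W (l i)) (W (r i))) < \<epsilon>1"
        by (rule \<delta>(2)[THEN spec, THEN spec, THEN spec, THEN mp]) (use 2 in simp)
      have "(\<Sum>i<n. dist (h (l i)) (h (r i))) \<le> (\<Sum>i<n. \<bar>b\<bar> * (r i - l i) + norm a * dist (W (l i)) (W (r i)))"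
      proof (rule sum_mono)
        fix i assume "i \<in> {..<n}"
        then have i: "l i \<le> r i" using 2 by blast
        have "dist (h (l i)) (h (r i)) = \<bar>b * (l i - r i) - a \<bullet> (W (l i) - W (r i))\<bar>"
          by (simp add: h_def dist_real_def algebra_simps)
        also have "\<dots> \<le> \<bar>b * (l i - r i)\<bar> + \<bar>a \<bullet> (W (l i) - W (r i))\<bar>" by simp
        also have "\<dots> \<le> \<bar>b\<bar> * (r i - l i) + norm a * dist (W (l i)) (W (r i))"
          using i Cauchy_Schwarz_ineq2[of a "W (l i) - W (r i)"] by (simp add: abs_mult dist_norm)
        finally show "dist (h (l i)) (h (r i)) \<le> \<bar>b\<bar> * (r i - l i) + norm a * dist (W (l i)) (W (r i))" .
      qed
      also have "\<dots> = \<bar>b\<bar> * (\<Sum>i<n. r i - l i) + norm a * (\<Sum>i<n. dist (W (l i)) (W (r i)))"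
        by (simp add: sum.distrib sum_distrib_left)
      also have "\<dots> \<le> (\<bar>b\<bar> + 1) * (\<Sum>i<n. r i - l i) + (norm a + 1) * (\<Sum>i<n. dist (W (l i)) (W (r i)))"
        using 2 by (intro add_mono mult_right_mono sum_nonneg) auto
      also have "(\<bar>b\<bar> + 1) * (\<Sum>i<n. r i - l i) < \<epsilon> / 2"
        using 2 by (simp add: pos_less_divide_eq field_simps add_nonneg_pos)
      also have "(norm a + 1) * (\<Sum>i<n. dist (W (l i)) (W (r i))) < \<epsilon> / 2"
      proof -
        have "c * (\<epsilon> / (2 * c)) = \<epsilon> / 2" if "c > 0" for c :: real using that by simp
        from this[of "norm a + 1"] have "(norm a + 1) * \<epsilon>1 = \<epsilon> / 2"
          by (simp add: \<epsilon>1_def add_nonneg_pos)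
        then show ?thesis
          using mult_strict_left_mono[OF W add_nonneg_pos[OF norm_ge_zero[of a] zero_less_one]] by linarith
      qed
      finally show ?case by simp
    qed
  qed
  moreover have "AE t in lebesgue. t \<in> {x..y} \<longrightarrow> (\<exists>d\<le>0. (h has_vector_derivative d) (at t within {x..y}))"
    using ae
  proof eventually_elim
    case (elim t)
    show ?case
    proof
      assume "t \<in> {x..y}"
      with elim obtain v where v: "v \<in> D" "(W has_vector_derivative v) (at t within {x..y})" by blast
      have "((\<lambda>t. a \<bullet> W t) has_vector_derivative a \<bullet> v) (at t within {x..y})"
        by (rule bounded_linear.has_vector_derivative[OF bounded_linear_inner_right v(2)])
      moreover have "((\<lambda>t. b * t) has_vector_derivative b) (at t within {x..y})"
        by (auto intro!: derivative_eq_intros)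
      ultimately have "(h has_vector_derivative b - a \<bullet> v) (at t within {x..y})"
        unfolding h_def by (intro has_vector_derivative_diff)
      moreover have "b - a \<bullet> v \<le> 0" using ab(2)[OF v(1)] by simp
      ultimately show "\<exists>d\<le>0. (h has_vector_derivative d) (at t within {x..y})" by blast
    qed
  qed
  ultimately have "h y \<le> h x"
    by (rule absolutely_continuous_on_nonpos_deriv[OF less_imp_le[OF xy]])
  then have "b * (y - x) \<le> a \<bullet> (W y - W x)"
    by (simp add: h_def algebra_simps)
  moreover have "a \<bullet> ((W y - W x) /\<^sub>R (y - x)) = a \<bullet> (W y - W x) / (y - x)"
    by (simp add: divide_inverse_commute)
  ultimately show False
    using ab(1) xy by (simp add: pos_divide_less_eq)
qed

section \<open>Lipschitz differential inclusions\<close>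

text \<open>Stated with an actual nearby point instead of \<open>infdist\<close>, so that the tube
  of the empty set is empty. Inclusion in a tube is one half of a Hausdorff distance bound.\<close>

definition tube :: "'a::metric_space set \<Rightarrow> real \<Rightarrow> 'a set"
  where "tube K e = {v. \<exists>k\<in>K. dist v k \<le> e}"

lemma tube_subset_tube:
  assumes "K \<subseteq> tube K' d" "d + e \<le> e'"
  shows "tube K e \<subseteq> tube K' e'"
proof
  fix v assume "v \<in> tube K e"
  then obtain k where k: "k \<in> K" "dist v k \<le> e" by (auto simp: tube_def)
  with assms obtain k' where k': "k' \<in> K'" "dist k k' \<le> d" by (auto simp: tube_def)
  have "dist v k' \<le> e'" using k(2) k'(2) assms(2) dist_triangle[of v k' k] by simp
  with k' show "v \<in> tube K' e'" by (auto simp: tube_def)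
qed

lemma tube_eq_sums:
  fixes K :: "'a::real_normed_vector set"
  shows "tube K e = {x + y | x y. x \<in> K \<and> y \<in> cball 0 e}"
proof (intro set_eqI iffI)
  fix v assume "v \<in> tube K e"
  then obtain k where k: "k \<in> K" "dist v k \<le> e" by (auto simp: tube_def)
  then have "v = k + (v - k)" "v - k \<in> cball 0 e" by (auto simp: dist_norm norm_minus_commute)
  with k(1) show "v \<in> {x + y | x y. x \<in> K \<and> y \<in> cball 0 e}" by blast
qed (auto simp: tube_def dist_norm intro!: bexI)

lemma tube_0 [simp]: "tube K 0 = K"
  by (auto simp: tube_def)

lemma convex_tube:
  fixes K :: "'a::real_normed_vector set"
  assumes "convex K" shows "convex (tube K e)"
proof -
  have "tube K e = (\<Union>x\<in>K. \<Union>y\<in>cball 0 e. {x + y})" unfolding tube_eq_sums by blast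
  then show ?thesis using convex_sums[OF assms convex_cball[of 0 e]] by simp
qed

lemma closed_tube:
  fixes K :: "'a::euclidean_space set"
  assumes "compact K" shows "closed (tube K e)"
  unfolding tube_eq_sums using compact_sums[OF assms compact_cball[of 0 e]] by (rule compact_imp_closed)

text \<open>Point and radius may converge together; compactness supplies a nearest point for the
  limit.\<close>

lemma tube_limit:
  fixes K :: "'a::euclidean_space set"
  assumes K: "compact K" and v: "\<And>n. v n \<in> tube K (\<rho> n)" and "v \<longlonglongrightarrow> l" "\<rho> \<longlonglongrightarrow> \<rho>'"
  shows "l \<in> tube K \<rho>'"
proof -
  have "K \<noteq> {}" using v[of 0] by (auto simp: tube_def)
  have "infdist (v n) K \<le> \<rho> n" for n
    using v[of n] by (auto simp: tube_def intro: infdist_le2)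
  moreover have "(\<lambda>n. infdist (v n) K) \<longlonglongrightarrow> infdist l K"
    using assms(3) by (intro tendsto_infdist)
  ultimately have "infdist l K \<le> \<rho>'"
    using assms(4) by (intro LIMSEQ_le) auto
  moreover obtain k where "k \<in> K" "infdist l K = dist l k"
    using infdist_attains_inf[OF compact_imp_closed[OF K] \<open>K \<noteq> {}\<close>] by metis
  ultimately show ?thesis by (auto simp: tube_def)
qed

lemma has_vector_derivative_difference_quotient:
  fixes W :: "real \<Rightarrow> 'a::real_normed_vector"
  assumes d: "(W has_vector_derivative v) (at t within S)"
    and y: "y \<longlonglongrightarrow> t" "\<And>n. y n \<in> S" "\<And>n. y n > t"
  shows "(\<lambda>n. (W (y n) - W t) /\<^sub>R (y n - t)) \<longlonglongrightarrow> v"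
proof -
  have "filterlim y (at t within S) sequentially"
    unfolding filterlim_at using y by (auto intro: always_eventually simp: less_imp_neq[THEN not_sym])
  from filterlim_compose[OF conjunct2[OF d[unfolded has_vector_derivative_def has_derivative_within]] this]
  have "(\<lambda>n. (1 / norm (y n - t)) *\<^sub>R (W (y n) - (W t + (y n - t) *\<^sub>R v))) \<longlonglongrightarrow> 0" .
  then have "(\<lambda>n. (1 / norm (y n - t)) *\<^sub>R (W (y n) - (W t + (y n - t) *\<^sub>R v)) + v) \<longlonglongrightarrow> 0 + v"
    by (intro tendsto_intros)
  moreover have "(1 / norm c) *\<^sub>R (x - (w + c *\<^sub>R v)) + v = (x - w) /\<^sub>R c" if "c > 0" for c and x w :: 'a
    using that by (simp add: scaleR_right_diff_distrib scaleR_right_distrib inverse_eq_divide)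
  then have "(1 / norm (y n - t)) *\<^sub>R (W (y n) - (W t + (y n - t) *\<^sub>R v)) + v = (W (y n) - W t) /\<^sub>R (y n - t)" for n
    using y(3)[of n] by simp
  ultimately show ?thesis by simp
qed

text \<open>The one-sided inclusions are two-sided Hausdorff bounds, since they are required for all
  ordered pairs. The time modulus is uniform in \<open>Y\<close>, which lets one step size serve
  along all curves.\<close>

locale differential_inclusion =
  fixes a b C L :: real and K :: "real \<Rightarrow> 'a::euclidean_space \<Rightarrow> 'a set"
  assumes compact_K: "\<And>t Y. t \<in> {a..b} \<Longrightarrow> compact (K t Y)"
    and convex_K: "\<And>t Y. t \<in> {a..b} \<Longrightarrow> convex (K t Y)"
    and norm_K: "\<And>t Y v. t \<in> {a..b} \<Longrightarrow> v \<in> K t Y \<Longrightarrow> norm v \<le> C"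
    and C_nonneg: "C \<ge> 0" and L_nonneg: "L \<ge> 0"
    and K_lipschitz: "\<And>t Y Y'. t \<in> {a..b} \<Longrightarrow> K t Y \<subseteq> tube (K t Y') (L * dist Y Y')"
    and K_time: "\<And>\<eta>. \<eta> > 0 \<Longrightarrow> \<exists>\<delta>>0. \<forall>t\<in>{a..b}. \<forall>t'\<in>{a..b}. \<forall>Y. \<bar>t - t'\<bar> \<le> \<delta> \<longrightarrow> K t Y \<subseteq> tube (K t' Y) \<eta>"
begin

text \<open>The tolerance \<open>e\<close> separates exact solutions (\<open>e = 0\<close>) from
  Euler polygons, whose velocities are only near the right-hand side.\<close>

definition traj :: "real \<Rightarrow> real \<Rightarrow> real \<Rightarrow> (real \<Rightarrow> 'a) \<Rightarrow> bool"
  where "traj e s r W \<longleftrightarrow> a \<le> s \<and> s \<le> r \<and> r \<le> b \<and> absolutely_continuous_on s r W \<and>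
    (AE t in lebesgue. t \<in> {s..r} \<longrightarrow>
      (\<exists>v\<in>tube (K t (W t)) e. (W has_vector_derivative v) (at t within {s..r})))"

text \<open>A step size that is admissible for the accuracy \<open>\<eta>\<close> along every curve with speed at most \<open>C + 1\<close>.\<close>

definition admissible :: "real \<Rightarrow> real \<Rightarrow> bool"
  where "admissible h \<eta> \<longleftrightarrow> h > 0 \<and> \<eta> \<ge> 0 \<and>
    (\<forall>t\<in>{a..b}. \<forall>t'\<in>{a..b}. \<forall>Y Y'. \<bar>t - t'\<bar> \<le> h \<longrightarrow> dist Y Y' \<le> (C + 1) * h \<longrightarrow> K t Y \<subseteq> tube (K t' Y') \<eta>)"

lemma admissible_exists:
  assumes "\<eta> > 0" shows "\<exists>h. admissible h \<eta>"
proof -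
  obtain \<delta> where \<delta>: "\<delta> > 0" "\<And>t t' Y. t \<in> {a..b} \<Longrightarrow> t' \<in> {a..b} \<Longrightarrow> \<bar>t - t'\<bar> \<le> \<delta> \<Longrightarrow> K t Y \<subseteq> tube (K t' Y) (\<eta> / 2)"
    using K_time[of "\<eta> / 2"] assms by auto
  \<comment> \<open>\<open>c * h\<close> dominates the state contribution
    \<open>L * ((C + 1) * h)\<close>; the summand 1 keeps \<open>c\<close> positive for the division
    below.\<close>
  define c where "c = L * (C + 1) + 1"
  have c: "c > 0" using L_nonneg C_nonneg by (simp add: c_def add_nonneg_pos)
  define h where "h = min \<delta> (\<eta> / 2 / c)"
  have h: "h > 0" "h \<le> \<delta>" "c * h \<le> \<eta> / 2"
  proof -
    show "h > 0" "h \<le> \<delta>" using \<delta>(1) assms c by (auto simp: h_def)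
    have "c * h \<le> c * (\<eta> / 2 / c)" using c by (intro mult_left_mono) (auto simp: h_def)
    then show "c * h \<le> \<eta> / 2" using c by simp
  qed
  have *: "K t Y \<subseteq> tube (K t' Y') \<eta>"
    if "t \<in> {a..b}" "t' \<in> {a..b}" "\<bar>t - t'\<bar> \<le> h" "dist Y Y' \<le> (C + 1) * h" for t t' Y Y'
  proof -
    have "L * dist Y Y' \<le> L * ((C + 1) * h)"
      using that L_nonneg by (intro mult_left_mono)
    also have "\<dots> \<le> c * h" using h(1) by (simp add: c_def algebra_simps)
    finally have "L * dist Y Y' \<le> \<eta> / 2" using h by simp
    then have "tube (K t Y') (L * dist Y Y') \<subseteq> tube (K t' Y') \<eta>"
      using \<delta>(2)[of t t' Y'] that h by (intro tube_subset_tube) auto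
    then show ?thesis using K_lipschitz[of t Y Y'] that by blast
  qed
  have "admissible h \<eta>"
    unfolding admissible_def using h(1) assms by (intro conjI ballI allI impI *; simp add: less_imp_le)
  then show ?thesis ..
qed

lemma admissibleD:
  "admissible h \<eta> \<Longrightarrow> t \<in> {a..b} \<Longrightarrow> t' \<in> {a..b} \<Longrightarrow> \<bar>t - t'\<bar> \<le> h \<Longrightarrow> dist Y Y' \<le> (C + 1) * h \<Longrightarrow>
    K t Y \<subseteq> tube (K t' Y') \<eta>"
  unfolding admissible_def by blast

section \<open>Increments and limits of approximate trajectories\<close>

lemma traj_restrict:
  assumes "traj e s r W" "s \<le> s'" "s' \<le> r'" "r' \<le> r"
  shows "traj e s' r' W"
proof -
  have "AE t in lebesgue. t \<in> {s'..r'} \<longrightarrow>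
      (\<exists>v\<in>tube (K t (W t)) e. (W has_vector_derivative v) (at t within {s'..r'}))"
  proof -
    have "AE t in lebesgue. t \<in> {s..r} \<longrightarrow>
      (\<exists>v\<in>tube (K t (W t)) e. (W has_vector_derivative v) (at t within {s..r}))"
      using assms(1) by (simp add: traj_def)
    then show ?thesis
    proof eventually_elim
      case (elim t)
      moreover have "{s'..r'} \<subseteq> {s..r}" using assms by auto
      ultimately show ?case
        using has_vector_derivative_within_subset[where S = "{s..r}" and T = "{s'..r'}"] by blast
    qed
  qed
  moreover have "absolutely_continuous_on s' r' W"
    using assms by (auto simp: traj_def intro: absolutely_continuous_on_subset)
  ultimately show ?thesis using assms by (simp add: traj_def)
qed

lemma traj_mean_value:
  assumes tr: "traj e s r W" and xy: "s \<le> x" "x < y" "y \<le> r"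
    and D: "closed D" "convex D" "\<And>t. t \<in> {x..y} \<Longrightarrow> tube (K t (W t)) e \<subseteq> D"
  shows "(W y - W x) /\<^sub>R (y - x) \<in> D"
proof (rule mean_value_closed_convex[OF xy(2) _ D(1,2)])
  have tr': "traj e x y W" using traj_restrict[OF tr, of x y] xy by simp
  then show "absolutely_continuous_on x y W" by (simp add: traj_def)
  have "AE t in lebesgue. t \<in> {x..y} \<longrightarrow>
      (\<exists>v\<in>tube (K t (W t)) e. (W has_vector_derivative v) (at t within {x..y}))"
    using tr' by (simp add: traj_def)
  then show "AE t in lebesgue. t \<in> {x..y} \<longrightarrow> (\<exists>v\<in>D. (W has_vector_derivative v) (at t within {x..y}))"
    by eventually_elim (use D(3) in blast)
qed

text \<open>Speeds are at most \<open>C + e\<close>, so \<open>e \<le> 1\<close> gives one constant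
  for all approximate trajectories; this is the origin of \<open>C + 1\<close>.\<close>

lemma traj_lipschitz:
  assumes tr: "traj e s r W" and e: "e \<le> 1"
  shows "(C + 1)-lipschitz_on {s..r} W"
proof (rule lipschitz_onI)
  have *: "dist (W x) (W y) \<le> (C + 1) * (y - x)" if "s \<le> x" "x < y" "y \<le> r" for x y
  proof -
    have "(W y - W x) /\<^sub>R (y - x) \<in> cball 0 (C + 1)"
    proof (rule traj_mean_value[OF tr that])
      fix t assume "t \<in> {x..y}"
      then have t: "t \<in> {a..b}" using that tr by (auto simp: traj_def)
      show "tube (K t (W t)) e \<subseteq> cball 0 (C + 1)"
      proof
        fix v assume "v \<in> tube (K t (W t)) e"
        then obtain k where "k \<in> K t (W t)" "dist v k \<le> e" by (auto simp: tube_def)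
        then show "v \<in> cball 0 (C + 1)"
          using norm_K[OF t] e norm_triangle_sub[of v k] by (fastforce simp: dist_norm)
      qed
    qed auto
    moreover have "norm ((W y - W x) /\<^sub>R (y - x)) = dist (W x) (W y) / (y - x)"
      using that by (simp add: dist_norm norm_minus_commute divide_inverse_commute)
    ultimately show ?thesis using that by (simp add: pos_divide_le_eq)
  qed
  show "dist (W x) (W y) \<le> (C + 1) * dist x y" if "x \<in> {s..r}" "y \<in> {s..r}" for x y
    using *[of x y] *[of y x] that
    by (cases x y rule: linorder_cases) (auto simp: dist_commute dist_real_def)
qed (use C_nonneg in simp)

text \<open>Within an admissible step all velocities lie in one closed convex set, a tube at the
  initial point, and so does the mean velocity. The conclusion mentions no derivative and therefore
  passes to pointwise limits.\<close>

lemma traj_increment: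
  assumes tr: "traj e s r W" and e: "0 \<le> e" "e \<le> 1" and h: "admissible h \<eta>"
    and xy: "s \<le> x" "x < y" "y \<le> r" "y \<le> x + h"
  shows "(W y - W x) /\<^sub>R (y - x) \<in> tube (K x (W x)) (\<eta> + e)"
proof (rule traj_mean_value[OF tr xy(1-3)])
  have x: "x \<in> {a..b}" using xy tr by (auto simp: traj_def)
  show "closed (tube (K x (W x)) (\<eta> + e))" "convex (tube (K x (W x)) (\<eta> + e))"
    by (rule closed_tube[OF compact_K[OF x]], rule convex_tube[OF convex_K[OF x]])
  fix t assume t: "t \<in> {x..y}"
  then have "t \<in> {a..b}" using xy tr by (auto simp: traj_def)
  moreover have "dist (W t) (W x) \<le> (C + 1) * h"
  proof -
    have "dist (W t) (W x) \<le> (C + 1) * dist t x"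
      using t xy by (intro lipschitz_onD[OF traj_lipschitz[OF tr e(2)]]) auto
    also have "\<dots> \<le> (C + 1) * h"
      using t xy C_nonneg by (intro mult_left_mono) (auto simp: dist_real_def)
    finally show ?thesis .
  qed
  ultimately have "K t (W t) \<subseteq> tube (K x (W x)) \<eta>"
    using t xy x by (intro admissibleD[OF h]) auto
  then show "tube (K t (W t)) e \<subseteq> tube (K x (W x)) (\<eta> + e)"
    by (rule tube_subset_tube) simp
qed

text \<open>Velocities of the \<open>W n\<close> need not converge, but their increments do. The
  tube condition on increments passes to the limit; shrinking the interval recovers the velocity of
  \<open>V\<close>, and then \<eta> tends to 0.\<close>

lemma traj_limit:
  assumes tr: "\<And>n. traj (e n) s r (W n)" and e: "\<And>n. 0 \<le> e n" "\<And>n. e n \<le> 1" "e \<longlonglongrightarrow> 0"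
    and lim: "\<And>t. t \<in> {s..r} \<Longrightarrow> (\<lambda>n. W n t) \<longlonglongrightarrow> V t"
  shows "traj 0 s r V"
proof -
  have sr: "a \<le> s" "s \<le> r" "r \<le> b" using tr by (auto simp: traj_def)
  have lip: "(C + 1)-lipschitz_on {s..r} V"
  proof (rule lipschitz_onI)
    fix x y assume xy: "x \<in> {s..r}" "y \<in> {s..r}"
    then have "(\<lambda>n. dist (W n x) (W n y)) \<longlonglongrightarrow> dist (V x) (V y)"
      by (intro tendsto_intros lim)
    moreover have "dist (W n x) (W n y) \<le> (C + 1) * dist x y" for n
      using xy by (intro lipschitz_onD[OF traj_lipschitz[OF tr e(2)]])
    ultimately show "dist (V x) (V y) \<le> (C + 1) * dist x y"
      by (intro LIMSEQ_le_const2) auto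
  qed (use C_nonneg in simp)
  have incr: "(V y - V x) /\<^sub>R (y - x) \<in> tube (K x (V x)) \<eta>"
    if h: "admissible h \<eta>" and xy: "s \<le> x" "x < y" "y \<le> r" "y \<le> x + h" for h \<eta> x y
  proof (rule tube_limit)
    have x: "x \<in> {a..b}" using xy sr by auto
    show "compact (K x (V x))" using x by (rule compact_K)
    show "(W n y - W n x) /\<^sub>R (y - x) \<in> tube (K x (V x)) (L * dist (W n x) (V x) + (\<eta> + e n))" for n
    proof -
      have "tube (K x (W n x)) (\<eta> + e n) \<subseteq> tube (K x (V x)) (L * dist (W n x) (V x) + (\<eta> + e n))"
        using K_lipschitz[OF x] by (rule tube_subset_tube) simp
      then show ?thesis using traj_increment[OF tr e(1,2) h xy] by blast
    qed
    show "(\<lambda>n. (W n y - W n x) /\<^sub>R (y - x)) \<longlonglongrightarrow> (V y - V x) /\<^sub>R (y - x)"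
      using xy by (intro tendsto_intros lim) auto
    have "(\<lambda>n. L * dist (W n x) (V x) + (\<eta> + e n)) \<longlonglongrightarrow> L * dist (V x) (V x) + (\<eta> + 0)"
      using xy by (intro tendsto_intros lim e) auto
    then show "(\<lambda>n. L * dist (W n x) (V x) + (\<eta> + e n)) \<longlonglongrightarrow> \<eta>" by simp
  qed
  \<comment> \<open>The quotients are taken to the right of \<open>t\<close>, which excludes the
    endpoint \<open>r\<close>, a null set.\<close>
  have deriv: "v \<in> K t (V t)" if t: "t \<in> {s..<r}" and v: "(V has_vector_derivative v) (at t within {s..r})" for t v
  proof -
    have t': "t \<in> {a..b}" using t sr by auto
    define y where "y n = t + (r - t) / real (Suc n)" for n
    have ypos: "y n > t" for n using t by (simp add: y_def)
    have yS: "y n \<in> {s..r}" for n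
    proof -
      have "(r - t) / real (Suc n) \<le> (r - t) / 1" using t by (intro divide_left_mono) auto
      then show ?thesis using ypos[of n] t by (auto simp: y_def)
    qed
    have "(\<lambda>n. t + (r - t) * inverse (real (Suc n))) \<longlonglongrightarrow> t + (r - t) * 0"
      by (intro tendsto_intros LIMSEQ_inverse_real_of_nat)
    then have ylim: "y \<longlonglongrightarrow> t" by (simp add: y_def[abs_def] divide_inverse)
    have q: "(\<lambda>n. (V (y n) - V t) /\<^sub>R (y n - t)) \<longlonglongrightarrow> v"
      by (rule has_vector_derivative_difference_quotient[OF v ylim yS ypos])
    have "v \<in> tube (K t (V t)) \<eta>" if eta: "\<eta> > 0" for \<eta>
    proof -
      obtain h where h: "admissible h \<eta>" using admissible_exists[OF eta] by blast
      then have "h > 0" by (simp add: admissible_def)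
      then have "eventually (\<lambda>n. y n < t + h) sequentially"
        using ylim by (intro order_tendstoD) auto
      then obtain N where N: "\<And>n. n \<ge> N \<Longrightarrow> y n < t + h" by (auto simp: eventually_sequentially)
      show ?thesis
      proof (rule tube_limit[OF compact_K[OF t']])
        show "(V (y (n + N)) - V t) /\<^sub>R (y (n + N) - t) \<in> tube (K t (V t)) \<eta>" for n
          using N[of "n + N"] t ypos[of "n + N"] yS[of "n + N"] by (intro incr[OF h]) auto
        show "(\<lambda>n. (V (y (n + N)) - V t) /\<^sub>R (y (n + N) - t)) \<longlonglongrightarrow> v"
          using q by (rule LIMSEQ_ignore_initial_segment)
      qed simp
    qed
    then have "v \<in> tube (K t (V t)) (inverse (real (Suc n)))" for n by simp
    then have "v \<in> tube (K t (V t)) 0"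
      by (rule tube_limit[OF compact_K[OF t'] _ tendsto_const LIMSEQ_inverse_real_of_nat])
    then show ?thesis by simp
  qed
  have "AE t in lebesgue. t \<noteq> r"
    by (rule AE_I'[of "{r}"]) (auto simp: negligible_iff_null_sets[symmetric])
  then have "AE t in lebesgue. t \<in> {s..r} \<longrightarrow> (\<exists>v\<in>tube (K t (V t)) 0. (V has_vector_derivative v) (at t within {s..r}))"
    using lipschitz_differentiable_AE[OF lip] by eventually_elim (use deriv in force)
  then show ?thesis
    using sr lipschitz_imp_absolutely_continuous_on[OF lip] by (simp add: traj_def)
qed

text \<open>The one-sided velocities at \<open>c\<close> may differ, but a point is null; absolute
  continuity of the concatenation comes from the common Lipschitz constant, whence
  \<open>e \<le> 1\<close>.\<close>

lemma traj_join:
  assumes tr: "traj e s c V1" "traj e c r V2" and eq: "V1 c = V2 c" and e: "e \<le> 1"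
  shows "traj e s r (\<lambda>t. if t \<le> c then V1 t else V2 t)" (is "traj e s r ?W")
proof -
  have scr: "a \<le> s" "s \<le> c" "c \<le> r" "r \<le> b" using tr by (auto simp: traj_def)
  have "AE t in lebesgue. t \<noteq> c"
    by (rule AE_I'[of "{c}"]) (auto simp: negligible_iff_null_sets[symmetric])
  moreover have "AE t in lebesgue. t \<in> {s..c} \<longrightarrow>
      (\<exists>v\<in>tube (K t (V1 t)) e. (V1 has_vector_derivative v) (at t within {s..c}))"
    "AE t in lebesgue. t \<in> {c..r} \<longrightarrow>
      (\<exists>v\<in>tube (K t (V2 t)) e. (V2 has_vector_derivative v) (at t within {c..r}))"
    using tr by (auto simp: traj_def)
  ultimately have "AE t in lebesgue. t \<in> {s..r} \<longrightarrow>
      (\<exists>v\<in>tube (K t (?W t)) e. (?W has_vector_derivative v) (at t within {s..r}))"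
  proof eventually_elim
    case (elim t)
    show ?case
    proof
      assume t: "t \<in> {s..r}"
      show "\<exists>v\<in>tube (K t (?W t)) e. (?W has_vector_derivative v) (at t within {s..r})"
      proof (cases "t < c")
        case True
        then obtain v where v: "v \<in> tube (K t (V1 t)) e" "(V1 has_vector_derivative v) (at t within {s..c})"
          using elim t by auto
        have "at t within {s..c} = at t within {s..r}"
          by (rule at_within_nhd[of _ "{..<c}"]) (use True t scr in auto)
        with v(2) have "(V1 has_vector_derivative v) (at t within {s..r})" by simp
        then have "(?W has_vector_derivative v) (at t within {s..r})"
          by (rule has_vector_derivative_transform_within[where d = "c - t"])
            (use True t in \<open>auto simp: dist_real_def\<close>)
        with v(1) True show ?thesis by auto
      next
        case False
        then have ct: "c < t" using elim by simp
        then obtain v where v: "v \<in> tube (K t (V2 t)) e" "(V2 has_vector_derivative v) (at t within {c..r})"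
          using elim t by auto
        have "at t within {c..r} = at t within {s..r}"
          by (rule at_within_nhd[of _ "{c<..}"]) (use ct t scr in auto)
        with v(2) have "(V2 has_vector_derivative v) (at t within {s..r})" by simp
        then have "(?W has_vector_derivative v) (at t within {s..r})"
          by (rule has_vector_derivative_transform_within[where d = "t - c"])
            (use ct t in \<open>auto simp: dist_real_def\<close>)
        with v(1) ct show ?thesis by auto
      qed
    qed
  qed
  moreover have "(C + 1)-lipschitz_on {s..r} ?W"
    by (intro lipschitz_on_concat traj_lipschitz[OF tr(1) e] traj_lipschitz[OF tr(2) e] eq)
  ultimately show ?thesis
    using scr lipschitz_imp_absolutely_continuous_on by (auto simp: traj_def)
qed

section \<open>Euler polygons, Filippov's estimate, reachable sets\<close>

text \<open>The constant velocity is chosen in \<open>K s Y\<close> close to the mean velocity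
  \<open>q\<close> of \<open>W\<close>: \<open>q\<close> lies near \<open>K s (W s)\<close>, and
  Lipschitz continuity carries it near \<open>K s Y\<close>. The distance to \<open>W\<close> then
  obeys a Gronwall recursion.\<close>

lemma euler_step:
  assumes tr: "traj 0 s r W" and h: "admissible h \<eta>" and r: "s < r" "r \<le> s + h"
  shows "\<exists>W'. traj \<eta> s r W' \<and> W' s = Y \<and> dist (W' r) (W r) \<le> (1 + L * (r - s)) * dist Y (W s) + \<eta> * (r - s)"
proof -
  have s: "s \<in> {a..b}" "a \<le> s" "s \<le> r" "r \<le> b" using tr by (auto simp: traj_def)
  define q where "q = (W r - W s) /\<^sub>R (r - s)"
  have "q \<in> tube (K s (W s)) (\<eta> + 0)"
    unfolding q_def by (rule traj_increment[OF tr _ _ h]) (use r in auto)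
  moreover have "tube (K s (W s)) (\<eta> + 0) \<subseteq> tube (K s Y) (L * dist (W s) Y + \<eta>)"
    using K_lipschitz[OF s(1)] by (rule tube_subset_tube) simp
  ultimately obtain v where v: "v \<in> K s Y" "dist q v \<le> L * dist (W s) Y + \<eta>"
    by (auto simp: tube_def)
  define W' where "W' t = Y + (t - s) *\<^sub>R v" for t
  have nv: "norm v \<le> C" using norm_K[OF s(1) v(1)] .
  have "traj \<eta> s r W'"
    unfolding traj_def
  proof (intro conjI s)
    have "C-lipschitz_on {s..r} W'"
    proof (rule lipschitz_onI)
      fix x y :: real
      have "dist (W' x) (W' y) = dist x y * norm v"
        by (simp add: W'_def dist_norm flip: scaleR_diff_left)
      then show "dist (W' x) (W' y) \<le> C * dist x y"
        using mult_right_mono[OF nv zero_le_dist[of x y]] by (simp add: mult.commute)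
    qed (rule C_nonneg)
    then show "absolutely_continuous_on s r W'" by (rule lipschitz_imp_absolutely_continuous_on)
    have "(W' has_vector_derivative v) (at t within {s..r})" for t
      unfolding W'_def by (auto intro!: derivative_eq_intros)
    moreover have "v \<in> tube (K t (W' t)) \<eta>" if t: "t \<in> {s..r}" for t
    proof -
      have "dist Y (W' t) = (t - s) * norm v" using t by (simp add: W'_def dist_norm)
      also have "\<dots> \<le> h * (C + 1)" using t nv r by (intro mult_mono) auto
      finally have "K s Y \<subseteq> tube (K t (W' t)) \<eta>"
        using t s r by (intro admissibleD[OF h]) (auto simp: mult.commute)
      with v(1) show ?thesis by blast
    qed
    ultimately show "AE t in lebesgue. t \<in> {s..r} \<longrightarrow>
      (\<exists>v\<in>tube (K t (W' t)) \<eta>. (W' has_vector_derivative v) (at t within {s..r}))"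
      by (intro AE_I2) blast
  qed
  moreover have "W' s = Y" by (simp add: W'_def)
  moreover have "dist (W' r) (W r) \<le> (1 + L * (r - s)) * dist Y (W s) + \<eta> * (r - s)"
  proof -
    have "W r = W s + (r - s) *\<^sub>R q" using r by (simp add: q_def)
    then have "W' r - W r = (Y - W s) + (r - s) *\<^sub>R (v - q)"
      by (simp add: W'_def algebra_simps)
    then have "dist (W' r) (W r) \<le> dist Y (W s) + (r - s) * dist q v"
      using norm_triangle_ineq[of "Y - W s" "(r - s) *\<^sub>R (v - q)"] r by (simp add: dist_norm norm_minus_commute)
    also have "\<dots> \<le> dist Y (W s) + (r - s) * (L * dist (W s) Y + \<eta>)"
      using v(2) r by (intro add_left_mono mult_left_mono) auto
    finally show ?thesis by (simp add: algebra_simps dist_commute)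
  qed
  ultimately show ?thesis by blast
qed

text \<open>Discrete Gronwall: the factors \<open>1 + L * k\<close> are absorbed by
  \<open>exp (L * k)\<close>, and the local errors \<open>\<eta> * k\<close> add up to at most the
  exponential times \<open>\<eta> * (r - s)\<close>.\<close>

lemma euler_polygon:
  assumes tr: "traj 0 s r W" and h: "admissible h \<eta>" and eta: "\<eta> \<le> 1"
  shows "\<exists>W'. traj \<eta> s r W' \<and> W' s = Y \<and> dist (W' r) (W r) \<le> exp (L * (r - s)) * (dist Y (W s) + \<eta> * (r - s))"
proof -
  have s: "a \<le> s" "s \<le> r" "r \<le> b" using tr by (auto simp: traj_def)
  have eta0: "\<eta> \<ge> 0" "h > 0" using h by (auto simp: admissible_def)
  \<comment> \<open>On a one-point interval the velocity condition is void almost everywhere, so a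
    constant curve starts the induction.\<close>
  have base: "\<exists>W'. traj \<eta> s s W' \<and> W' s = Y \<and> dist (W' s) (W s) \<le> exp (L * (s - s)) * (dist Y (W s) + \<eta> * (s - s))"
  proof (intro exI conjI)
    have "AE t in lebesgue. t \<noteq> s"
      by (rule AE_I'[of "{s}"]) (auto simp: negligible_iff_null_sets[symmetric])
    then have "AE t in lebesgue. t \<in> {s..s} \<longrightarrow>
      (\<exists>v\<in>tube (K t ((\<lambda>_. Y) t)) \<eta>. ((\<lambda>_. Y) has_vector_derivative v) (at t within {s..s}))"
      by eventually_elim auto
    then show "traj \<eta> s s (\<lambda>_. Y)"
      using s lipschitz_imp_absolutely_continuous_on[OF lipschitz_on_constant] by (simp add: traj_def)
  qed auto
  \<comment> \<open>\<open>Suc\<close> keeps \<open>N\<close> positive even for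
    \<open>s = r\<close>; rounding up makes the step \<open>k\<close> at most
    \<open>h\<close>.\<close>
  define N where "N = Suc (nat \<lceil>(r - s) / h\<rceil>)"
  define k where "k = (r - s) / real N"
  have N: "real N > 0" "real N * h \<ge> r - s"
  proof -
    have "(r - s) / h \<le> real N" unfolding N_def by linarith
    then show "real N * h \<ge> r - s" using eta0 by (simp add: pos_divide_le_eq)
  qed (simp add: N_def)
  have k: "0 \<le> k" "k \<le> h" using N s by (auto simp: k_def pos_divide_le_eq mult.commute)
  have Nk: "real N * k = r - s" using N by (simp add: k_def)
  have "\<exists>W'. traj \<eta> s (s + real n * k) W' \<and> W' s = Y \<and>
      dist (W' (s + real n * k)) (W (s + real n * k)) \<le> exp (L * (real n * k)) * (dist Y (W s) + \<eta> * (real n * k))"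
    if "n \<le> N" for n
    using that
  proof (induction n)
    case 0
    then show ?case using base by simp
  next
    case (Suc n)
    define x y where "x = s + real n * k" and "y = s + real (Suc n) * k"
    obtain V1 where V1: "traj \<eta> s x V1" "V1 s = Y"
      "dist (V1 x) (W x) \<le> exp (L * (real n * k)) * (dist Y (W s) + \<eta> * (real n * k))"
      using Suc by (auto simp: x_def)
    show ?case
    proof (cases "k = 0")
      case True
      with V1 show ?thesis by (auto simp: x_def)
    next
      case False
      then have kp: "k > 0" using k by simp
      have yx: "y = x + k" by (simp add: x_def y_def algebra_simps)
      have "real (Suc n) * k \<le> real N * k" using Suc.prems k by (intro mult_right_mono) auto
      then have "y \<le> r" using Nk by (simp add: y_def)
      moreover have "s \<le> x" using k by (simp add: x_def)
      ultimately have "traj 0 x y W"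
        using kp yx by (intro traj_restrict[OF tr]) auto
      from euler_step[OF this h, of "V1 x"] obtain V2 where V2: "traj \<eta> x y V2" "V2 x = V1 x"
        "dist (V2 y) (W y) \<le> (1 + L * k) * dist (V1 x) (W x) + \<eta> * k"
        using kp k yx by auto
      define W' where "W' t = (if t \<le> x then V1 t else V2 t)" for t
      have "traj \<eta> s y W'"
        unfolding W'_def[abs_def] using traj_join[OF V1(1) V2(1) V2(2)[symmetric] eta] by simp
      moreover have "W' s = Y" using \<open>s \<le> x\<close> V1 by (simp add: W'_def)
      moreover have "dist (W' y) (W y) \<le> exp (L * (real (Suc n) * k)) * (dist Y (W s) + \<eta> * (real (Suc n) * k))"
      proof -
        have "(1 + L * k) * dist (V1 x) (W x) \<le>
          exp (L * k) * (exp (L * (real n * k)) * (dist Y (W s) + \<eta> * (real n * k)))"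
          using L_nonneg k eta0 by (intro mult_mono V1(3) exp_ge_add_one_self) auto
        also have "\<dots> = exp (L * (real (Suc n) * k)) * (dist Y (W s) + \<eta> * (real n * k))"
          by (simp add: algebra_simps exp_add)
        finally have 1: "(1 + L * k) * dist (V1 x) (W x) \<le>
          exp (L * (real (Suc n) * k)) * (dist Y (W s) + \<eta> * (real n * k))" .
        have "1 * (\<eta> * k) \<le> exp (L * (real (Suc n) * k)) * (\<eta> * k)"
          using L_nonneg k eta0 by (intro mult_right_mono) auto
        with 1 V2(3) have "dist (V2 y) (W y) \<le>
          exp (L * (real (Suc n) * k)) * (dist Y (W s) + \<eta> * (real n * k)) + exp (L * (real (Suc n) * k)) * (\<eta> * k)"
          by linarith
        also have "\<dots> = exp (L * (real (Suc n) * k)) * (dist Y (W s) + \<eta> * (real (Suc n) * k))"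
          by (simp add: algebra_simps)
        finally show ?thesis using kp yx by (simp add: W'_def)
      qed
      ultimately show ?thesis by (auto simp: y_def)
    qed
  qed
  from this[of N] show ?thesis by (simp add: Nk)
qed

text \<open>Arzela-Ascoli, from the common Lipschitz constant and the common start. Convergence is
  recorded only at the final time, where payoffs and distances are evaluated.\<close>

lemma traj_compact:
  assumes tr: "\<And>n. traj (e n) s r (W n)" and e: "\<And>n. 0 \<le> e n" "\<And>n. e n \<le> 1" "e \<longlonglongrightarrow> 0"
    and init: "\<And>n. W n s = Y"
  obtains V k where "strict_mono (k :: nat \<Rightarrow> nat)" "traj 0 s r V" "V s = Y" "(\<lambda>n. W (k n) r) \<longlonglongrightarrow> V r"
proof -
  have s: "a \<le> s" "s \<le> r" "r \<le> b" using tr by (auto simp: traj_def)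
  note lip = lipschitz_onD[OF traj_lipschitz[OF tr e(2)]]
  obtain V k where k: "strict_mono (k :: nat \<Rightarrow> nat)"
    "\<And>\<epsilon>. 0 < \<epsilon> \<Longrightarrow> \<exists>N. \<forall>n x. n \<ge> N \<and> x \<in> {s..r} \<longrightarrow> norm (W (k n) x - V x) < \<epsilon>"
  proof (rule Arzela_Ascoli[of "{s..r}" W "norm Y + (C + 1) * (r - s)"])
    show "norm (W n x) \<le> norm Y + (C + 1) * (r - s)" if "x \<in> {s..r}" for n x
    proof -
      have "dist (W n x) (W n s) \<le> (C + 1) * dist x s" using that s by (intro lip) auto
      also have "\<dots> \<le> (C + 1) * (r - s)"
        using that C_nonneg by (intro mult_left_mono) (auto simp: dist_real_def)
      finally show ?thesis using norm_triangle_sub[of "W n x" "W n s"] by (simp add: init dist_norm)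
    qed
    show "\<exists>d>0. \<forall>n y. y \<in> {s..r} \<and> norm (x - y) < d \<longrightarrow> norm (W n x - W n y) < \<epsilon>"
      if x: "x \<in> {s..r}" and "0 < \<epsilon>" for x \<epsilon>
    proof (intro exI conjI allI impI)
      show "\<epsilon> / (C + 1) > 0" using \<open>0 < \<epsilon>\<close> C_nonneg by simp
      fix n y assume y: "y \<in> {s..r} \<and> norm (x - y) < \<epsilon> / (C + 1)"
      then have "dist (W n x) (W n y) \<le> (C + 1) * dist x y" using x by (intro lip) auto
      also have "\<dots> < (C + 1) * (\<epsilon> / (C + 1))"
        using y C_nonneg by (intro mult_strict_left_mono) (auto simp: dist_norm)
      also have "\<dots> = \<epsilon>" using C_nonneg by simp
      finally show "norm (W n x - W n y) < \<epsilon>" by (simp add: dist_norm)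
    qed
  qed auto
  have lim: "(\<lambda>n. W (k n) t) \<longlonglongrightarrow> V t" if "t \<in> {s..r}" for t
    using k(2) that unfolding LIMSEQ_def dist_norm by meson
  have "(\<lambda>n. e (k n)) \<longlonglongrightarrow> 0" using LIMSEQ_subseq_LIMSEQ[OF e(3) k(1)] by (simp add: o_def)
  then have "traj 0 s r V"
    by (rule traj_limit[OF tr e(1,2) _ lim])
  moreover have "V s = Y"
    using lim[of s] s init by (simp add: LIMSEQ_const_iff)
  ultimately show ?thesis using that k(1) lim[of r] s by auto
qed

text \<open>Also the source of existence: one trajectory yields one from every starting point on the
  same interval. The error term \<open>e n * (r - s)\<close> of the polygons vanishes in the
  limit.\<close>

lemma filippov:
  assumes tr: "traj 0 s r W"
  obtains V where "traj 0 s r V" "V s = Y" "dist (V r) (W r) \<le> exp (L * (r - s)) * dist Y (W s)"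
proof -
  define e where "e n = inverse (real (Suc n))" for n
  have e: "0 < e n" "e n \<le> 1" "e \<longlonglongrightarrow> 0" for n
    using LIMSEQ_inverse_real_of_nat by (auto simp: e_def[abs_def] inverse_le_1_iff)
  have "\<exists>W'. traj (e n) s r W' \<and> W' s = Y \<and> dist (W' r) (W r) \<le> exp (L * (r - s)) * (dist Y (W s) + e n * (r - s))" for n
    using admissible_exists[OF e(1)] euler_polygon[OF tr _ e(2)] by metis
  then obtain W' where W': "\<And>n. traj (e n) s r (W' n)" "\<And>n. W' n s = Y"
    "\<And>n. dist (W' n r) (W r) \<le> exp (L * (r - s)) * (dist Y (W s) + e n * (r - s))" by metis
  obtain V k where V: "strict_mono (k :: nat \<Rightarrow> nat)" "traj 0 s r V" "V s = Y" "(\<lambda>n. W' (k n) r) \<longlonglongrightarrow> V r"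
    using traj_compact[OF W'(1) less_imp_le[OF e(1)] e(2,3) W'(2)] by blast
  have ek: "(\<lambda>n. e (k n)) \<longlonglongrightarrow> 0" using LIMSEQ_subseq_LIMSEQ[OF e(3) V(1)] by (simp add: o_def)
  have "(\<lambda>n. dist (W' (k n) r) (W r)) \<longlonglongrightarrow> dist (V r) (W r)"
    by (intro tendsto_intros V(4))
  moreover have "(\<lambda>n. exp (L * (r - s)) * (dist Y (W s) + e (k n) * (r - s))) \<longlonglongrightarrow>
      exp (L * (r - s)) * (dist Y (W s) + 0 * (r - s))"
    by (intro tendsto_intros ek)
  ultimately have "dist (V r) (W r) \<le> exp (L * (r - s)) * (dist Y (W s) + 0 * (r - s))"
    by (rule LIMSEQ_le) (use W'(3) in blast)
  then show ?thesis using that[OF V(2,3)] by simp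
qed

text \<open>The payoff depends on the endpoint alone, so sequential compactness of the reachable set
  suffices; it is \<open>traj_compact\<close> with tolerance 0.\<close>

lemma traj_attains_sup:
  fixes p :: "'a \<Rightarrow> real"
  assumes tr: "traj 0 s r W" and p: "continuous_on UNIV p"
  obtains V where "traj 0 s r V" "V s = W s" "\<And>V'. traj 0 s r V' \<Longrightarrow> V' s = W s \<Longrightarrow> p (V' r) \<le> p (V r)"
proof -
  define R where "R = {V r | V. traj 0 s r V \<and> V s = W s}"
  have "compact R"
    unfolding compact_def
  proof (intro allI impI)
    fix f :: "nat \<Rightarrow> 'a" assume "\<forall>n. f n \<in> R"
    then obtain W' where W': "\<And>n. traj 0 s r (W' n)" "\<And>n. W' n s = W s" "\<And>n. f n = W' n r"
      unfolding R_def mem_Collect_eq by metis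
    obtain V k where "strict_mono (k :: nat \<Rightarrow> nat)" "traj 0 s r V" "V s = W s" "(\<lambda>n. W' (k n) r) \<longlonglongrightarrow> V r"
      by (rule traj_compact[of "\<lambda>_. 0" s r W' "W s", OF W'(1) order_refl zero_le_one tendsto_const W'(2)])
    then show "\<exists>l\<in>R. \<exists>k. strict_mono k \<and> (f \<circ> k) \<longlonglongrightarrow> l"
      using W'(3) by (auto simp: R_def o_def intro!: bexI[of _ "V r"] exI[of _ k])
  qed
  moreover have "R \<noteq> {}" using tr by (auto simp: R_def)
  ultimately obtain x where "x \<in> R" "\<And>y. y \<in> R \<Longrightarrow> p y \<le> p x"
    using continuous_attains_sup[of R p] continuous_on_subset[OF p] by auto
  then show ?thesis using that by (force simp: R_def)
qed

end

section \<open>The control problem on the torus\<close>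

text \<open>The boundedness clause of \<open>cfunspace\<close> is automatic on a compact interval.
  Curves are extensional, hence the \<open>restrict\<close> in \<open>traj_Sol\<close>.\<close>

lemma mspace_curves: "mspace (curves s r) = {w \<in> extensional {s..r}. continuous_on {s..r} w}"
proof -
  have "compactin (top_of_set {s..r}) (topspace (top_of_set {s..r}))"
    by (simp add: compactin_subtopology)
  then show ?thesis
    unfolding curves_def by (subst compactin_mspace_cfunspace) auto
qed

lemma torus_of_eq_iff: "torus_of x = torus_of y \<longleftrightarrow> x - y \<in> int_lattice"
  by (simp add: torus.abs_eq_iff torus_rel_def)

lemma torus_of_add_lattice: "k \<in> int_lattice \<Longrightarrow> torus_of (x + k) = torus_of x"
  by (simp add: torus_of_eq_iff)

lemma torus_of_surj: "\<exists>x. torus_of x = q"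
  by (metis Quotient_torus Quotient_abs_rep)

text \<open>The quotient distance is an infimum over lattice translates; with the slack
  \<open>e\<close> it need not be attained.\<close>

lemma torus_lift_close:
  assumes "e > 0"
  obtains x' where "torus_of x' = q" "dist x x' < dist (torus_of x) q + e"
proof -
  obtain y where y: "torus_of y = q" using torus_of_surj by blast
  have bdd: "bdd_below ((\<lambda>k. norm (x - y - k)) ` int_lattice)"
    by (rule bdd_belowI[of _ 0]) auto
  have d: "dist (torus_of x) q = (INF k\<in>int_lattice. norm (x - y - k))"
    unfolding y[symmetric] dist_torus.abs_eq ..
  have "int_lattice \<noteq> ({} :: (real ^ 'a) set)" using int_lattice_0 by blast
  then obtain k where "k \<in> int_lattice" "norm (x - y - k) < dist (torus_of x) q + e"
    using cInf_lessD[of "(\<lambda>k. norm (x - y - k)) ` int_lattice" "dist (torus_of x) q + e"] d assms by auto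
  moreover from this have "torus_of (y + k) = q" using y by (simp add: torus_of_add_lattice)
  moreover have "dist x (y + k) = norm (x - y - k)" by (simp add: dist_norm algebra_simps)
  ultimately show ?thesis using that[of "y + k"] by simp
qed

text \<open>Tubes of convex sets are convex, so a bound at the generators, later the individual
  controls, extends to the hulls.\<close>

lemma hull_subset_tube:
  fixes A B :: "'a::real_normed_vector set"
  assumes "\<And>x. x \<in> A \<Longrightarrow> \<exists>y\<in>B. dist x y \<le> e"
  shows "convex hull A \<subseteq> tube (convex hull B) e"
proof (rule hull_minimal)
  show "A \<subseteq> tube (convex hull B) e"
    using assms hull_subset[of B convex] unfolding tube_def by blast
  show "convex (tube (convex hull B) e)"
    by (rule convex_tube) simp
qed

lemma cSup_eq_attained:
  fixes h :: "'a \<Rightarrow> real"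
  assumes "w \<in> S" "\<And>w'. w' \<in> S \<Longrightarrow> h w' \<le> h w"
  shows "(SUP w\<in>S. h w) = h w"
  using assms by (intro cSup_eq_maximum) auto

text \<open>The flow is frozen: after substituting \<open>m t\<close> a control system in
  \<open>(t, x, u)\<close> remains, and \<open>L\<close> is the constant of the pair
  \<open>(f, g)\<close>.\<close>

locale mean_field_flow =
  fixes f :: "real \<Rightarrow> 'n::finite torus \<Rightarrow> 'n torus measure \<Rightarrow> 'u::metric_space \<Rightarrow> real ^ 'n"
    and g :: "real \<Rightarrow> 'n torus \<Rightarrow> 'n torus measure \<Rightarrow> 'u \<Rightarrow> real"
    and U :: "'u set" and m :: "real \<Rightarrow> 'n torus measure" and a b L :: real
  assumes U: "compact U" and L_nonneg: "L \<ge> 0"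
    and fg_continuous: "continuous_on ({a..b} \<times> UNIV \<times> U) (\<lambda>(t, x, u). (f t x (m t) u, g t x (m t) u))"
    and fg_lipschitz: "\<And>t x x' u. t \<in> {a..b} \<Longrightarrow> u \<in> U \<Longrightarrow>
      dist (f t x (m t) u, g t x (m t) u) (f t x' (m t) u, g t x' (m t) u) \<le> L * dist x x'"
begin

abbreviation fg :: "real \<Rightarrow> 'n torus \<Rightarrow> 'u \<Rightarrow> (real ^ 'n) \<times> real"
  where "fg t x u \<equiv> (f t x (m t) u, g t x (m t) u)"

text \<open>Pullback of the right-hand side to the cover R^d x R: lattice periodic in the first
  component and independent of the second.\<close>

definition K :: "real \<Rightarrow> (real ^ 'n) \<times> real \<Rightarrow> ((real ^ 'n) \<times> real) set"
  where "K t Y = velocities f g U t (torus_of (fst Y)) (m t)"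

text \<open>Inserting 0 gives a nonnegative supremum of a nonempty set even when \<open>U\<close> or
  \<open>{a..b}\<close> is empty.\<close>

definition C :: real
  where "C = Sup (insert 0 ((\<lambda>(t, x, u). norm (fg t x u)) ` ({a..b} \<times> UNIV \<times> U)))"

lemma compact_domain: "compact ({a..b} \<times> (UNIV :: 'n torus set) \<times> U)"
  by (intro compact_Times compact_torus U) auto

lemma bdd_norm_fg: "bdd_above (insert 0 ((\<lambda>(t, x, u). norm (fg t x u)) ` ({a..b} \<times> UNIV \<times> U)))"
proof -
  have "continuous_on ({a..b} \<times> UNIV \<times> U) (\<lambda>p. norm ((\<lambda>(t, x, u). fg t x u) p))"
    by (intro continuous_intros fg_continuous)
  then have "compact ((\<lambda>p. norm ((\<lambda>(t, x, u). fg t x u) p)) ` ({a..b} \<times> UNIV \<times> U))"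
    by (rule compact_continuous_image[OF _ compact_domain])
  then have "bdd_above ((\<lambda>p. norm ((\<lambda>(t, x, u). fg t x u) p)) ` ({a..b} \<times> UNIV \<times> U))"
    by (intro bounded_imp_bdd_above compact_imp_bounded)
  then show ?thesis by (simp add: case_prod_unfold)
qed

lemma C_nonneg: "C \<ge> 0" and norm_fg: "t \<in> {a..b} \<Longrightarrow> u \<in> U \<Longrightarrow> norm (fg t x u) \<le> C"
proof -
  show "C \<ge> 0" unfolding C_def by (rule cSup_upper[OF _ bdd_norm_fg]) simp
  show "norm (fg t x u) \<le> C" if "t \<in> {a..b}" "u \<in> U"
    unfolding C_def by (rule cSup_upper[OF _ bdd_norm_fg]) (use that in force)
qed

sublocale differential_inclusion a b C L K
proof
  fix t :: real and Y Y' :: "(real ^ 'n) \<times> real" assume t: "t \<in> {a..b}"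
  show "compact (K t Y)"
  proof -
    have "continuous_on U ((\<lambda>(t, x, u). fg t x u) \<circ> (\<lambda>u. (t, torus_of (fst Y), u)))"
      by (rule continuous_on_compose[OF _ continuous_on_subset[OF fg_continuous]])
        (use t in \<open>auto intro!: continuous_intros\<close>)
    then show ?thesis
      using U by (auto simp: K_def velocities_def o_def intro!: compact_convex_hull compact_continuous_image)
  qed
  show "convex (K t Y)" by (simp add: K_def velocities_def)
  show "norm v \<le> C" if "v \<in> K t Y" for v
  proof -
    have "K t Y \<subseteq> cball 0 C"
      unfolding K_def velocities_def
      by (rule hull_minimal) (use norm_fg[OF t] in auto)
    with that show ?thesis by auto
  qed
  show "K t Y \<subseteq> tube (K t Y') (L * dist Y Y')"
    unfolding K_def velocities_def
  proof (rule hull_subset_tube)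
    fix v assume "v \<in> fg t (torus_of (fst Y)) ` U"
    then obtain u where u: "u \<in> U" "v = fg t (torus_of (fst Y)) u" by blast
    have "dist v (fg t (torus_of (fst Y')) u) \<le> L * dist (torus_of (fst Y)) (torus_of (fst Y'))"
      unfolding u(2) by (rule fg_lipschitz[OF t u(1)])
    also have "\<dots> \<le> L * dist Y Y'"
      using dist_torus_of_le[of "fst Y" "fst Y'"] dist_fst_le[of Y Y'] L_nonneg by (intro mult_left_mono) auto
    finally show "\<exists>y\<in>fg t (torus_of (fst Y')) ` U. dist v y \<le> L * dist Y Y'" using u(1) by blast
  qed
next
  fix \<eta> :: real assume eta: "\<eta> > 0"
  have uc: "uniformly_continuous_on ({a..b} \<times> UNIV \<times> U) (\<lambda>(t, x, u). fg t x u)"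
    by (rule compact_uniformly_continuous[OF fg_continuous compact_domain])
  obtain d where d0: "d > 0" and d1: "\<forall>p\<in>{a..b} \<times> UNIV \<times> U. \<forall>q\<in>{a..b} \<times> UNIV \<times> U. dist q p < d \<longrightarrow>
      dist ((\<lambda>(t, x, u). fg t x u) q) ((\<lambda>(t, x, u). fg t x u) p) < \<eta>"
    using uc[unfolded uniformly_continuous_on_def, THEN spec, THEN mp, OF eta] by (elim exE conjE)
  note d = d0 d1[rule_format]
  have "K t Y \<subseteq> tube (K t' Y) \<eta>" if t: "t \<in> {a..b}" "t' \<in> {a..b}" "\<bar>t - t'\<bar> \<le> d / 2" for t t' Y
    unfolding K_def velocities_def
  proof (rule hull_subset_tube)
    fix v assume "v \<in> fg t (torus_of (fst Y)) ` U"
    then obtain u where u: "u \<in> U" "v = fg t (torus_of (fst Y)) u" by blast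
    have "dist (t, torus_of (fst Y), u) (t', torus_of (fst Y), u) < d"
      using t d(1) by (simp add: dist_prod_def dist_real_def)
    then have "dist v (fg t' (torus_of (fst Y)) u) \<le> \<eta>"
      using d(2)[of "(t', torus_of (fst Y), u)" "(t, torus_of (fst Y), u)"] t u by simp
    then show "\<exists>y\<in>fg t' (torus_of (fst Y)) ` U. dist v y \<le> \<eta>" using u(1) by blast
  qed
  then show "\<exists>\<delta>>0. \<forall>t\<in>{a..b}. \<forall>t'\<in>{a..b}. \<forall>Y. \<bar>t - t'\<bar> \<le> \<delta> \<longrightarrow> K t Y \<subseteq> tube (K t' Y) \<eta>"
    using d(1) by (intro exI[of _ "d / 2"]) auto
qed (rule C_nonneg L_nonneg)+

definition proj :: "(real ^ 'n) \<times> real \<Rightarrow> 'n torus \<times> real"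
  where "proj Y = (torus_of (fst Y), snd Y)"

lemma dist_proj_le: "dist (proj Y) (proj Y') \<le> dist Y Y'"
  unfolding proj_def dist_prod_def
  using dist_torus_of_le[of "fst Y" "fst Y'"] by (auto intro!: real_sqrt_le_mono add_mono power_mono)

lemma Sol_lift:
  assumes w: "w \<in> Sol f g U r s y m" and s: "a \<le> s" "s \<le> r" "r \<le> b"
  obtains W where "traj 0 s r W" "\<And>t. t \<in> {s..r} \<Longrightarrow> w t = proj (W t)" "fst (w s) = y"
proof -
  obtain W where W: "\<And>t. t \<in> {s..r} \<Longrightarrow> w t = proj (W t)" "absolutely_continuous_on s r W"
    "AE t in lebesgue. t \<in> {s..r} \<longrightarrow>
        (\<exists>v \<in> velocities f g U t (fst (w t)) (m t). (W has_vector_derivative v) (at t within {s..r}))"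
    using w by (auto simp: Sol_def proj_def)
  from W(3) have "AE t in lebesgue. t \<in> {s..r} \<longrightarrow>
      (\<exists>v\<in>tube (K t (W t)) 0. (W has_vector_derivative v) (at t within {s..r}))"
    by eventually_elim (use W(1) in \<open>auto simp: K_def proj_def\<close>)
  then have "traj 0 s r W" using s W(2) by (simp add: traj_def)
  then show ?thesis using that W(1) w by (auto simp: Sol_def)
qed

lemma traj_Sol:
  assumes tr: "traj 0 s r W"
  shows "restrict (\<lambda>t. proj (W t)) {s..r} \<in> Sol f g U r s (torus_of (fst (W s))) m"
proof -
  have "(C + 1)-lipschitz_on {s..r} (\<lambda>t. proj (W t))"
    using lipschitz_onD[OF traj_lipschitz[OF tr]] C_nonneg
    by (intro lipschitz_onI order_trans[OF dist_proj_le]) auto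
  then have "continuous_on {s..r} (\<lambda>t. proj (W t))" by (rule lipschitz_on_continuous_on)
  then have "continuous_on {s..r} (restrict (\<lambda>t. proj (W t)) {s..r})"
    by (rule continuous_on_eq) simp
  then have "restrict (\<lambda>t. proj (W t)) {s..r} \<in> mspace (curves s r)"
    by (simp add: mspace_curves)
  moreover have "AE t in lebesgue. t \<in> {s..r} \<longrightarrow>
      (\<exists>v\<in>tube (K t (W t)) 0. (W has_vector_derivative v) (at t within {s..r}))"
    using tr by (simp add: traj_def)
  then have "AE t in lebesgue. t \<in> {s..r} \<longrightarrow>
      (\<exists>v \<in> velocities f g U t (fst (restrict (\<lambda>t. proj (W t)) {s..r} t)) (m t).
        (W has_vector_derivative v) (at t within {s..r}))"
    by eventually_elim (auto simp: K_def proj_def)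
  ultimately show ?thesis
    using tr by (auto simp: Sol_def traj_def proj_def intro!: exI[of _ W])
qed

text \<open>Such shifts bring lifts over the same torus point to the same start; the second
  component of \<open>c\<close> is free because \<open>K\<close> ignores that of the state.\<close>

lemma traj_shift:
  assumes tr: "traj 0 s r W" and c: "fst c \<in> int_lattice"
  shows "traj 0 s r (\<lambda>t. W t + c)"
proof -
  have "K t (W t + c) = K t (W t)" for t
    using c by (simp add: K_def torus_of_add_lattice)
  moreover have "AE t in lebesgue. t \<in> {s..r} \<longrightarrow>
      (\<exists>v\<in>tube (K t (W t)) 0. (W has_vector_derivative v) (at t within {s..r}))"
    using tr by (simp add: traj_def)
  then have "AE t in lebesgue. t \<in> {s..r} \<longrightarrow>
      (\<exists>v\<in>tube (K t (W t)) 0. ((\<lambda>t. W t + c) has_vector_derivative v) (at t within {s..r}))"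
    by eventually_elim (auto intro!: derivative_eq_intros)
  ultimately show ?thesis
    using tr by (simp add: traj_def absolutely_continuous_on_def)
qed

end

section \<open>The value function: attainment, monotonicity, continuity\<close>

text \<open>\<open>traj_exists\<close> excludes an empty set of solutions, for which the supremum in
  \<open>bellman\<close> would be meaningless. One trajectory is enough, since
  \<open>filippov\<close> starts others from every point.\<close>

locale mean_field_value = mean_field_flow f g U m a b L
  for f :: "real \<Rightarrow> 'n::finite torus \<Rightarrow> 'n torus measure \<Rightarrow> 'u::metric_space \<Rightarrow> real ^ 'n"
    and g U m a b L +
  fixes \<psi> :: "'n torus \<Rightarrow>\<^sub>C real" and \<kappa> :: real
  assumes \<kappa>_nonneg: "\<kappa> \<ge> 0"
    and \<psi>_lipschitz: "\<And>x x'. \<bar>\<psi> x - \<psi> x'\<bar> \<le> \<kappa> * dist x x'"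
    and traj_exists: "\<exists>W. traj 0 a b W"
begin

abbreviation val :: "real \<Rightarrow> 'n torus \<Rightarrow> real"
  where "val s \<equiv> bellman f g U s b m \<psi>"

text \<open>Mayer form: the running gain is stored in the second component, so a trajectory earns
  \<open>payoff\<close> at its end minus the second component at its start.\<close>

definition payoff :: "(real ^ 'n) \<times> real \<Rightarrow> real"
  where "payoff Y = \<psi> (torus_of (fst Y)) + snd Y"

lemma payoff_lipschitz: "\<bar>payoff Y - payoff Y'\<bar> \<le> (\<kappa> + 1) * dist Y Y'"
proof -
  have "\<bar>\<psi> (torus_of (fst Y)) - \<psi> (torus_of (fst Y'))\<bar> \<le> \<kappa> * dist (torus_of (fst Y)) (torus_of (fst Y'))"
    by (rule \<psi>_lipschitz)
  also have "\<dots> \<le> \<kappa> * dist Y Y'"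
    using dist_torus_of_le[of "fst Y" "fst Y'"] dist_fst_le[of Y Y'] \<kappa>_nonneg by (intro mult_left_mono) auto
  finally show ?thesis
    using dist_snd_le[of Y Y'] by (simp add: payoff_def dist_real_def algebra_simps)
qed

lemma continuous_on_payoff: "continuous_on S payoff"
proof -
  have "(\<kappa> + 1)-lipschitz_on S payoff"
    using payoff_lipschitz \<kappa>_nonneg by (intro lipschitz_onI) (auto simp: dist_real_def)
  then show ?thesis by (rule lipschitz_on_continuous_on)
qed

lemma payoff_shift: "fst c \<in> int_lattice \<Longrightarrow> payoff (Y + c) = payoff Y + snd c"
  by (simp add: payoff_def torus_of_add_lattice)

text \<open>A maximiser from the fixed lift \<open>Y\<close> is best among all lifts over the same
  torus point: a shift moves any competitor to start at \<open>Y\<close> without changing its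
  gain.\<close>

lemma optimal_traj_lift:
  assumes s: "s \<in> {a..b}"
  obtains V where "traj 0 s b V" "V s = Y"
    "\<And>W. traj 0 s b W \<Longrightarrow> torus_of (fst (W s)) = torus_of (fst Y) \<Longrightarrow> payoff (W b) - snd (W s) \<le> payoff (V b) - snd Y"
proof -
  obtain W0 where "traj 0 a b W0" using traj_exists by blast
  then have "traj 0 s b W0" using s traj_restrict[of 0 a b W0 s b] by simp
  then obtain V1 where V1: "traj 0 s b V1" "V1 s = Y" using filippov[of s b W0 Y] by blast
  obtain V where V: "traj 0 s b V" "V s = Y" "\<And>V'. traj 0 s b V' \<Longrightarrow> V' s = Y \<Longrightarrow> payoff (V' b) \<le> payoff (V b)"
    using traj_attains_sup[OF V1(1) continuous_on_payoff] V1(2) by metis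
  show ?thesis
  proof (rule that[OF V(1,2)])
    fix W assume W: "traj 0 s b W" "torus_of (fst (W s)) = torus_of (fst Y)"
    define c where "c = Y - W s"
    have c: "fst c \<in> int_lattice"
      using W(2)[symmetric] by (simp add: c_def torus_of_eq_iff)
    have "payoff (W b + c) \<le> payoff (V b)"
      using V(3)[OF traj_shift[OF W(1) c]] by (simp add: c_def)
    then show "payoff (W b) - snd (W s) \<le> payoff (V b) - snd Y"
      by (simp add: payoff_shift[OF c]) (simp add: c_def)
  qed
qed

text \<open>One maximiser on the cover serves all three claims; \<open>traj_Sol\<close> projects it
  into \<open>Sol\<close>, and \<open>Sol_lift\<close> lifts every competitor.\<close>

lemma
  assumes s: "s \<in> {a..b}"
  shows bellman_attained: "\<exists>w\<in>Sol f g U b s y m. val s y = \<psi> (fst (w b)) + snd (w b) - snd (w s) \<and>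
    (\<forall>w'\<in>Sol f g U b s y m. \<psi> (fst (w' b)) + snd (w' b) - snd (w' s) \<le> val s y)"
    and optimal_traj: "\<exists>V. traj 0 s b V \<and> V s = Y \<and> val s (torus_of (fst Y)) = payoff (V b) - snd Y"
    and traj_le_value: "\<And>W. traj 0 s b W \<Longrightarrow> payoff (W b) - snd (W s) \<le> val s (torus_of (fst (W s)))"
proof -
  have main: "\<exists>V. traj 0 s b V \<and> V s = Y \<and> val s (torus_of (fst Y)) = payoff (V b) - snd Y \<and>
     (\<exists>w\<in>Sol f g U b s (torus_of (fst Y)) m. payoff (V b) - snd Y = \<psi> (fst (w b)) + snd (w b) - snd (w s) \<and>
    (\<forall>w'\<in>Sol f g U b s (torus_of (fst Y)) m. \<psi> (fst (w' b)) + snd (w' b) - snd (w' s) \<le> payoff (V b) - snd Y)) \<and>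
    (\<forall>W. traj 0 s b W \<longrightarrow> torus_of (fst (W s)) = torus_of (fst Y) \<longrightarrow> payoff (W b) - snd (W s) \<le> payoff (V b) - snd Y)"
    for Y
  proof -
    obtain V where V: "traj 0 s b V" "V s = Y"
      "\<And>W. traj 0 s b W \<Longrightarrow> torus_of (fst (W s)) = torus_of (fst Y) \<Longrightarrow> payoff (W b) - snd (W s) \<le> payoff (V b) - snd Y"
      using optimal_traj_lift[OF s] by blast
    define w where "w = restrict (\<lambda>t. proj (V t)) {s..b}"
    have w: "w \<in> Sol f g U b s (torus_of (fst Y)) m"
      using traj_Sol[OF V(1)] by (simp add: w_def V(2))
    have wv: "\<psi> (fst (w b)) + snd (w b) - snd (w s) = payoff (V b) - snd Y"
      using s V(2) by (simp add: w_def payoff_def proj_def)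
    have le: "\<psi> (fst (w' b)) + snd (w' b) - snd (w' s) \<le> payoff (V b) - snd Y"
      if w': "w' \<in> Sol f g U b s (torus_of (fst Y)) m" for w'
    proof -
      obtain W where W: "traj 0 s b W" "\<And>t. t \<in> {s..b} \<Longrightarrow> w' t = proj (W t)" "fst (w' s) = torus_of (fst Y)"
        using Sol_lift[OF w'] s by auto
      then show ?thesis using V(3)[OF W(1)] s by (simp add: payoff_def proj_def)
    qed
    have "val s (torus_of (fst Y)) = \<psi> (fst (w b)) + snd (w b) - snd (w s)"
      unfolding bellman_def by (rule cSup_eq_attained[OF w]) (use le wv in auto)
    then show ?thesis using V w wv le by metis
  qed
  show "\<exists>V. traj 0 s b V \<and> V s = Y \<and> val s (torus_of (fst Y)) = payoff (V b) - snd Y"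
    using main[of Y] by blast
  show "payoff (W b) - snd (W s) \<le> val s (torus_of (fst (W s)))" if "traj 0 s b W" for W
    using main[of "W s"] that by metis
  obtain x where x: "torus_of x = y" using torus_of_surj by blast
  show "\<exists>w\<in>Sol f g U b s y m. val s y = \<psi> (fst (w b)) + snd (w b) - snd (w s) \<and>
    (\<forall>w'\<in>Sol f g U b s y m. \<psi> (fst (w' b)) + snd (w' b) - snd (w' s) \<le> val s y)"
    using main[of "(x, 0)"] x by auto
qed

text \<open>Lipschitz constant \<open>\<kappa> + 1\<close> of \<open>payoff\<close> times the growth
  factor of \<open>filippov\<close> over the longest horizon.\<close>

definition \<Lambda> :: real
  where "\<Lambda> = (\<kappa> + 1) * exp (L * (b - a))"

lemma \<Lambda>_nonneg: "\<Lambda> \<ge> 0"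
  using \<kappa>_nonneg by (simp add: \<Lambda>_def)

text \<open>A solution from the other point shadows the optimal one by \<open>filippov\<close>. The
  distance of the lifts exceeds that on the torus by less than \<open>e'\<close>, which costs at
  most the arbitrary \<open>e\<close>.\<close>

lemma value_lipschitz:
  assumes s: "s \<in> {a..b}"
  shows "\<bar>val s y - val s y'\<bar> \<le> \<Lambda> * dist y y'"
proof -
  have one: "val s y \<le> val s y' + \<Lambda> * dist y y'" for y y'
  proof (rule field_le_epsilon)
    fix e :: real assume e: "e > 0"
    define e' where "e' = e / (\<Lambda> + 1)"
    have e': "e' > 0" "\<Lambda> * e' \<le> e"
      using e \<Lambda>_nonneg by (auto simp: e'_def field_simps)
    obtain x where x: "torus_of x = y" using torus_of_surj by blast
    obtain x' where x': "torus_of x' = y'" "dist x x' < dist y y' + e'"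
      using torus_lift_close[OF e'(1), of y' x] x by metis
    obtain V where V: "traj 0 s b V" "V s = (x, 0)" "val s y = payoff (V b) - 0"
      using optimal_traj[OF s, of "(x, 0)"] x by auto
    obtain W where W: "traj 0 s b W" "W s = (x', 0)" "dist (W b) (V b) \<le> exp (L * (b - s)) * dist (x', 0) (V s)"
      using filippov[OF V(1)] by blast
    have "dist (W b) (V b) \<le> exp (L * (b - a)) * (dist y y' + e')"
    proof (rule order_trans[OF W(3)], rule mult_mono)
      show "exp (L * (b - s)) \<le> exp (L * (b - a))" using s L_nonneg by (auto intro!: mult_left_mono)
      show "dist (x', 0) (V s) \<le> dist y y' + e'" using x'(2) by (simp add: V(2) dist_prod_def dist_commute)
    qed auto
    then have "(\<kappa> + 1) * dist (W b) (V b) \<le> (\<kappa> + 1) * (exp (L * (b - a)) * (dist y y' + e'))"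
      using \<kappa>_nonneg by (intro mult_left_mono) auto
    also have "\<dots> = \<Lambda> * dist y y' + \<Lambda> * e'" by (simp add: \<Lambda>_def algebra_simps)
    finally have "payoff (V b) - payoff (W b) \<le> \<Lambda> * dist y y' + e"
      using payoff_lipschitz[of "V b" "W b"] e'(2) by (simp add: dist_commute)
    moreover have "payoff (W b) \<le> val s y'"
      using traj_le_value[OF s W(1)] x'(1) by (simp add: W(2))
    ultimately show "val s y \<le> val s y' + \<Lambda> * dist y y' + e" using V(3) by simp
  qed
  show ?thesis using one[of y y'] one[of y' y] by (simp add: dist_commute)
qed

text \<open>Continuing \<open>W\<close> after \<open>r\<close> by an optimal trajectory from
  \<open>W r\<close>, second component included, gives a competitor at time
  \<open>s\<close>.\<close>

lemma value_decreasing: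
  assumes tr: "traj 0 s r W" and s: "a \<le> s" "s \<le> r" "r \<le> b"
  shows "val r (torus_of (fst (W r))) + snd (W r) \<le> val s (torus_of (fst (W s))) + snd (W s)"
proof -
  have r: "r \<in> {a..b}" and s': "s \<in> {a..b}" using s by auto
  obtain V where V: "traj 0 r b V" "V r = W r" "val r (torus_of (fst (W r))) = payoff (V b) - snd (W r)"
    using optimal_traj[OF r, of "W r"] by blast
  define Z where "Z t = (if t \<le> r then W t else V t)" for t
  have "traj 0 s b Z"
    unfolding Z_def[abs_def] using traj_join[OF tr V(1) V(2)[symmetric]] by simp
  from traj_le_value[OF s' this] show ?thesis
    \<comment> \<open>If \<open>r = b\<close>, then \<open>Z b\<close> takes the first branch; it
      equals \<open>V b\<close> because \<open>V\<close> starts at \<open>W r\<close>.\<close>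
    using s V by (cases "r = b") (auto simp: Z_def)
qed

text \<open>Along a trajectory optimal from \<open>(s, y)\<close>, value plus second component agree
  at \<open>s\<close> and \<open>r\<close>: facts 3 and 4 are the two inequalities. Facts 1 and 2
  bound the effect of the displacement of \<open>V\<close> between these times.\<close>

lemma value_time_lipschitz:
  assumes s: "a \<le> s" "s \<le> r" "r \<le> b"
  shows "\<bar>val s y - val r y\<bar> \<le> (\<Lambda> + 1) * (C + 1) * (r - s)"
proof -
  have r: "r \<in> {a..b}" and s': "s \<in> {a..b}" using s by auto
  obtain x where x: "torus_of x = y" using torus_of_surj by blast
  obtain V where V: "traj 0 s b V" "V s = (x, 0)" "val s y = payoff (V b)"
    using optimal_traj[OF s', of "(x, 0)"] x by auto
  have d: "dist (V r) (V s) \<le> (C + 1) * (r - s)"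
    using lipschitz_onD[OF traj_lipschitz[OF V(1)], of r s] s by (simp add: dist_real_def)
  have "dist (torus_of (fst (V r))) y \<le> dist (V r) (V s)"
    using dist_torus_of_le[of "fst (V r)" x] dist_fst_le[of "V r" "V s"] x by (simp add: V(2))
  then have "\<Lambda> * dist (torus_of (fst (V r))) y \<le> \<Lambda> * ((C + 1) * (r - s))"
    using d \<Lambda>_nonneg by (intro mult_left_mono) auto
  then have 1: "\<bar>val r (torus_of (fst (V r))) - val r y\<bar> \<le> \<Lambda> * ((C + 1) * (r - s))"
    using value_lipschitz[OF r, of "torus_of (fst (V r))" y] by linarith
  have 2: "\<bar>snd (V r)\<bar> \<le> (C + 1) * (r - s)"
    using d dist_snd_le[of "V r" "V s"] by (simp add: V(2) dist_real_def)
  have 3: "payoff (V b) - snd (V r) \<le> val r (torus_of (fst (V r)))"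
    using V(1) s by (intro traj_le_value[OF r] traj_restrict[OF V(1)]) auto
  have 4: "val r (torus_of (fst (V r))) + snd (V r) \<le> val s y"
    using value_decreasing[OF traj_restrict[OF V(1)] s] s x by (simp add: V(2))
  show ?thesis
    using 1 2 3 4 V(3) by (simp add: algebra_simps abs_le_iff)
qed

lemma continuous_on_value: "continuous_on ({a..b} \<times> UNIV) (\<lambda>(t, x). val t x)"
proof -
  define M where "M = \<Lambda> + (\<Lambda> + 1) * (C + 1)"
  have M: "M \<ge> 0" using \<Lambda>_nonneg C_nonneg by (simp add: M_def)
  have time: "\<bar>val s y - val r y\<bar> \<le> (\<Lambda> + 1) * (C + 1) * \<bar>r - s\<bar>" if "s \<in> {a..b}" "r \<in> {a..b}" for s r y
  proof (cases "s \<le> r")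
    case True then show ?thesis using value_time_lipschitz[of s r y] that by auto
  next
    case False then show ?thesis using value_time_lipschitz[of r s y] that by (auto simp: abs_minus_commute)
  qed
  have "M-lipschitz_on ({a..b} \<times> UNIV) (\<lambda>(t, x). val t x)"
  proof (rule lipschitz_onI[OF _ M])
    fix p q :: "real \<times> 'n torus" assume p: "p \<in> {a..b} \<times> UNIV" "q \<in> {a..b} \<times> UNIV"
    obtain s y r y' where pq: "p = (s, y)" "q = (r, y')" by (cases p, cases q)
    have "\<bar>val s y - val r y'\<bar> \<le> \<bar>val s y - val s y'\<bar> + \<bar>val s y' - val r y'\<bar>" by simp
    also have "\<dots> \<le> \<Lambda> * dist y y' + (\<Lambda> + 1) * (C + 1) * \<bar>r - s\<bar>"
      using value_lipschitz[of s y y'] time[of s r y'] p pq by (intro add_mono) auto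
    also have "\<dots> \<le> \<Lambda> * dist p q + (\<Lambda> + 1) * (C + 1) * dist p q"
      using dist_fst_le[of p q] dist_snd_le[of p q] \<Lambda>_nonneg C_nonneg
      by (intro add_mono mult_left_mono) (auto simp: pq dist_real_def abs_minus_commute)
    finally show "dist ((\<lambda>(t, x). val t x) p) ((\<lambda>(t, x). val t x) q) \<le> M * dist p q"
      by (simp add: pq M_def dist_real_def algebra_simps)
  qed
  then show ?thesis by (rule lipschitz_on_continuous_on)
qed

end

section \<open>Laws on the space of curves\<close>

text \<open>Finite nets of radius \<open>inverse (real (Suc n))\<close> give a countable base. The
  instance underlies the countable dense set used to separate curves and the measurability of
  distances between evaluations.\<close>

instance torus :: (finite) second_countable_topology
proof
  have "\<exists>k. finite k \<and> (UNIV :: 'a torus set) \<subseteq> (\<Union>x\<in>k. ball x e)" if "e > 0" for e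
    using compact_torus that unfolding compact_eq_totally_bounded by blast
  then have "\<exists>k. finite k \<and> (UNIV :: 'a torus set) \<subseteq> (\<Union>x\<in>k. ball x (inverse (real (Suc n))))" for n
    by simp
  then obtain k where k: "\<And>n. finite (k n)"
    "\<And>n. (UNIV :: 'a torus set) \<subseteq> (\<Union>x\<in>k n. ball x (inverse (real (Suc n))))"
    by metis
  define B where "B = (\<Union>n. (\<lambda>x. ball x (inverse (real (Suc n)))) ` k n)"
  have "countable B"
    unfolding B_def by (intro countable_UN[OF countableI_type] countable_image countable_finite[OF k(1)])
  moreover have "topological_basis B"
  proof (rule topological_basisI)
    fix O' and x :: "'a torus" assume O': "open O'" "x \<in> O'"
    then obtain e where e: "e > 0" "ball x e \<subseteq> O'" by (auto simp: open_contains_ball)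
    obtain n where n: "inverse (real (Suc n)) < e / 2"
      using reals_Archimedean[of "e / 2"] e(1) by auto
    obtain y where y: "y \<in> k n" "x \<in> ball y (inverse (real (Suc n)))" using k(2)[of n] by blast
    have "ball y (inverse (real (Suc n))) \<subseteq> ball x e"
    proof
      fix z assume "z \<in> ball y (inverse (real (Suc n)))"
      then show "z \<in> ball x e"
        using y(2) n dist_triangle[of x z y] by (simp add: dist_commute)
    qed
    then show "\<exists>B'\<in>B. x \<in> B' \<and> B' \<subseteq> O'"
      using y e(2) unfolding B_def by (intro bexI[of _ "ball y (inverse (real (Suc n)))"]) auto
  qed (auto simp: B_def)
  ultimately show "\<exists>B :: 'a torus set set. countable B \<and> open = generate_topology B"
    using topological_basis_imp_subbasis by blast
qed

lemma space_borel_of [simp]: "space (borel_of X) = topspace X"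
  unfolding borel_of_def by (subst space_measure_of) (auto dest: openin_subset)

lemma openin_sets_borel_of: "openin X S \<Longrightarrow> S \<in> sets (borel_of X)"
  unfolding borel_of_def by (subst sets_measure_of) (auto dest: openin_subset)

lemma measurable_borel_ofI:
  assumes "\<And>x. x \<in> space M \<Longrightarrow> h x \<in> topspace Y"
    and "\<And>S. openin Y S \<Longrightarrow> h -` S \<inter> space M \<in> sets M"
  shows "h \<in> M \<rightarrow>\<^sub>M borel_of Y"
  unfolding borel_of_def by (rule measurable_measure_of) (use assms openin_subset in blast)+

lemma continuous_map_measurable_borel_of:
  assumes "continuous_map X Y h"
  shows "h \<in> borel_of X \<rightarrow>\<^sub>M borel_of Y"
proof (rule measurable_borel_ofI)
  show "h x \<in> topspace Y" if "x \<in> space (borel_of X)" for x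
    using that continuous_map_image_subset_topspace[OF assms] by auto
  fix S assume "openin Y S"
  then have "openin X {x \<in> topspace X. h x \<in> S}"
    by (rule openin_continuous_map_preimage[OF assms])
  moreover have "h -` S \<inter> space (borel_of X) = {x \<in> topspace X. h x \<in> S}" by auto
  ultimately show "h -` S \<inter> space (borel_of X) \<in> sets (borel_of X)"
    by (simp add: openin_sets_borel_of)
qed

lemma openin_mtopology_of_iff:
  "openin (mtopology_of X) S \<longleftrightarrow> S \<subseteq> mspace X \<and> (\<forall>x\<in>S. \<exists>e>0. \<forall>y\<in>mspace X. mdist X x y < e \<longrightarrow> y \<in> S)"
proof -
  interpret Metric_space "mspace X" "mdist X" by (rule Metric_space_mspace_mdist)
  have "openin (mtopology_of X) S \<longleftrightarrow> S \<subseteq> mspace X \<and> (\<forall>x\<in>S. \<exists>e>0. mball x e \<subseteq> S)"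
    unfolding mtopology_of_def openin_mtopology Ball_def ..
  also have "\<dots> \<longleftrightarrow> S \<subseteq> mspace X \<and> (\<forall>x\<in>S. \<exists>e>0. \<forall>y\<in>mspace X. mdist X x y < e \<longrightarrow> y \<in> S)"
  proof (intro conj_cong ball_cong refl)
    fix x assume "S \<subseteq> mspace X" "x \<in> S"
    then have "mball x e \<subseteq> S \<longleftrightarrow> (\<forall>y\<in>mspace X. mdist X x y < e \<longrightarrow> y \<in> S)" for e
      by (auto simp: mball_def)
    then show "(\<exists>e>0. mball x e \<subseteq> S) \<longleftrightarrow> (\<exists>e>0. \<forall>y\<in>mspace X. mdist X x y < e \<longrightarrow> y \<in> S)"
      by simp
  qed
  finally show ?thesis .
qed

lemma P1_sets:
  assumes "M \<in> P1 X"
  shows "sets M = sets (borel_of (mtopology_of X))" "space M = mspace X" "prob_space M"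
  using assms sets_eq_imp_space_eq[of M "borel_of (mtopology_of X)"] by (auto simp: P1_def)

lemma mdist_curves_ge:
  assumes "w \<in> mspace (curves s r)" "v \<in> mspace (curves s r)" "t \<in> {s..r}"
  shows "dist (w t) (v t) \<le> mdist (curves s r) w v"
    and "dist (fst (w t)) (fst (v t)) + dist (snd (w t)) (snd (v t)) \<le> mdist (curves s r) w v"
proof -
  show *: "dist (fst (w t)) (fst (v t)) + dist (snd (w t)) (snd (v t)) \<le> mdist (curves s r) w v"
    using mdist_cfunspace_imp_mdist_le[of w "top_of_set {s..r}" sum_metric v "mdist (curves s r) w v" t] assms
    by (simp add: curves_def del: mspace_cfunspace)
  show "dist (w t) (v t) \<le> mdist (curves s r) w v"
    using * sqrt_sum_squares_le_sum[of "dist (fst (w t)) (fst (v t))" "dist (snd (w t)) (snd (v t))"]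
    by (simp add: dist_prod_def)
qed

lemma continuous_map_eval:
  assumes t: "t \<in> {s..r}"
  shows "continuous_map (mtopology_of (curves s r)) euclidean (\<lambda>w. w t)"
  unfolding continuous_map_def
proof (intro conjI allI impI)
  fix S :: "('a torus \<times> real) set" assume S: "openin euclidean S"
  show "openin (mtopology_of (curves s r)) {w \<in> topspace (mtopology_of (curves s r)). w t \<in> S}"
    unfolding openin_mtopology_of_iff
  proof (intro conjI ballI)
    fix w assume "w \<in> {w \<in> topspace (mtopology_of (curves s r)). w t \<in> S}"
    then have w: "w \<in> mspace (curves s r)" "w t \<in> S" by auto
    then obtain e where e: "e > 0" "ball (w t) e \<subseteq> S" using S by (auto simp: open_contains_ball)
    have "v t \<in> S" if "v \<in> mspace (curves s r)" "mdist (curves s r) w v < e" for v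
    proof -
      have "v t \<in> ball (w t) e" using mdist_curves_ge(1)[OF w(1) that(1) t] that(2) by simp
      then show ?thesis using e(2) by blast
    qed
    then show "\<exists>e>0. \<forall>v\<in>mspace (curves s r). mdist (curves s r) w v < e \<longrightarrow>
        v \<in> {w \<in> topspace (mtopology_of (curves s r)). w t \<in> S}"
      using e(1) by auto
  qed auto
qed simp

lemma P1_curves_measurable:
  assumes "\<gamma> \<in> P1 (curves s r)" "continuous_map (mtopology_of (curves s r)) euclidean h"
  shows "h \<in> \<gamma> \<rightarrow>\<^sub>M borel"
  using continuous_map_measurable_borel_of[OF assms(2)] P1_sets(1)[OF assms(1)]
  by (simp cong: measurable_cong_sets)

section \<open>Separability of the space of curves and the support of a law\<close>

text \<open>A curve is coded by finitely many basic open sets covering \<open>{s..r}\<close>, each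
  with a point of a countable dense set near which the curve stays there. Compactness of
  \<open>{s..r}\<close> gives every curve a code, and finite codes are countably many.\<close>

lemma curves_countable_cover:
  fixes s r :: real
  assumes e: "e > 0"
  obtains \<A> :: "(real \<Rightarrow> 'n::finite torus \<times> real) set set" where
    "countable \<A>" "mspace (curves s r) \<subseteq> \<Union>\<A>"
    "\<And>A w v. A \<in> \<A> \<Longrightarrow> w \<in> A \<Longrightarrow> v \<in> A \<Longrightarrow> mdist (curves s r) w v \<le> e"
proof -
  obtain B :: "real set set" where B: "countable B" "topological_basis B"
    using ex_countable_basis by blast
  obtain D :: "('n torus \<times> real) set" where D: "countable D" "\<And>X. open X \<Longrightarrow> X \<noteq> {} \<Longrightarrow> \<exists>d\<in>D. d \<in> X"
    by (rule countable_dense_setE) blast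
  \<comment> \<open>With \<open>e / 4\<close>, two curves sharing a code are within
    \<open>e / 2\<close> in the product metric, hence within \<open>e\<close> in the sum
    metric.\<close>
  define tb where "tb F = {w :: real \<Rightarrow> 'n torus \<times> real. {s..r} \<subseteq> \<Union>(fst ` F) \<and>
    (\<forall>(b, d)\<in>F. \<forall>t\<in>b \<inter> {s..r}. dist (w t) d < e / 4)}" for F
  define \<F> where "\<F> = {F. finite F \<and> F \<subseteq> B \<times> D}"
  show ?thesis
  proof (rule that[of "tb ` \<F>"])
    show "countable (tb ` \<F>)"
      unfolding \<F>_def using B(1) D(1) countable_Collect_finite_subset[of "B \<times> D"]
      by (intro countable_image) (simp add: conj_commute)
  next
    show "mspace (curves s r) \<subseteq> \<Union>(tb ` \<F>)"
    proof
      fix w :: "real \<Rightarrow> 'n torus \<times> real" assume "w \<in> mspace (curves s r)"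
      then have w: "continuous_on {s..r} w" by (simp add: mspace_curves)
      have "\<exists>b\<in>B. \<exists>d\<in>D. t \<in> b \<and> (\<forall>t'\<in>b \<inter> {s..r}. dist (w t') d < e / 4)" if t: "t \<in> {s..r}" for t
      proof -
        obtain d where d: "d \<in> D" "d \<in> ball (w t) (e / 8)"
          using D(2)[of "ball (w t) (e / 8)"] e by auto
        obtain \<delta> where \<delta>: "\<delta> > 0" "\<And>t'. t' \<in> {s..r} \<Longrightarrow> dist t' t < \<delta> \<Longrightarrow> dist (w t') (w t) < e / 8"
          using w[unfolded continuous_on_iff, rule_format, OF t, of "e / 8"] e by auto
        obtain b where b: "b \<in> B" "t \<in> b" "b \<subseteq> ball t \<delta>"
          using topological_basisE[OF B(2), of "ball t \<delta>" t] \<delta>(1) by auto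
        have "dist (w t') d < e / 4" if t': "t' \<in> b \<inter> {s..r}" for t'
        proof -
          have "dist (w t') (w t) < e / 8" using \<delta>(2)[of t'] b(3) t' by (auto simp: dist_commute)
          then show ?thesis using d(2) dist_triangle[of "w t'" d "w t"] by simp
        qed
        then show ?thesis using b d(1) by blast
      qed
      then obtain b d where bd: "\<And>t. t \<in> {s..r} \<Longrightarrow> b t \<in> B" "\<And>t. t \<in> {s..r} \<Longrightarrow> d t \<in> D"
        "\<And>t. t \<in> {s..r} \<Longrightarrow> t \<in> b t"
        "\<And>t t'. t \<in> {s..r} \<Longrightarrow> t' \<in> b t \<inter> {s..r} \<Longrightarrow> dist (w t') (d t) < e / 4"
        by metis
      obtain I where I: "I \<subseteq> {s..r}" "finite I" "{s..r} \<subseteq> (\<Union>t\<in>I. b t)"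
      proof (rule compactE_image[of "{s..r}" "{s..r}" b])
        show "open (b t)" if "t \<in> {s..r}" for t
          using bd(1)[OF that] B(2) topological_basis_open by blast
      qed (use bd(3) in auto)
      have "(\<lambda>t. (b t, d t)) ` I \<in> \<F>"
        using I bd(1,2) by (auto simp: \<F>_def)
      moreover have "w \<in> tb ((\<lambda>t. (b t, d t)) ` I)"
        using I bd(4) by (auto simp: tb_def image_image)
      ultimately show "w \<in> \<Union>(tb ` \<F>)" by blast
    qed
  next
    fix A w v assume "A \<in> tb ` \<F>" and wv: "w \<in> A" "v \<in> A"
    then obtain F where F: "A = tb F" by blast
    show "mdist (curves s r) w v \<le> e"
      unfolding curves_def
    proof (rule mdist_cfunspace_le)
      fix t assume "t \<in> topspace (top_of_set {s..r})"
      then have t: "t \<in> {s..r}" by simp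
      then have "t \<in> \<Union>(fst ` F)" using wv(1) unfolding F tb_def by blast
      then obtain b d where bd: "(b, d) \<in> F" "t \<in> b" by auto
      then have *: "dist (w t) d < e / 4" "dist (v t) d < e / 4"
        using wv t by (auto simp: F tb_def)
      then have "dist (w t) (v t) < e / 2"
        using dist_triangle2[of "w t" "v t" d] by simp
      then show "mdist sum_metric (w t) (v t) \<le> e"
        using dist_fst_le[of "w t" "v t"] dist_snd_le[of "w t" "v t"] by simp
    qed (use e in simp)
  qed
qed

text \<open>The support has full measure since the space of curves is separable. The covers by small sets
  replace a countable base; their members need not be measurable.\<close>

lemma AE_measure_supp_curves:
  fixes \<gamma> :: "(real \<Rightarrow> 'n::finite torus \<times> real) measure"
  assumes P: "\<gamma> \<in> P1 (curves s r)"
  shows "AE w in \<gamma>. w \<in> measure_supp (curves s r) \<gamma>"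
proof -
  let ?X = "curves s r"
  have "\<exists>\<A> :: (real \<Rightarrow> 'n torus \<times> real) set set. countable \<A> \<and> mspace ?X \<subseteq> \<Union>\<A> \<and>
    (\<forall>A w v. A \<in> \<A> \<longrightarrow> w \<in> A \<longrightarrow> v \<in> A \<longrightarrow> mdist ?X w v \<le> inverse (real (Suc n)))" for n
    by (rule curves_countable_cover[of "inverse (real (Suc n))" s r]) auto
  then obtain \<A> :: "nat \<Rightarrow> (real \<Rightarrow> 'n torus \<times> real) set set" where \<A>: "\<And>n. countable (\<A> n)" "\<And>n. mspace ?X \<subseteq> \<Union>(\<A> n)"
    "\<And>n A w v. A \<in> \<A> n \<Longrightarrow> w \<in> A \<Longrightarrow> v \<in> A \<Longrightarrow> mdist ?X w v \<le> inverse (real (Suc n))"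
    by metis
  define Q where "Q A S \<longleftrightarrow> S \<in> null_sets \<gamma> \<and> A \<inter> mspace ?X \<subseteq> S" for A S
  \<comment> \<open>One null superset is fixed for each cell \<open>A\<close> that has any,
    independently of the curve, so that countably many null sets cover the complement of the
    support.\<close>
  define G where "G A = (if \<exists>S. Q A S then SOME S. Q A S else {})" for A
  have G_null: "G A \<in> null_sets \<gamma>" for A
  proof (cases "\<exists>S. Q A S")
    case True
    then have "Q A (G A)" unfolding G_def by (simp add: someI_ex)
    then show ?thesis by (simp add: Q_def)
  qed (simp add: G_def)
  have "(\<Union>n. \<Union>A\<in>\<A> n. G A) \<in> null_sets \<gamma>"
    using \<A>(1) G_null by (intro null_sets_UN null_sets_UN') auto
  then show ?thesis
  proof (rule AE_I', intro subsetI)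
    fix w assume "w \<in> {w \<in> space \<gamma>. w \<notin> measure_supp ?X \<gamma>}"
    then have w: "w \<in> mspace ?X" "w \<notin> measure_supp ?X \<gamma>" using P1_sets(2)[OF P] by auto
    then obtain S where S: "openin (mtopology_of ?X) S" "w \<in> S" "emeasure \<gamma> S = 0"
      by (auto simp: measure_supp_def zero_less_iff_neq_zero)
    then obtain e where e: "e > 0" "\<And>v. v \<in> mspace ?X \<Longrightarrow> mdist ?X w v < e \<Longrightarrow> v \<in> S"
      unfolding openin_mtopology_of_iff by blast
    obtain n where n: "inverse (real (Suc n)) < e" using reals_Archimedean[OF e(1)] by blast
    obtain A where A: "A \<in> \<A> n" "w \<in> A" using \<A>(2)[of n] w(1) by blast
    have "S \<in> null_sets \<gamma>"
      using S P1_sets(1)[OF P] openin_sets_borel_of by (auto intro: null_setsI)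
    moreover have "A \<inter> mspace ?X \<subseteq> S"
      using \<A>(3)[OF A(1,2)] n e(2) by fastforce
    ultimately have "Q A S" by (simp add: Q_def)
    then have "Q A (G A)" unfolding G_def using someI[of "Q A" S] by auto
    then show "w \<in> (\<Union>n. \<Union>A\<in>\<A> n. G A)" using A w(1) by (auto simp: Q_def)
  qed
qed

section \<open>Wasserstein continuity of the marginals\<close>

lemma bounded_dist_torus: "\<exists>B. \<forall>x y :: 'n::finite torus. dist x y \<le> B"
  using compact_imp_bounded[OF compact_torus] unfolding bounded_two_points by blast

lemma P1_torus_iff:
  "M \<in> P1 (euclidean_metric :: 'n::finite torus metric) \<longleftrightarrow> sets M = sets borel \<and> prob_space M"
proof
  assume M: "sets M = sets borel \<and> prob_space M"
  then interpret prob_space M by simp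
  obtain B where B: "\<And>x y :: 'n torus. dist x y \<le> B" using bounded_dist_torus by blast
  have [measurable_cong]: "sets M = sets borel" using M by simp
  have "integrable M (\<lambda>x. dist x0 x)" for x0 :: "'n torus"
    by (rule integrable_const_bound[of _ B]) (use B in auto)
  then show "M \<in> P1 (euclidean_metric :: 'n torus metric)"
    using M by (auto simp: P1_def)
qed (auto simp: P1_def)

lemma W1_nonneg: "couplings X M N \<noteq> {} \<Longrightarrow> W1 X M N \<ge> 0"
  unfolding W1_def by (intro cINF_greatest integral_nonneg) auto

text \<open>The joint law of \<open>(X, Y)\<close> is a coupling. It also makes the infimum range
  over a nonempty set, as the lower bound requires.\<close>

lemma W1_marginals_le:
  assumes X[measurable]: "X \<in> P \<rightarrow>\<^sub>M borel" and Y[measurable]: "Y \<in> P \<rightarrow>\<^sub>M (borel :: 'n::finite torus measure)"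
  shows "0 \<le> W1 euclidean_metric (distr P borel X) (distr P borel Y)"
    and "W1 euclidean_metric (distr P borel X) (distr P borel Y) \<le> (\<integral>w. dist (X w) (Y w) \<partial>P)"
proof -
  let ?\<pi> = "distr P (borel \<Otimes>\<^sub>M borel) (\<lambda>w. (X w, Y w))"
  have \<pi>: "?\<pi> \<in> couplings euclidean_metric (distr P borel X) (distr P borel Y)"
    by (simp add: couplings_def distr_distr o_def)
  then show "0 \<le> W1 euclidean_metric (distr P borel X) (distr P borel Y)"
    by (intro W1_nonneg) auto
  have "W1 euclidean_metric (distr P borel X) (distr P borel Y) \<le> (\<integral>p. dist (fst p) (snd p) \<partial>?\<pi>)"
    unfolding W1_def
    by (rule cINF_lower2[OF _ \<pi>]) (auto intro!: bdd_belowI2[where m = 0] integral_nonneg)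
  also have "\<dots> = (\<integral>w. dist (X w) (Y w) \<partial>P)"
    by (subst integral_distr) auto
  finally show "W1 euclidean_metric (distr P borel X) (distr P borel Y) \<le> (\<integral>w. dist (X w) (Y w) \<partial>P)" .
qed

locale curve_law =
  fixes s r :: real and \<gamma> :: "(real \<Rightarrow> 'n::finite torus \<times> real) measure" and m :: "real \<Rightarrow> 'n torus measure"
  assumes P: "\<gamma> \<in> P1 (curves s r)"
    and m: "\<And>t. t \<in> {s..r} \<Longrightarrow> m t = distr \<gamma> borel (\<lambda>w. fst (w t))"
begin

sublocale prob_space \<gamma>
  using P1_sets(3)[OF P] .

lemma eval_measurable:
  assumes "t \<in> {s..r}"
  shows "(\<lambda>w. w t) \<in> \<gamma> \<rightarrow>\<^sub>M borel" "(\<lambda>w. fst (w t)) \<in> \<gamma> \<rightarrow>\<^sub>M borel" "(\<lambda>w. snd (w t)) \<in> \<gamma> \<rightarrow>\<^sub>M borel"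
proof -
  show *: "(\<lambda>w. w t) \<in> \<gamma> \<rightarrow>\<^sub>M borel"
    by (rule P1_curves_measurable[OF P continuous_map_eval[OF assms]])
  have "fst \<in> borel \<rightarrow>\<^sub>M (borel :: 'n torus measure)" "snd \<in> (borel :: ('n torus \<times> real) measure) \<rightarrow>\<^sub>M borel"
    by (auto intro!: borel_measurable_continuous_onI continuous_intros)
  then show "(\<lambda>w. fst (w t)) \<in> \<gamma> \<rightarrow>\<^sub>M borel" "(\<lambda>w. snd (w t)) \<in> \<gamma> \<rightarrow>\<^sub>M borel"
    using measurable_compose[OF *] by auto
qed

lemma marginal_P1: "t \<in> {s..r} \<Longrightarrow> m t \<in> P1 euclidean_metric"
  unfolding P1_torus_iff by (auto simp: m intro!: prob_space_distr eval_measurable)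

text \<open>The diagonal coupling costs nothing. This turns the joint Lipschitz bounds of
  \<open>f\<close> and \<open>g\<close> into bounds in the state alone along the flow.\<close>

lemma W1_marginal_self: "t \<in> {s..r} \<Longrightarrow> W1 euclidean_metric (m t) (m t) = 0"
  using W1_marginals_le[OF eval_measurable(2) eval_measurable(2), of t t] by (simp add: m)

text \<open>Evaluation at two times is a coupling whose cost tends to 0 by dominated convergence,
  since curves are continuous and torus distances bounded.\<close>

lemma W1_marginal_tendsto:
  assumes t: "t \<in> {s..r}" and \<tau>: "\<And>n. \<tau> n \<in> {s..r}" "\<tau> \<longlonglongrightarrow> t"
  shows "(\<lambda>n. W1 euclidean_metric (m t) (m (\<tau> n))) \<longlonglongrightarrow> 0"
proof (rule tendsto_sandwich[OF _ _ tendsto_const])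
  obtain B where B: "\<And>x y :: 'n torus. dist x y \<le> B" using bounded_dist_torus by blast
  note [measurable] = eval_measurable(2)[OF t] eval_measurable(2)[OF \<tau>(1)]
  have "(\<lambda>n. \<integral>w. dist (fst (w t)) (fst (w (\<tau> n))) \<partial>\<gamma>) \<longlonglongrightarrow> (\<integral>w. 0 \<partial>\<gamma>)"
  proof (rule integral_dominated_convergence[where w = "\<lambda>_. B"])
    have "(\<lambda>n. dist (fst (w t)) (fst (w (\<tau> n)))) \<longlonglongrightarrow> 0" if "w \<in> space \<gamma>" for w
    proof -
      have "continuous_on {s..r} w" using that P1_sets(2)[OF P] by (simp add: mspace_curves)
      then have "(\<lambda>n. w (\<tau> n)) \<longlonglongrightarrow> w t"
        using continuous_on_tendsto_compose[OF _ \<tau>(2) t] \<tau>(1) by simp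
      then have "(\<lambda>n. dist (fst (w t)) (fst (w (\<tau> n)))) \<longlonglongrightarrow> dist (fst (w t)) (fst (w t))"
        by (intro tendsto_intros)
      then show ?thesis by simp
    qed
    then show "AE w in \<gamma>. (\<lambda>n. dist (fst (w t)) (fst (w (\<tau> n)))) \<longlonglongrightarrow> 0" by (rule AE_I2)
    show "AE w in \<gamma>. norm (dist (fst (w t)) (fst (w (\<tau> n)))) \<le> B" for n
      using B by (intro AE_I2) auto
  qed auto
  then show "(\<lambda>n. \<integral>w. dist (fst (w t)) (fst (w (\<tau> n))) \<partial>\<gamma>) \<longlonglongrightarrow> 0" by simp
  show "\<forall>\<^sub>F n in sequentially. 0 \<le> W1 euclidean_metric (m t) (m (\<tau> n))"
    unfolding m[OF t] m[OF \<tau>(1)]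
    by (intro always_eventually allI W1_marginals_le eval_measurable t \<tau>(1))
  show "\<forall>\<^sub>F n in sequentially. W1 euclidean_metric (m t) (m (\<tau> n)) \<le> (\<integral>w. dist (fst (w t)) (fst (w (\<tau> n))) \<partial>\<gamma>)"
    unfolding m[OF t] m[OF \<tau>(1)]
    by (intro always_eventually allI W1_marginals_le eval_measurable t \<tau>(1))
qed

text \<open>The limit is used with \<open>m t\<close> as first argument of \<open>W1\<close>,
  matching the centre of the balls in \<open>P1_topology\<close>; symmetry of the distance does not
  enter.\<close>

lemma continuous_map_marginal: "continuous_map (top_of_set {s..r}) (P1_topology euclidean_metric) m"
  unfolding continuous_map_def
proof (intro conjI allI impI)
  show "m \<in> topspace (top_of_set {s..r}) \<rightarrow> topspace (P1_topology euclidean_metric)"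
    using marginal_P1 by simp
  fix S :: "'n torus measure set" assume "openin (P1_topology euclidean_metric) S"
  then have S: "\<And>M. M \<in> S \<Longrightarrow> \<exists>e>0. \<forall>N\<in>P1 euclidean_metric. W1 euclidean_metric M N < e \<longrightarrow> N \<in> S"
    unfolding openin_P1_topology by blast
  have "\<exists>d>0. \<forall>t'\<in>{s..r}. dist t' t < d \<longrightarrow> m t' \<in> S" if t: "t \<in> {s..r}" "m t \<in> S" for t
  proof (rule ccontr)
    assume "\<not> ?thesis"
    then have "\<exists>t'. t' \<in> {s..r} \<and> dist t' t < inverse (real (Suc n)) \<and> m t' \<notin> S" for n
      by (metis inverse_positive_iff_positive of_nat_0_less_iff zero_less_Suc)
    then obtain \<tau> where \<tau>: "\<And>n. \<tau> n \<in> {s..r}" "\<And>n. dist (\<tau> n) t < inverse (real (Suc n))" "\<And>n. m (\<tau> n) \<notin> S"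
      by metis
    have *: "norm (dist (\<tau> n) t) \<le> inverse (real (Suc n))" for n
      using less_imp_le[OF \<tau>(2)[of n]] by simp
    have "(\<lambda>n. dist (\<tau> n) t) \<longlonglongrightarrow> 0"
      by (rule Lim_null_comparison[OF always_eventually LIMSEQ_inverse_real_of_nat]) (rule allI, rule *)
    then have "\<tau> \<longlonglongrightarrow> t" by (rule tendsto_dist_iff[THEN iffD2])
    from W1_marginal_tendsto[OF t(1) \<tau>(1) this]
    have lim: "(\<lambda>n. W1 euclidean_metric (m t) (m (\<tau> n))) \<longlonglongrightarrow> 0" .
    obtain e where e: "e > 0" "\<And>N. N \<in> P1 euclidean_metric \<Longrightarrow> W1 euclidean_metric (m t) N < e \<Longrightarrow> N \<in> S"
      using S[OF t(2)] by blast
    obtain n where "W1 euclidean_metric (m t) (m (\<tau> n)) < e"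
      using order_tendstoD(2)[OF lim e(1)] by (auto simp: eventually_sequentially)
    then show False using e(2)[OF marginal_P1[OF \<tau>(1)]] \<tau>(3) by blast
  qed
  then show "openin (top_of_set {s..r}) {t \<in> topspace (top_of_set {s..r}). m t \<in> S}"
    unfolding openin_euclidean_subtopology_iff by auto
qed

lemma marginal_measure_flow: "m \<in> measure_flows euclidean_metric s r"
  unfolding measure_flows_def
proof (rule measurable_borel_ofI)
  show "m t \<in> topspace (P1_topology euclidean_metric)" if "t \<in> space (restrict_space borel {s..r})" for t
    using that marginal_P1 by (simp add: space_restrict_space)
  fix S :: "'n torus measure set" assume "openin (P1_topology euclidean_metric) S"
  then have "openin (top_of_set {s..r}) {t \<in> topspace (top_of_set {s..r}). m t \<in> S}"
    by (rule openin_continuous_map_preimage[OF continuous_map_marginal])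
  then obtain O' where "open O'" "{t \<in> {s..r}. m t \<in> S} = {s..r} \<inter> O'"
    by (auto simp: openin_open)
  moreover have "m -` S \<inter> space (restrict_space borel {s..r}) = {t \<in> {s..r}. m t \<in> S}"
    by (auto simp: space_restrict_space)
  ultimately show "m -` S \<inter> space (restrict_space borel {s..r}) \<in> sets (restrict_space borel {s..r})"
    by (auto simp: sets_restrict_space)
qed

lemma continuous_on_along_marginal:
  fixes h :: "real \<Rightarrow> 'n torus \<Rightarrow> 'n torus measure \<Rightarrow> 'u::metric_space \<Rightarrow> 'b::metric_space"
  assumes h: "continuous_map (prod_topology (top_of_set J) (prod_topology euclidean
        (prod_topology (P1_topology euclidean_metric) (top_of_set U)))) euclidean (\<lambda>(t, x, m, u). h t x m u)"
    and J: "{s..r} \<subseteq> J"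
  shows "continuous_on ({s..r} \<times> UNIV \<times> U) (\<lambda>(t, x, u). h t x (m t) u)"
proof -
  let ?A = "top_of_set ({s..r} \<times> (UNIV :: 'n torus set) \<times> U)"
  have 1: "continuous_map ?A (top_of_set {s..r}) (\<lambda>p. fst p)"
    by (simp add: continuous_map_in_subtopology) (auto intro!: continuous_intros)
  then have 2: "continuous_map ?A (top_of_set J) (\<lambda>p. fst p)"
    using J by (auto simp: continuous_map_in_subtopology)
  have 3: "continuous_map ?A euclidean (\<lambda>p. fst (snd p))"
    by (auto intro!: continuous_intros)
  have 4: "continuous_map ?A (P1_topology euclidean_metric) (\<lambda>p. m (fst p))"
    using continuous_map_compose[OF 1 continuous_map_marginal] by (simp add: o_def)
  have 5: "continuous_map ?A (top_of_set U) (\<lambda>p. snd (snd p))"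
    by (simp add: continuous_map_in_subtopology) (auto intro!: continuous_intros)
  have "continuous_map ?A euclidean ((\<lambda>(t, x, m, u). h t x m u) \<circ> (\<lambda>p. (fst p, fst (snd p), m (fst p), snd (snd p))))"
    by (intro continuous_map_compose[OF _ h] continuous_map_pairedI 2 3 4 5)
  then show ?thesis by (simp add: o_def case_prod_unfold)
qed

text \<open>The second component is dominated by the distance to a reference curve
  \<open>w0\<close>, integrable by the first moment in \<open>P1\<close>.\<close>

lemma integrable_eval:
  fixes \<phi> :: "'n torus \<Rightarrow>\<^sub>C real"
  assumes t: "t \<in> {s..r}"
  shows "integrable \<gamma> (\<lambda>w. \<phi> (fst (w t)) + snd (w t))"
proof -
  obtain w0 where w0: "w0 \<in> mspace (curves s r)" "integrable \<gamma> (\<lambda>w. mdist (curves s r) w0 w)"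
    using P by (auto simp: P1_def)
  have [measurable]: "apply_bcontfun \<phi> \<in> borel \<rightarrow>\<^sub>M borel"
    by (rule borel_measurable_continuous_onI) simp
  note [measurable] = eval_measurable[OF t]
  have "integrable \<gamma> (\<lambda>w. norm \<phi> + \<bar>snd (w0 t)\<bar> + mdist (curves s r) w0 w)"
    using w0(2) by simp
  then show ?thesis
  proof (rule Bochner_Integration.integrable_bound)
    show "AE w in \<gamma>. norm (\<phi> (fst (w t)) + snd (w t)) \<le> norm (norm \<phi> + \<bar>snd (w0 t)\<bar> + mdist (curves s r) w0 w)"
    proof (rule AE_I2)
      fix w assume "w \<in> space \<gamma>"
      then have w: "w \<in> mspace (curves s r)" using P1_sets(2)[OF P] by simp
      have "\<bar>\<phi> (fst (w t))\<bar> \<le> norm \<phi>" using norm_bounded[of \<phi> "fst (w t)"] by simp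
      moreover have "\<bar>snd (w t)\<bar> \<le> \<bar>snd (w0 t)\<bar> + mdist (curves s r) w0 w"
        using mdist_curves_ge(2)[OF w0(1) w t] zero_le_dist[of "fst (w0 t)" "fst (w t)"]
        unfolding dist_real_def by linarith
      ultimately show "norm (\<phi> (fst (w t)) + snd (w t)) \<le> norm (norm \<phi> + \<bar>snd (w0 t)\<bar> + mdist (curves s r) w0 w)"
        by simp
    qed
  qed simp
qed

lemma payoff_pairing_eval:
  fixes \<phi> :: "'n torus \<Rightarrow>\<^sub>C real"
  assumes t: "t \<in> {s..r}"
  shows "payoff_pairing \<phi> (distr \<gamma> borel (\<lambda>w. w t)) = (\<integral>w. \<phi> (fst (w t)) + snd (w t) \<partial>\<gamma>)"
  unfolding payoff_pairing_def
proof (rule integral_distr[OF eval_measurable(1)[OF t]])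
  show "(\<lambda>p. \<phi> (fst p) + snd p) \<in> borel_measurable borel"
  proof (rule borel_measurable_continuous_onI)
    have "continuous_on UNIV (\<lambda>p :: 'n torus \<times> real. \<phi> (fst p))"
      by (rule continuous_on_compose2[of UNIV "apply_bcontfun \<phi>"]) (auto intro!: continuous_intros)
    then show "continuous_on UNIV (\<lambda>p. \<phi> (fst p) + snd p)"
      by (intro continuous_intros)
  qed
qed

end

section \<open>The verification theorem\<close>

text \<open>A sign on a set of full measure and a nonpositive mean force \<open>h = 0\<close> almost
  everywhere. The set where \<open>h > 0\<close> is open and null, so it misses the support.\<close>

lemma measure_supp_eq_0_of_integral:
  fixes h :: "(real \<Rightarrow> 'n::finite torus \<times> real) \<Rightarrow> real"
  assumes P: "\<gamma> \<in> P1 (curves s r)" and h: "continuous_map (mtopology_of (curves s r)) euclidean h"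
    and nonneg: "\<And>w. w \<in> measure_supp (curves s r) \<gamma> \<Longrightarrow> 0 \<le> h w"
    and int: "integrable \<gamma> h" "(\<integral>w. h w \<partial>\<gamma>) \<le> 0"
    and w: "w \<in> measure_supp (curves s r) \<gamma>"
  shows "h w = 0"
proof (rule ccontr)
  assume "h w \<noteq> 0"
  then have "h w > 0" using nonneg[OF w] by simp
  have AE_nonneg: "AE w in \<gamma>. 0 \<le> h w"
    using AE_measure_supp_curves[OF P] by eventually_elim (rule nonneg)
  then have "(\<integral>w. h w \<partial>\<gamma>) = 0" using int(2) integral_nonneg_AE[OF AE_nonneg] by simp
  then have "AE w in \<gamma>. h w = 0"
    using integral_nonneg_eq_0_iff_AE[OF int(1) AE_nonneg] by simp
  define S where "S = {w \<in> mspace (curves s r). h w \<in> {0<..}}"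
  have S: "openin (mtopology_of (curves s r)) S"
    using openin_continuous_map_preimage[OF h, of "{0<..}"] by (simp add: S_def)
  then have "S \<in> sets \<gamma>" using P1_sets(1)[OF P] openin_sets_borel_of by blast
  moreover have "AE w in \<gamma>. w \<notin> S"
    using \<open>AE w in \<gamma>. h w = 0\<close> by eventually_elim (simp add: S_def)
  ultimately have "emeasure \<gamma> S = 0"
    using AE_iff_null_sets[of S \<gamma>] by (simp add: null_sets_def)
  moreover have "w \<in> S" using w \<open>h w > 0\<close> by (simp add: S_def measure_supp_def)
  ultimately show False
    using w S by (auto simp: measure_supp_def)
qed

theorem theorem1:
  fixes T L \<kappa> :: real
    and U :: "'u::metric_space set"
    and f :: "real \<Rightarrow> 'n::finite torus \<Rightarrow> 'n torus measure \<Rightarrow> 'u \<Rightarrow> real ^ 'n"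
    and g :: "real \<Rightarrow> 'n torus \<Rightarrow> 'n torus measure \<Rightarrow> 'u \<Rightarrow> real"
    and \<sigma> :: "'n torus \<Rightarrow> 'n torus measure \<Rightarrow> real"
    and \<alpha> :: "real \<Rightarrow> real"
    and \<V> :: "real \<Rightarrow> 'n torus measure \<Rightarrow> ('n torus \<Rightarrow>\<^sub>C real) set"
  assumes T: "T > 0"
    and U: "compact U"
    and f_cont: "continuous_map
      (prod_topology (top_of_set {0..T}) (prod_topology euclidean
        (prod_topology (P1_topology euclidean_metric) (top_of_set U))))
      euclidean (\<lambda>(t, x, m, u). f t x m u)"
    and g_cont: "continuous_map
      (prod_topology (top_of_set {0..T}) (prod_topology euclidean
        (prod_topology (P1_topology euclidean_metric) (top_of_set U))))
      euclidean (\<lambda>(t, x, m, u). g t x m u)"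
    and \<sigma>_cont: "continuous_map (prod_topology euclidean (P1_topology euclidean_metric))
      euclidean (\<lambda>(x, m). \<sigma> x m)"
    and \<alpha>_nonneg: "\<And>\<delta>. \<alpha> \<delta> \<ge> 0"
    and \<alpha>_lim: "(\<alpha> \<longlongrightarrow> 0) (at 0)"
    and f_time: "\<And>t' t'' x m u. t' \<in> {0..T} \<Longrightarrow> t'' \<in> {0..T} \<Longrightarrow> m \<in> P1 euclidean_metric \<Longrightarrow>
      u \<in> U \<Longrightarrow> norm (f t' x m u - f t'' x m u) \<le> \<alpha> (t' - t'')"
    and g_time: "\<And>t' t'' x m u. t' \<in> {0..T} \<Longrightarrow> t'' \<in> {0..T} \<Longrightarrow> m \<in> P1 euclidean_metric \<Longrightarrow>
      u \<in> U \<Longrightarrow> \<bar>g t' x m u - g t'' x m u\<bar> \<le> \<alpha> (t' - t'')"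
    and f_lipschitz: "\<And>t x' x'' m' m'' u. t \<in> {0..T} \<Longrightarrow> m' \<in> P1 euclidean_metric \<Longrightarrow>
      m'' \<in> P1 euclidean_metric \<Longrightarrow> u \<in> U \<Longrightarrow>
      norm (f t x' m' u - f t x'' m'' u) \<le> L * (dist x' x'' + W1 euclidean_metric m' m'')"
    and g_lipschitz: "\<And>t x' x'' m' m'' u. t \<in> {0..T} \<Longrightarrow> m' \<in> P1 euclidean_metric \<Longrightarrow>
      m'' \<in> P1 euclidean_metric \<Longrightarrow> u \<in> U \<Longrightarrow>
      \<bar>g t x' m' u - g t x'' m'' u\<bar> \<le> L * (dist x' x'' + W1 euclidean_metric m' m'')"
    and \<sigma>_lipschitz: "\<And>x' x'' m. m \<in> P1 euclidean_metric \<Longrightarrow>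
      \<bar>\<sigma> x' m - \<sigma> x'' m\<bar> \<le> \<kappa> * dist x' x''"
    and usc: "upper_semicontinuous T \<V>"
    and viable: "viable T f g U \<V>"
    and terminal: "\<And>m. m \<in> P1 euclidean_metric \<Longrightarrow> \<V> T m = {Bcontfun (\<lambda>x. \<sigma> x m)}"
  shows "value_multifunction T f g U \<sigma> \<V>"
  unfolding value_multifunction_def
proof (intro conjI ballI usc)
  fix t0 m0 \<phi> assume t0: "t0 \<in> {0..T}" and m0: "m0 \<in> P1 euclidean_metric" and \<phi>: "\<phi> \<in> \<V> t0 m0"
  have T': "T \<in> {0..T}" "t0 \<le> T" "{t0..T} \<subseteq> {0..T}" "T \<in> {t0..T}" "t0 \<in> {t0..T}" using T t0 by auto
  obtain \<mu> \<psi> where \<mu>: "\<mu> \<in> P1 euclidean_metric" and dyn: "(\<mu>, \<psi>) \<in> MFG_dynamics f g U T t0 m0 \<phi>" and "\<psi> \<in> \<V> T \<mu>"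
    using viable t0 T' m0 \<phi> unfolding viable_def by blast
  then have "\<psi> = Bcontfun (\<lambda>x. \<sigma> x \<mu>)" using terminal by blast
  \<comment> \<open>\<open>Bcontfun\<close> returns the given function only if it is continuous and
    bounded; on the compact torus continuity is the condition to check.\<close>
  moreover have "continuous_on UNIV (\<lambda>x. \<sigma> x \<mu>)"
  proof -
    have "\<bar>\<sigma> x \<mu> - \<sigma> x' \<mu>\<bar> \<le> \<bar>\<kappa>\<bar> * dist x x'" for x x'
      using \<sigma>_lipschitz[OF \<mu>, of x x'] mult_right_mono[OF abs_ge_self zero_le_dist, of \<kappa> x x'] by linarith
    then have "\<bar>\<kappa>\<bar>-lipschitz_on UNIV (\<lambda>x. \<sigma> x \<mu>)" by (intro lipschitz_onI) (auto simp: dist_real_def)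
    then show ?thesis by (rule lipschitz_on_continuous_on)
  qed
  ultimately have \<psi>: "apply_bcontfun \<psi> = (\<lambda>x. \<sigma> x \<mu>)" by (simp add: apply_bcontfun_torus)
  obtain \<nu> where \<nu>: "solves_MFDI f g U t0 T \<nu>" "distr (\<nu> t0) borel fst = m0" "distr (\<nu> T) borel fst = \<mu>"
    "apply_bcontfun \<phi> = bellman f g U t0 T (\<lambda>t. distr (\<nu> t) borel fst) \<psi>"
    "payoff_pairing \<psi> (\<nu> T) \<ge> payoff_pairing \<phi> (\<nu> t0)"
    using dyn by (auto simp: MFG_dynamics_def)
  define m where "m = (\<lambda>t. distr (\<nu> t) borel fst)"
  obtain \<gamma> where P: "\<gamma> \<in> P1 (curves t0 T)" and \<nu>\<gamma>: "\<And>t. t \<in> {t0..T} \<Longrightarrow> \<nu> t = distr \<gamma> borel (\<lambda>w. w t)"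
    and supp: "measure_supp (curves t0 T) \<gamma> \<subseteq> SOL f g U T t0 m"
    using \<nu>(1) by (auto simp: solves_MFDI_def m_def)
  interpret curve_law t0 T \<gamma> m
  proof
    fix t assume t: "t \<in> {t0..T}"
    have "(\<lambda>w. w t) \<in> \<gamma> \<rightarrow>\<^sub>M borel"
      by (rule P1_curves_measurable[OF P continuous_map_eval[OF t]])
    moreover have "fst \<in> (borel :: ('n torus \<times> real) measure) \<rightarrow>\<^sub>M borel"
      by (auto intro!: borel_measurable_continuous_onI continuous_intros)
    ultimately show "m t = distr \<gamma> borel (\<lambda>w. fst (w t))"
      by (simp add: m_def \<nu>\<gamma>[OF t] distr_distr o_def)
  qed (rule P)
  \<comment> \<open>One \<open>L\<close> for each of \<open>f\<close> and \<open>g\<close>, since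
    the product distance is at most the sum; the absolute value supplies nonnegativity.\<close>
  interpret mean_field_flow f g U m t0 T "2 * \<bar>L\<bar>"
  proof
    show "continuous_on ({t0..T} \<times> UNIV \<times> U) (\<lambda>(t, x, u). (f t x (m t) u, g t x (m t) u))"
      using continuous_on_Pair[OF continuous_on_along_marginal[OF f_cont T'(3)] continuous_on_along_marginal[OF g_cont T'(3)]]
      by (simp add: case_prod_unfold)
    fix t x x' u assume t: "t \<in> {t0..T}" and u: "u \<in> U"
    have t': "t \<in> {0..T}" using t T' by blast
    have "dist (f t x (m t) u, g t x (m t) u) (f t x' (m t) u, g t x' (m t) u) \<le>
        dist (f t x (m t) u) (f t x' (m t) u) + dist (g t x (m t) u) (g t x' (m t) u)"
      unfolding dist_prod_def by (simp add: sqrt_sum_squares_le_sum)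
    also have "\<dots> \<le> L * dist x x' + L * dist x x'"
      using f_lipschitz[OF t' marginal_P1[OF t] marginal_P1[OF t] u, of x x']
        g_lipschitz[OF t' marginal_P1[OF t] marginal_P1[OF t] u, of x x']
      unfolding W1_marginal_self[OF t] by (intro add_mono) (simp_all add: dist_norm)
    also have "\<dots> \<le> 2 * \<bar>L\<bar> * dist x x'"
      using mult_right_mono[OF abs_ge_self zero_le_dist, of L x x'] by simp
    finally show "dist (f t x (m t) u, g t x (m t) u) (f t x' (m t) u, g t x' (m t) u) \<le> 2 * \<bar>L\<bar> * dist x x'" .
  qed (use U in auto)
  have lift: "\<exists>W. traj 0 t0 T W \<and> (\<forall>t\<in>{t0..T}. w t = proj (W t))" if ws: "w \<in> measure_supp (curves t0 T) \<gamma>" for w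
  proof -
    obtain y where w: "w \<in> Sol f g U T t0 y m" using supp ws by (auto simp: SOL_def)
    show ?thesis
      by (rule Sol_lift[OF w]) (use T' in auto)
  qed
  interpret mean_field_value f g U m t0 T "2 * \<bar>L\<bar>" \<psi> "\<bar>\<kappa>\<bar>"
  proof
    show "\<bar>\<psi> x - \<psi> x'\<bar> \<le> \<bar>\<kappa>\<bar> * dist x x'" for x x'
      unfolding \<psi> using \<sigma>_lipschitz[OF \<mu>, of x x'] mult_right_mono[OF abs_ge_self zero_le_dist, of \<kappa> x x'] by linarith
    \<comment> \<open>A set of full measure under a probability is nonempty; a curve in the support
      lifts to the trajectory that starts the existence argument.\<close>
    have "\<exists>w. w \<in> measure_supp (curves t0 T) \<gamma>"
    proof (rule ccontr)
      assume "\<nexists>w. w \<in> measure_supp (curves t0 T) \<gamma>"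
      then have "AE w in \<gamma>. False" using AE_measure_supp_curves[OF P] by simp
      then show False by (simp add: AE_False)
    qed
    then show "\<exists>W. traj 0 t0 T W" using lift by blast
  qed simp
  have mT: "m T = \<mu>" and mt0: "m t0 = m0" using \<nu> by (auto simp: m_def)
  have val_t0: "val t0 = apply_bcontfun \<phi>" using \<nu>(4) by (simp add: m_def)
  \<comment> \<open>On the interval \<open>{T..T}\<close> a trajectory is its starting point, so the
    value is the terminal payoff.\<close>
  have val_T: "val T y = \<psi> y" for y
  proof -
    obtain x where x: "torus_of x = y" using torus_of_surj by blast
    show ?thesis using optimal_traj[OF T'(4), of "(x, 0)"] x by (auto simp: payoff_def)
  qed
  have decr: "val r' (fst (w r')) + snd (w r') \<le> val s (fst (w s)) + snd (w s)"
    if w: "w \<in> measure_supp (curves t0 T) \<gamma>" and s: "t0 \<le> s" "s \<le> r'" "r' \<le> T" for w s r'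
  proof -
    obtain W where W: "traj 0 t0 T W" "\<forall>t\<in>{t0..T}. w t = proj (W t)" using lift[OF w] by blast
    have "traj 0 s r' W" using traj_restrict[OF W(1)] s by simp
    from value_decreasing[OF this s] show ?thesis using W(2) s by (simp add: proj_def)
  qed
  \<comment> \<open>The loss between \<open>t0\<close> and \<open>T\<close>, written with
    \<open>\<phi>\<close> and \<open>\<psi>\<close> so that its mean is the difference of the
    pairings compared in \<open>MFG_dynamics\<close>.\<close>
  define h where "h w = (\<phi> (fst (w t0)) + snd (w t0)) - (\<psi> (fst (w T)) + snd (w T))" for w
  have h0: "h w = 0" if w: "w \<in> measure_supp (curves t0 T) \<gamma>" for w
  proof (rule measure_supp_eq_0_of_integral[OF P _ _ _ _ w])
    have "continuous_map (mtopology_of (curves t0 T)) euclidean ((\<lambda>p. \<theta> (fst p) + snd p) \<circ> (\<lambda>w. w t))"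
      if t: "t \<in> {t0..T}" for t and \<theta> :: "'n torus \<Rightarrow>\<^sub>C real"
    proof (rule continuous_map_compose[OF continuous_map_eval[OF t]])
      have "continuous_on UNIV (\<lambda>p :: 'n torus \<times> real. \<theta> (fst p))"
        by (rule continuous_on_compose2[of UNIV "apply_bcontfun \<theta>"]) (auto intro!: continuous_intros)
      then show "continuous_map euclidean euclidean (\<lambda>p :: 'n torus \<times> real. \<theta> (fst p) + snd p)"
        by (simp add: continuous_on_add continuous_on_snd)
    qed
    then show "continuous_map (mtopology_of (curves t0 T)) euclidean h"
      unfolding h_def[abs_def] using T' by (intro continuous_map_diff) (simp_all add: o_def)
    show "0 \<le> h w" if "w \<in> measure_supp (curves t0 T) \<gamma>" for w
      using decr[OF that order_refl T'(2) order_refl] by (simp add: h_def val_t0 val_T)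
    show "integrable \<gamma> h"
      unfolding h_def[abs_def] by (intro Bochner_Integration.integrable_diff integrable_eval T')
    have "(\<integral>w. h w \<partial>\<gamma>) = payoff_pairing \<phi> (\<nu> t0) - payoff_pairing \<psi> (\<nu> T)"
      unfolding h_def \<nu>\<gamma>[OF T'(4)] \<nu>\<gamma>[OF T'(5)] payoff_pairing_eval[OF T'(4)] payoff_pairing_eval[OF T'(5)]
      by (rule Bochner_Integration.integral_diff[OF integrable_eval[OF T'(5)] integrable_eval[OF T'(4)]])
    then show "(\<integral>w. h w \<partial>\<gamma>) \<le> 0" using \<nu>(5) by simp
  qed
  have "MFG_solution T f g U \<sigma> t0 val m"
    unfolding MFG_solution_def
  proof (intro conjI bexI[OF _ P] ballI allI impI)
    show "continuous_on ({t0..T} \<times> UNIV) (\<lambda>(t, x). val t x)" by (rule continuous_on_value)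
    show "m \<in> measure_flows euclidean_metric t0 T" by (rule marginal_measure_flow)
    show "m t = distr \<gamma> borel (\<lambda>w. fst (w t))" if "t \<in> {t0..T}" for t using that by (rule m)
    show "\<exists>w\<in>Sol f g U T s y m. val s y = \<sigma> (fst (w T)) (m T) + snd (w T) - snd (w s)"
      if "s \<in> {t0..T}" for s y
      using bellman_attained[OF that, of y] unfolding \<psi> mT by blast
    show "\<sigma> (fst (w T)) (m T) + snd (w T) - snd (w s) \<le> val s y"
      if "s \<in> {t0..T}" "w \<in> Sol f g U T s y m" for s y w
      using bellman_attained[OF that(1), of y] that(2) unfolding \<psi> mT by blast
    show "measure_supp (curves t0 T) \<gamma> \<subseteq> SOL f g U T t0 m" by (rule supp)
    show "val s (fst (w s)) + snd (w s) = val r' (fst (w r')) + snd (w r')"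
      if sr: "s \<in> {t0..T}" "r' \<in> {t0..T}" "s < r'" and w: "w \<in> measure_supp (curves t0 T) \<gamma>" for s r' w
    proof -
      \<comment> \<open>The values at \<open>s\<close> and \<open>r'\<close> are squeezed between
        those at \<open>t0\<close> and \<open>T\<close>, which coincide.\<close>
      have "val s (fst (w s)) + snd (w s) \<le> val t0 (fst (w t0)) + snd (w t0)"
        using sr by (intro decr[OF w]) auto
      also have "\<dots> = val T (fst (w T)) + snd (w T)"
        using h0[OF w] by (simp add: h_def val_t0 val_T)
      also have "\<dots> \<le> val r' (fst (w r')) + snd (w r')"
        using sr by (intro decr[OF w]) auto
      finally show ?thesis using decr[OF w, of s r'] sr by auto
    qed
  qed
  with val_t0 mt0 show "\<exists>V m. MFG_solution T f g U \<sigma> t0 V m \<and> V t0 = apply_bcontfun \<phi> \<and> m t0 = m0"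
    by blast
qed

end
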